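(* Fix $\beta\in(0,1)$. Let $D_\beta=\{(x,y)\in\mathbb R^2:0\le x\le y\le1,\ y=\beta\text{ or }x=\beta\}$; the restriction of $L$ to $D_\beta$ is a continuous strictly increasing (along $D_\beta$, first along $y=\beta$ from $x=0$ to $x=\beta$, then along $x=\beta$ from $y=\beta$ to $y=1$) bijection onto its image, and for $\alpha$ in that image define $\mathfrak f_\beta(\alpha)=y-x$ where $(x,y)\in D_\beta$ is the point with $L(x,y)=\alpha$. Define \[\mathfrak t_\beta(\alpha)=\begin{cases}\beta,&0\le\alpha\le\frac{1-\sqrt{1-\beta^2}}2,\\ \mathfrak f_\beta(\alpha),&\frac{1-\sqrt{1-\beta^2}}2<\alpha<\frac{1+\sqrt{2\beta-\beta^2}}2,\\ 1-\beta,&\frac{1+\sqrt{2\beta-\beta^2}}2\le\alpha\le1.\end{cases}\] Let $\mathcal R^{132}_n$ be the set of $n$-element 132-avoiding sorting networks with uniform measure $\mathbb P_n$. Then for all $\epsilon>0$ \[\lim_{n\to\infty}\mathbb P_n\Big(w\in\mathcal R^{132}_n:\sup_{0\le\alpha\le1}|f_{w,\lfloor\beta n\rfloor}(\alpha)-\mathfrak t_\beta(\alpha)|>\epsilon\Big)=0.\]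
   Context: Sorting networks, intermediate permutations $\sigma_k$ (in one-line notation, $\sigma_k$ is $\sigma_{k-1}$ with entries in positions $w_k,w_k+1$ swapped, $\sigma_0=\mathrm{id}$, $N=\binom n2$), and 132-avoidance (every $\sigma_k$ avoids 132) as usual. Scaled trajectory: $f_{w,i}(\alpha)=\sigma^{-1}_{\alpha N}(i)/n$ for $\alpha N\in\mathbb Z$, linear interpolation otherwise. The surface $L$: for $0<\alpha<1/2$ let \[g_\alpha(u)=\frac{2u}{\pi}\tan^{-1}\Big(\frac{(1-2\alpha)u}{\sqrt{2\alpha(1-\alpha)-u^2}}\Big)+\frac{\sqrt2}{\pi}\tan^{-1}\Big(\frac{\sqrt{2(2\alpha(1-\alpha)-u^2)}}{1-2\alpha}\Big)\] on $|u|\le\sqrt{2\alpha(1-\alpha)}$ (endpoint values by continuity, equal to $|u|$); for $1/2<\alpha<1$, $g_\alpha=\sqrt2-g_{1-\alpha}$ on $|u|\le\sqrt{2\alpha(1-\alpha)}$; $g_{1/2}\equiv\sqrt2/2$ on $|u|\le\sqrt2/2$. On $D=\{(u,v):-\sqrt2/2\le u\le0,\ |u|\le v\le\sqrt2-|u|\}$ the curves $\{v=g_\alpha(u),|u|\le\sqrt{2\alpha(1-\alpha)}\}$, $\alpha\in(0,1)$, are disjoint and cover $D\setminus\{(0,0),(0,\sqrt2)\}$; $\overline L(u,v)$ is the index $\alpha$ of the curve through $(u,v)$, with $\overline L(0,0)=0$, $\overline L(0,\sqrt2)=1$; and $L(x,y)=\overline L\big(\frac{x-y}{\sqrt2},\frac{x+y}{\sqrt2}\big)$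 for $0\le x\le y\le1$. *)

theory Defs
  imports "HOL-Analysis.Analysis"
begin

text \<open>Permutations of {1..n} in one-line notation, as functions nat => nat
  (identity outside {1..n}).  Swapping the entries in positions p, p+1.\<close>
definition swap_adj :: "(nat \<Rightarrow> nat) \<Rightarrow> nat \<Rightarrow> (nat \<Rightarrow> nat)" where
  "swap_adj \<sigma> p = (\<lambda>j. if j = p then \<sigma> (p + 1) else if j = p + 1 then \<sigma> p else \<sigma> j)"

definition sigma :: "nat list \<Rightarrow> nat \<Rightarrow> (nat \<Rightarrow> nat)" where
  "sigma w k = foldl swap_adj id (take k w)"

definition sorting_network :: "nat \<Rightarrow> nat list \<Rightarrow> bool" where
  "sorting_network n w \<longleftrightarrow> length w = n choose 2 \<and> set w \<subseteq> {1..n-1}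
     \<and> (\<forall>i\<in>{1..n}. sigma w (n choose 2) i = n + 1 - i)"

definition avoids132 :: "nat \<Rightarrow> (nat \<Rightarrow> nat) \<Rightarrow> bool" where
  "avoids132 n \<sigma> \<longleftrightarrow> \<not> (\<exists>i j k. 1 \<le> i \<and> i < j \<and> j < k \<and> k \<le> n \<and> \<sigma> i < \<sigma> k \<and> \<sigma> k < \<sigma> j)"

definition R132 :: "nat \<Rightarrow> nat list set" where
  "R132 n = {w. sorting_network n w \<and> (\<forall>k \<le> n choose 2. avoids132 n (sigma w k))}"

definition sigma_inv :: "nat \<Rightarrow> nat list \<Rightarrow> nat \<Rightarrow> nat \<Rightarrow> nat" where
  "sigma_inv n w k i = (THE j. j \<in> {1..n} \<and> sigma w k j = i)"

definition traj :: "nat \<Rightarrow> nat list \<Rightarrow> nat \<Rightarrow> real \<Rightarrow> real" where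
  "traj n w i \<alpha> =
     (let N = n choose 2; t = \<alpha> * real N; k = nat \<lfloor>t\<rfloor>; s = t - real k in
       (1 - s) * real (sigma_inv n w k i) / real n + s * real (sigma_inv n w (k + 1) i) / real n)"

definition g_low :: "real \<Rightarrow> real \<Rightarrow> real" where
  "g_low \<alpha> u = (if u\<^sup>2 = 2 * \<alpha> * (1 - \<alpha>) then \<bar>u\<bar> else
      2 * u / pi * arctan ((1 - 2 * \<alpha>) * u / sqrt (2 * \<alpha> * (1 - \<alpha>) - u\<^sup>2))
      + sqrt 2 / pi * arctan (sqrt (2 * (2 * \<alpha> * (1 - \<alpha>) - u\<^sup>2)) / (1 - 2 * \<alpha>)))"

definition g :: "real \<Rightarrow> real \<Rightarrow> real" where
  "g \<alpha> u = (if \<alpha> < 1/2 then g_low \<alpha> u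
            else if \<alpha> = 1/2 then sqrt 2 / 2
            else sqrt 2 - g_low (1 - \<alpha>) u)"

definition Lbar :: "real \<Rightarrow> real \<Rightarrow> real" where
  "Lbar u v = (if u = 0 \<and> v = 0 then 0
               else if u = 0 \<and> v = sqrt 2 then 1
               else (THE \<alpha>. 0 < \<alpha> \<and> \<alpha> < 1 \<and> \<bar>u\<bar> \<le> sqrt (2 * \<alpha> * (1 - \<alpha>)) \<and> v = g \<alpha> u))"

definition L :: "real \<Rightarrow> real \<Rightarrow> real" where
  "L x y = Lbar ((x - y) / sqrt 2) ((x + y) / sqrt 2)"

definition D_beta :: "real \<Rightarrow> (real \<times> real) set" where
  "D_beta \<beta> = {(x, y). 0 \<le> x \<and> x \<le> y \<and> y \<le> 1 \<and> (y = \<beta> \<or> x = \<beta>)}"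

definition frak_f :: "real \<Rightarrow> real \<Rightarrow> real" where
  "frak_f \<beta> \<alpha> = (THE d. \<exists>x y. (x, y) \<in> D_beta \<beta> \<and> L x y = \<alpha> \<and> d = y - x)"

definition frak_t :: "real \<Rightarrow> real \<Rightarrow> real" where
  "frak_t \<beta> \<alpha> =
     (if \<alpha> \<le> (1 - sqrt (1 - \<beta>\<^sup>2)) / 2 then \<beta>
      else if \<alpha> < (1 + sqrt (2 * \<beta> - \<beta>\<^sup>2)) / 2 then frak_f \<beta> \<alpha>
      else 1 - \<beta>)"

end

theory Submission
  imports Defs "HOL-Computational_Algebra.Polynomial_FPS"
begin

text \<open>A 132-avoiding sorting network amounts to a standard filling of the shifted staircase: the
  state after \<open>k\<close> swaps is a strict partition of \<open>k\<close> with parts below \<open>n\<close>, and its numbers of parts of given minimal size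
  (the tail function) determine the position of every entry. Read backwards, the
  uniform network is a Markov chain that removes a cell with probability given by Schur's product
  formula; by partial fractions the conditional drifts of the moments \<open>\<Sum> (s + 1/2)\<^bsup>2j\<^esup> - (s - 1/2)\<^bsup>2j\<^esup>\<close>
  over the parts \<open>s\<close> are values of a Newton recursion in these moments. The drifts contract towards an
  explicit deterministic solution, so a mean square estimate going backwards from the full staircase
  shows that the scaled moments concentrate. Even polynomials determine the tail function on \<open>[0, 1]\<close>,
  and the limit profile with these moments has the surface \<open>L\<close> as its level curves. Monotonicity in
  time and space makes the convergence uniform, and compactness transfers it to trajectories.\<close>

text \<open>The half-integer shifts and even powers are dictated by the removal probabilities. With
  \<open>a t = (t - 1/2)^2\<close> and \<open>b t = (t + 1/2)^2\<close>, each factor in the ratio of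
  two Schur products equals \<open>(a s - b t) / (a s - a t)\<close>. Up to a common factor the
  probabilities are therefore residues of the single rational function with factors
  \<open>(1 - b t X) / (1 - a t X)\<close>. Its logarithmic derivative has the moments as
  coefficients, so the drift of a moment involves only moments of the same or lower order and the
  system closes. The drift carries a factor \<open>1 / k\<close>, singular at the empty shape. The
  estimate therefore starts at the full staircase, whose moments are explicit, and stops at times
  \<open>k\<close> of order \<open>n^2\<close>; earlier times are reached through monotonicity of
  the tail in time. An entry \<open>i\<close> sits either where the tail function equals
  \<open>i\<close> or where position plus tail equals \<open>i\<close>. These two alternatives
  become the arms \<open>x = \<beta>\<close> and \<open>y = \<beta>\<close> of
  \<open>D_beta\<close>, so the limit trajectory is a root of an equation in the profile, and
  stability of this root follows from its uniqueness.\<close>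

section \<open>Strict partitions as states and the permutations they encode\<close>

definition push :: "nat set \<Rightarrow> nat \<Rightarrow> nat set" where
  "push S p = insert p (S - {p - 1})"

text \<open>Parts of size 0 are never stored, so \<open>p = 1\<close> starts a new row and has no
  predecessor in \<open>S\<close>.\<close>

definition can_push :: "nat set \<Rightarrow> nat \<Rightarrow> bool" where
  "can_push S p \<longleftrightarrow> 1 \<le> p \<and> p \<notin> S \<and> (p = 1 \<or> p - 1 \<in> S)"

primrec valid :: "nat set \<Rightarrow> nat list \<Rightarrow> bool" where
  "valid S [] \<longleftrightarrow> True"
| "valid S (p # w) \<longleftrightarrow> can_push S p \<and> valid (push S p) w"

definition shape :: "nat list \<Rightarrow> nat set" where
  "shape w = foldl push {} w"

definition tail_count :: "nat set \<Rightarrow> nat \<Rightarrow> nat" where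
  "tail_count S r = card {s \<in> S. r \<le> s}"

text \<open>If the parts are listed in decreasing order, entry \<open>j\<close> sits one position to
  the right of the size of the \<open>j\<close>-th part, and \<open>tail_count S (p - 1)\<close> is
  the rank \<open>j\<close> of the part \<open>p - 1\<close>. All larger entries fill the remaining
  positions in increasing order.\<close>

definition perm_of :: "nat set \<Rightarrow> nat \<Rightarrow> nat" where
  "perm_of S p = (if p - 1 \<in> S then tail_count S (p - 1) else p + tail_count S p)"

lemma valid_append: "valid S (u @ v) \<longleftrightarrow> valid S u \<and> valid (foldl push S u) v"
  by (induction u arbitrary: S) auto

lemma push_props:
  assumes "finite S" "0 \<notin> S" "can_push S p"
  shows "finite (push S p)" "0 \<notin> push S p" "\<Sum>(push S p) = Suc (\<Sum>S)"
proof -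
  show "finite (push S p)" "0 \<notin> push S p"
    using assms by (auto simp: push_def can_push_def)
  show "\<Sum>(push S p) = Suc (\<Sum>S)"
  proof (cases "p - 1 \<in> S")
    case True
    have "\<Sum>S = (p - 1) + \<Sum>(S - {p - 1})"
      using assms(1) True by (simp add: sum.remove)
    moreover have "\<Sum>(push S p) = p + \<Sum>(S - {p - 1})"
      using assms unfolding push_def by (subst sum.insert) (auto simp: can_push_def)
    ultimately show ?thesis using assms(3) by (simp add: can_push_def)
  next
    case False
    then have "p = 1" using assms(3) by (simp add: can_push_def)
    then show ?thesis using assms by (auto simp: push_def can_push_def)
  qed
qed

lemma foldl_push_props:
  assumes "finite S" "0 \<notin> S" "valid S w"
  shows "finite (foldl push S w) \<and> 0 \<notin> foldl push S w \<and> \<Sum>(foldl push S w) = \<Sum>S + length w"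
  using assms
proof (induction w arbitrary: S)
  case (Cons p w)
  then show ?case using push_props[of S p] by auto
qed simp

lemma shape_props:
  assumes "valid {} w"
  shows "finite (shape w)" "0 \<notin> shape w" "\<Sum>(shape w) = length w"
  using foldl_push_props[of "{}" w] assms by (auto simp: shape_def)

lemma valid_take: "valid S w \<Longrightarrow> valid S (take k w)"
  by (metis append_take_drop_id valid_append)

text \<open>Parts never shrink and every letter is the size of a part just created, so a bound on
  the final shape controls the whole history.\<close>

lemma foldl_push_bounded:
  assumes "foldl push S w \<subseteq> {..<n}" "valid S w"
  shows "S \<subseteq> {..<n} \<and> set w \<subseteq> {..<n}"
  using assms
proof (induction w arbitrary: S)
  case (Cons p w)
  then have *: "push S p \<subseteq> {..<n}" "set w \<subseteq> {..<n}" by auto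
  then have "p < n" by (auto simp: push_def)
  have "S \<subseteq> {..<n}"
  proof
    fix x assume "x \<in> S"
    show "x \<in> {..<n}"
    proof (cases "x = p - 1")
      case True then show ?thesis using \<open>p < n\<close> by simp
    next
      case False
      then have "x \<in> push S p" using \<open>x \<in> S\<close> by (simp add: push_def)
      then show ?thesis using * by auto
    qed
  qed
  then show ?case using * \<open>p < n\<close> by auto
qed simp

text \<open>Growing \<open>p - 1\<close> to \<open>p\<close> is seen only at threshold
  \<open>p\<close>. A new part 1 is counted at thresholds 0 and 1 alike, which is why the second
  alternative has an inequality.\<close>

lemma tail_count_push:
  assumes "finite S" "0 \<notin> S" "can_push S p"
  shows "tail_count (push S p) r = tail_count S r +
    (if (p - 1 \<in> S \<and> r = p) \<or> (p - 1 \<notin> S \<and> r \<le> p) then 1 else 0)"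
proof (cases "p - 1 \<in> S")
  case True
  have pp: "p \<ge> 1" "p \<notin> S" using assms(3) by (auto simp: can_push_def)
  consider "r = p" | "r < p" | "r > p" by linarith
  then show ?thesis
  proof cases
    case 1
    have "{s \<in> push S p. r \<le> s} = insert p {s \<in> S. r \<le> s}"
      using 1 pp by (auto simp: push_def)
    then show ?thesis using 1 True pp assms(1) by (simp add: tail_count_def)
  next
    case 2
    have "{s \<in> push S p. r \<le> s} = insert p ({s \<in> S. r \<le> s} - {p - 1})"
      using 2 pp by (auto simp: push_def)
    moreover have "p - 1 \<in> {s \<in> S. r \<le> s}" using 2 True by auto
    moreover have "p \<notin> {s \<in> S. r \<le> s} - {p - 1}" using pp by auto
    ultimately have "card {s \<in> push S p. r \<le> s} = Suc (card ({s \<in> S. r \<le> s} - {p - 1}))"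
      using assms(1) by simp
    also have "\<dots> = card {s \<in> S. r \<le> s}"
      using \<open>p - 1 \<in> {s \<in> S. r \<le> s}\<close> assms(1) by (intro card_Suc_Diff1) auto
    finally show ?thesis using 2 True by (simp add: tail_count_def)
  next
    case 3
    have "{s \<in> push S p. r \<le> s} = {s \<in> S. r \<le> s}"
      using 3 pp by (auto simp: push_def)
    then show ?thesis using 3 True by (simp add: tail_count_def)
  qed
next
  case False
  then have p: "p = 1" "p \<notin> S" using assms(3) by (auto simp: can_push_def)
  have pu: "push S p = insert 1 S" using p assms(2) by (auto simp: push_def)
  show ?thesis
  proof (cases "r \<le> 1")
    case True
    then have "{s \<in> push S p. r \<le> s} = insert 1 {s \<in> S. r \<le> s}" using pu by auto
    then show ?thesis using p True False assms(1) by (simp add: tail_count_def)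
  next
    case F: False
    then have "{s \<in> push S p. r \<le> s} = {s \<in> S. r \<le> s}" using pu by auto
    then show ?thesis using p F by (simp add: tail_count_def)
  qed
qed

lemma tail_count_Suc:
  assumes "finite S"
  shows "tail_count S r = tail_count S (Suc r) + (if r \<in> S then 1 else 0)"
proof (cases "r \<in> S")
  case True
  then have "{s \<in> S. r \<le> s} = insert r {s \<in> S. Suc r \<le> s}" by auto
  then show ?thesis using True assms by (simp add: tail_count_def)
next
  case False
  then have "{s \<in> S. r \<le> s} = {s \<in> S. Suc r \<le> s}"
    by (auto simp: Suc_le_eq order.order_iff_strict)
  then show ?thesis using False by (simp add: tail_count_def)
qed

lemma tail_count_antimono:
  assumes "finite S" "r \<le> r'"
  shows "tail_count S r' \<le> tail_count S r"
  unfolding tail_count_def using assms by (intro card_mono) auto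

lemma tail_count_lipschitz:
  assumes "finite S" "r \<le> r'"
  shows "tail_count S r \<le> tail_count S r' + (r' - r)"
proof -
  have "tail_count S r \<le> card ({s \<in> S. r' \<le> s} \<union> {r..<r'})"
    unfolding tail_count_def using assms by (intro card_mono) auto
  also have "\<dots> \<le> tail_count S r' + card {r..<r'}"
    unfolding tail_count_def by (rule card_Un_le)
  finally show ?thesis by simp
qed

text \<open>Before the push, position \<open>p + 1\<close> holds a large entry because
  \<open>p\<close> is not a part; afterwards it holds the rank of the new part \<open>p\<close>, and
  the large entry has moved to position \<open>p\<close>. All other positions see the same tail
  counts.\<close>

lemma perm_of_push:
  assumes "finite S" "0 \<notin> S" "can_push S p" "q \<ge> 1"
  shows "perm_of (push S p) q = swap_adj (perm_of S) p q"
proof -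
  have p: "p \<ge> 1" "p \<notin> S" "p = 1 \<or> p - 1 \<in> S" using assms(3) by (auto simp: can_push_def)
  note tc = tail_count_push[OF assms(1-3)]
  have s1: "tail_count S p = tail_count S (Suc p)" using tail_count_Suc[OF assms(1), of p] p by simp
  consider "q = p" | "q = p + 1" | "q \<noteq> p" "q \<noteq> p + 1" by blast
  then show ?thesis
  proof cases
    case 1
    have "p - 1 \<notin> push S p" using p by (auto simp: push_def)
    then show ?thesis using 1 p s1 by (simp add: perm_of_def swap_adj_def tc)
  next
    case 2
    have "p \<in> push S p" by (simp add: push_def)
    then have "perm_of (push S p) q = tail_count S p + 1" using 2 p by (simp add: perm_of_def tc)
    moreover have "perm_of S p = tail_count S p + 1"
    proof (cases "p - 1 \<in> S")
      case True
      then show ?thesis using tail_count_Suc[OF assms(1), of "p-1"] p by (simp add: perm_of_def)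
    next
      case False
      then show ?thesis using p by (simp add: perm_of_def)
    qed
    ultimately show ?thesis using 2 by (simp add: swap_adj_def)
  next
    case 3
    have m: "q - 1 \<in> push S p \<longleftrightarrow> q - 1 \<in> S"
      using 3 assms(4) p by (auto simp: push_def)
    have "tail_count (push S p) (q-1) = tail_count S (q-1)" if "q - 1 \<in> S"
      using 3 p assms(2,4) that by (auto simp: tc le_Suc_eq)
    moreover have "tail_count (push S p) q = tail_count S q"
      using 3 p assms(2,4) by (auto simp: tc)
    ultimately show ?thesis using 3 m by (simp add: perm_of_def swap_adj_def)
  qed
qed

text \<open>An entry at a position \<open>k\<close> with \<open>k - 1 \<in> S\<close> lies above no
  earlier entry, since the tail counts decrease. Any other entry lies below no earlier one, since
  \<open>p + tail_count S p\<close> increases. Neither kind can be the last entry of a 132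
  pattern.\<close>

lemma avoids132_perm_of:
  assumes "finite S" "0 \<notin> S"
  shows "avoids132 n (perm_of S)"
  unfolding avoids132_def
proof (rule notI, elim exE conjE)
  fix i j k assume ijk: "1 \<le> i" "i < j" "j < k" "k \<le> n"
    "perm_of S i < perm_of S k" "perm_of S k < perm_of S j"
  show False
  proof (cases "k - 1 \<in> S")
    case True
    have "tail_count S (k-1) \<le> tail_count S (i-1)" "tail_count S (k-1) \<le> tail_count S i"
      using ijk by (auto intro!: tail_count_antimono assms)
    then show False using True ijk by (auto simp: perm_of_def split: if_splits)
  next
    case False
    then have k: "perm_of S k = k + tail_count S k" by (simp add: perm_of_def)
    have a: "tail_count S (j-1) \<le> tail_count S k + (k - (j-1))"
            "tail_count S j \<le> tail_count S k + (k - j)"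
      using tail_count_lipschitz[OF assms(1), of "j-1" k] tail_count_lipschitz[OF assms(1), of j k] ijk by simp_all
    have "j - 1 \<in> S \<Longrightarrow> j - 1 \<ge> 1" using assms(2) by (metis gr0I One_nat_def Suc_leI)
    then show False using a k ijk by (auto simp: perm_of_def split: if_splits)
  qed
qed

lemma perm_of_full:
  assumes "i \<in> {1..n}"
  shows "perm_of {1..n-1} i = n + 1 - i"
proof -
  have *: "{s. Suc 0 \<le> s \<and> s \<le> n - Suc 0 \<and> r \<le> s} = {max r 1..n-1}" for r by auto
  show ?thesis using assms by (auto simp: perm_of_def tail_count_def *)
qed

subsection \<open>Inversions\<close>

definition inversions :: "nat \<Rightarrow> (nat \<Rightarrow> nat) \<Rightarrow> (nat \<times> nat) set" where
  "inversions n \<sigma> = {(i, j). 1 \<le> i \<and> i < j \<and> j \<le> n \<and> \<sigma> j < \<sigma> i}"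

lemma finite_inversions [simp]: "finite (inversions n \<sigma>)"
  by (rule finite_subset[of _ "{1..n} \<times> {1..n}"]) (auto simp: inversions_def)

text \<open>Relabelling positions by the transposition of \<open>p\<close> and \<open>p + 1\<close>
  carries inversions to inversions, except for the pair \<open>(p, p+1)\<close> itself, which is set
  aside on both sides.\<close>

lemma card_inversions_swap:
  assumes "1 \<le> p" "p < n"
  shows "card (inversions n (swap_adj \<sigma> p) - {(p, p+1)}) \<le> card (inversions n \<sigma> - {(p, p+1)})"
proof -
  define t where "t = (\<lambda>x. if x = p then p + 1 else if x = p + 1 then p else x)"
  have "inj (map_prod t t)" by (intro prod.inj_map) (auto simp: t_def inj_def split: if_splits)
  then have inj: "inj_on (map_prod t t) (inversions n (swap_adj \<sigma> p) - {(p, p+1)})"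
    by (rule inj_on_subset) simp
  have "map_prod t t ` (inversions n (swap_adj \<sigma> p) - {(p, p+1)}) \<subseteq> inversions n \<sigma> - {(p, p+1)}"
    using assms by (auto simp: inversions_def t_def swap_adj_def split: if_splits)
  with inj show ?thesis by (intro card_inj_on_le) auto
qed

lemma card_inversions_swap_le:
  assumes "1 \<le> p" "p < n"
  shows "card (inversions n (swap_adj \<sigma> p)) \<le> Suc (card (inversions n \<sigma>))"
    and "\<sigma> (p+1) < \<sigma> p \<Longrightarrow> card (inversions n (swap_adj \<sigma> p)) < card (inversions n \<sigma>)"
proof -
  note c = card_inversions_swap[OF assms, of \<sigma>]
  have "card (inversions n (swap_adj \<sigma> p)) \<le> Suc (card (inversions n (swap_adj \<sigma> p) - {(p, p+1)}))"
    by (metis card_Diff1_le card_Diff_singleton_if diff_Suc_1 diff_le_self le_SucI le_diff_conv add.commute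
        plus_1_eq_Suc order_refl)
  moreover have "card (inversions n \<sigma> - {(p, p+1)}) \<le> card (inversions n \<sigma>)"
    by (intro card_mono) auto
  ultimately show "card (inversions n (swap_adj \<sigma> p)) \<le> Suc (card (inversions n \<sigma>))"
    using c by linarith
  assume d: "\<sigma> (p+1) < \<sigma> p"
  have "inversions n (swap_adj \<sigma> p) - {(p, p+1)} = inversions n (swap_adj \<sigma> p)"
    using d by (auto simp: inversions_def swap_adj_def)
  moreover have "(p, p+1) \<in> inversions n \<sigma>" using d assms by (auto simp: inversions_def)
  then have "card (inversions n \<sigma> - {(p, p+1)}) < card (inversions n \<sigma>)"
    by (intro psubset_card_mono) auto
  ultimately show "card (inversions n (swap_adj \<sigma> p)) < card (inversions n \<sigma>)" using c by simp
qed

lemma sigma_Suc: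
  "k < length w \<Longrightarrow> sigma w (Suc k) = swap_adj (sigma w k) (w ! k)"
  by (simp add: sigma_def take_Suc_conv_app_nth)

lemma sum_upto_choose: "\<Sum>{1..n-1} = n choose (2::nat)"
  proof (cases n)
  case (Suc m)
  have "\<Sum>{1..m} = m * Suc m div 2" using gauss_sum_from_Suc_0[of m, where 'a = nat] by simp
  then show ?thesis using Suc by (simp add: choose_two mult.commute)
qed (simp add: binomial_eq_0)

lemma card_pairs: "card {(i, j). 1 \<le> i \<and> i < j \<and> j \<le> (n::nat)} = n choose 2"
proof -
  have "{(i, j). 1 \<le> i \<and> i < j \<and> j \<le> n} = (\<lambda>(j,i). (i,j)) ` (SIGMA j:{1..n}. {1..<j})" by force
  moreover have "card ((\<lambda>(j,i). (i,j)) ` (SIGMA j:{1..n}. {1..<j})) = card (SIGMA j:{1..n}. {1..<j})"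
    by (intro card_image) (auto simp: inj_on_def)
  moreover have "\<dots> = (\<Sum>j\<in>{1..n}. j - 1)" by simp
  moreover have "(\<Sum>j\<in>{1..n}. j - 1) = \<Sum>{1..n-1}"
  proof (induction n)
    case (Suc n)
    then show ?case by (cases n) auto
  qed simp
  ultimately show ?thesis using sum_upto_choose by simp
qed

text \<open>The reversal has \<open>n choose 2\<close> inversions, as many as there are swaps, and a
  swap adds at most one. A single swap at a descent would lose one and could never be made
  up.\<close>

lemma sorting_network_ascent:
  assumes "sorting_network n w" "k < n choose 2"
  shows "\<not> sigma w k (w ! k + 1) < sigma w k (w ! k)"
proof
  let ?N = "n choose 2"
  let ?I = "\<lambda>k. card (inversions n (sigma w k))"
  assume d: "sigma w k (w ! k + 1) < sigma w k (w ! k)"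
  have len: "length w = ?N" using assms by (simp add: sorting_network_def)
  have p: "1 \<le> w ! l" "w ! l < n" if "l < ?N" for l
  proof -
    have "w ! l \<in> set w" using that len by simp
    then have "w ! l \<in> {1..n-1}" using assms(1) unfolding sorting_network_def by blast
    then show "1 \<le> w ! l" "w ! l < n" by auto
  qed
  have st: "?I (Suc l) \<le> Suc (?I l)" if "l < ?N" for l
    using card_inversions_swap_le(1)[OF p[OF that]] that by (simp add: sigma_Suc len)
  have up: "?I (l + m) \<le> ?I l + m" if "l + m \<le> ?N" for l m
    using that
  proof (induction m)
    case (Suc m)
    then show ?case using st[of "l+m"] by simp
  qed simp
  have "?I 0 = 0" by (auto simp: inversions_def sigma_def card_eq_0_iff)
  then have "?I k \<le> k" using up[of 0 k] assms(2) by simp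
  moreover have "?I (Suc k) < ?I k"
    using card_inversions_swap_le(2)[OF p[OF assms(2)] d] assms(2) by (simp add: sigma_Suc len)
  moreover have e: "Suc k + (?N - Suc k) = ?N" using assms(2) by simp
  have "?I ?N \<le> ?I (Suc k) + (?N - Suc k)"
    using up[of "Suc k" "?N - Suc k"] unfolding e by simp
  ultimately have "?I ?N < ?N" using assms(2) by linarith
  moreover have "inversions n (sigma w ?N) = {(i, j). 1 \<le> i \<and> i < j \<and> j \<le> n}"
    using assms(1) unfolding sorting_network_def inversions_def by fastforce
  ultimately show False using card_pairs[of n] by simp
qed

section \<open>Correspondence between 132-avoiding networks and fillings\<close>

text \<open>Only positions from 1 on are compared: at 0 the function \<open>perm_of S\<close>
  returns the number of parts, whereas \<open>sigma\<close> fixes 0.\<close>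

lemma sigma_eq_perm_of:
  assumes "valid {} (take k w)" "k \<le> length w" "q \<ge> 1"
  shows "sigma w k q = perm_of (shape (take k w)) q"
  using assms
proof (induction k arbitrary: q)
  case 0
  then show ?case by (simp add: sigma_def shape_def perm_of_def tail_count_def)
next
  case (Suc k)
  let ?S = "shape (take k w)"
  have tk: "take (Suc k) w = take k w @ [w ! k]" using Suc.prems by (simp add: take_Suc_conv_app_nth)
  have v: "valid {} (take k w)" "can_push ?S (w!k)"
    using Suc.prems(1) unfolding tk valid_append by (auto simp: shape_def)
  have sh: "shape (take (Suc k) w) = push ?S (w!k)" unfolding tk by (simp add: shape_def)
  have "sigma w (Suc k) q = swap_adj (sigma w k) (w!k) q" using Suc.prems by (simp add: sigma_Suc)
  also have "\<dots> = swap_adj (perm_of ?S) (w!k) q"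
    using Suc.IH[OF v(1)] Suc.prems v(2) by (auto simp: swap_adj_def can_push_def)
  also have "\<dots> = perm_of (push ?S (w!k)) q"
    using perm_of_push[OF shape_props(1,2)[OF v(1)] v(2)] Suc.prems by simp
  finally show ?case using sh by simp
qed

text \<open>Two of the three ways in which the next letter could fail to be a push are excluded by
  different facts: \<open>p \<in> S\<close> would make the swap a descent, and a missing part
  \<open>p - 1\<close> with \<open>p \<ge> 2\<close> would create a 132 pattern.\<close>

lemma R132_valid_take:
  assumes "w \<in> R132 n" "k \<le> n choose 2"
  shows "valid {} (take k w) \<and> shape (take k w) \<subseteq> {1..n-1}"
  using assms(2)
proof (induction k)
  case 0
  then show ?case by (simp add: shape_def)
next
  case (Suc k)
  let ?S = "shape (take k w)"
  have sn: "sorting_network n w" and av: "avoids132 n (sigma w (Suc k))"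
    using assms Suc.prems by (auto simp: R132_def)
  have len: "length w = n choose 2" using sn by (simp add: sorting_network_def)
  have tk: "take (Suc k) w = take k w @ [w ! k]" using Suc.prems len by (simp add: take_Suc_conv_app_nth)
  define p where "p = w ! k"
  have "w ! k \<in> set w" using Suc.prems len by simp
  then have "w ! k \<in> {1..n-1}" using sn unfolding sorting_network_def by blast
  then have p: "1 \<le> p" "p < n" by (auto simp: p_def)
  have v: "valid {} (take k w)" and sub: "?S \<subseteq> {1..n-1}" using Suc by auto
  note S = shape_props[OF v]
  have asc: "\<not> perm_of ?S (p+1) < perm_of ?S p"
    using sorting_network_ascent[OF sn, of k] Suc.prems len p sigma_eq_perm_of[OF v]
    by (simp add: p_def)
  have cp: "can_push ?S p"
  proof (rule ccontr)
    assume n: "\<not> can_push ?S p"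
    note ts = tail_count_Suc[OF S(1)]
    have "p \<notin> ?S"
    proof
      assume "p \<in> ?S"
      then show False using asc ts[of "p-1"] p by (auto simp: perm_of_def split: if_splits)
    qed
    with n p have p1: "p \<ge> 2" "p - 1 \<notin> ?S" by (auto simp: can_push_def)
    have sg: "sigma w (Suc k) = swap_adj (sigma w k) p" using Suc.prems len by (simp add: sigma_Suc p_def)
    have s1: "sigma w (Suc k) 1 = perm_of ?S 1" "sigma w (Suc k) p = perm_of ?S (p+1)"
       "sigma w (Suc k) (p+1) = perm_of ?S p"
      using sigma_eq_perm_of[OF v] Suc.prems len p1 by (simp_all add: sg swap_adj_def)
    have "tail_count ?S 1 \<le> tail_count ?S (p-1) + (p - 1 - 1)"
      using p1 by (intro tail_count_lipschitz S) auto
    \<comment> \<open>With neither \<open>p - 1\<close> nor \<open>p\<close> a part, positions 1,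
      \<open>p\<close>, \<open>p + 1\<close> all hold large entries in increasing order. Swapping
      the last two produces the pattern 132 at exactly these positions.\<close>
    then have "perm_of ?S 1 < perm_of ?S p" "perm_of ?S p < perm_of ?S (p+1)"
      using p1 \<open>p \<notin> ?S\<close> S(2) ts[of p] ts[of "p-1"] by (auto simp: perm_of_def)
    then have "1 \<le> (1::nat) \<and> 1 < p \<and> p < p + 1 \<and> p + 1 \<le> n \<and>
        sigma w (Suc k) 1 < sigma w (Suc k) (p+1) \<and> sigma w (Suc k) (p+1) < sigma w (Suc k) p"
      using p p1 s1 by auto
    then show False using av unfolding avoids132_def by blast
  qed
  have "push ?S p \<subseteq> {1..n-1}" using sub p by (auto simp: push_def)
  then show ?case using v cp unfolding tk valid_append by (simp add: shape_def p_def)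
qed

text \<open>A shape inside the staircase with the same sum as the staircase must be the whole of it.
  Conversely, every sequence of pushes ending in the staircase passes only through 132-avoiding
  permutations.\<close>

theorem R132_eq: "R132 n = {w. valid {} w \<and> shape w = {1..n-1}}"
proof (intro set_eqI iffI)
  fix w assume w: "w \<in> R132 n"
  then have len: "length w = n choose 2" by (simp add: R132_def sorting_network_def)
  have v: "valid {} w" "shape w \<subseteq> {1..n-1}" using R132_valid_take[OF w order_refl] len by auto
  have "shape w = {1..n-1}"
  proof (rule ccontr)
    assume "shape w \<noteq> {1..n-1}"
    then obtain x where x: "x \<in> {1..n-1}" "x \<notin> shape w" using v by blast
    have "\<Sum>(shape w) + x = \<Sum>(insert x (shape w))" using x shape_props(1)[OF v(1)] by simp
    also have "\<dots> \<le> \<Sum>{1..n-1}" using x v by (intro sum_mono2) auto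
    also have "\<dots> = \<Sum>(shape w)" using shape_props(3)[OF v(1)] len sum_upto_choose by simp
    finally show False using x by simp
  qed
  with v show "w \<in> {w. valid {} w \<and> shape w = {1..n-1}}" by simp
next
  fix w assume "w \<in> {w. valid {} w \<and> shape w = {1..n-1}}"
  then have v: "valid {} w" "shape w = {1..n-1}" by auto
  have len: "length w = n choose 2" using shape_props(3)[OF v(1)] v(2) sum_upto_choose by metis
  have "set w \<subseteq> {1..n-1}"
  proof (cases "n = 0")
    case True then show ?thesis using len by (simp add: binomial_eq_0)
  next
    case False
    then have "foldl push {} w \<subseteq> {..<n}" using v(2) by (auto simp: shape_def)
    then have "set w \<subseteq> {..<n}" using foldl_push_bounded v(1) by blast
    moreover have "valid S w \<Longrightarrow> 0 \<notin> set w" for S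
      by (induction w arbitrary: S) (auto simp: can_push_def)
    ultimately show ?thesis using v(1)
      by (auto simp: subset_iff) (metis One_nat_def Suc_leI gr0I)+
  qed
  moreover have sg: "sigma w k q = perm_of (shape (take k w)) q" if "k \<le> n choose 2" "q \<ge> 1" for k q
    using sigma_eq_perm_of[OF valid_take[OF v(1)]] that len by simp
  ultimately have "sorting_network n w"
    unfolding sorting_network_def using len v(2) perm_of_full by auto
  moreover have "avoids132 n (sigma w k)" if "k \<le> n choose 2" for k
    using avoids132_perm_of[OF shape_props(1,2)[OF valid_take[OF v(1), of k]], of n] sg[OF that]
    unfolding avoids132_def by auto
  ultimately show "w \<in> R132 n" by (simp add: R132_def)
qed

lemma bij_sigma:
  assumes "set w \<subseteq> {1..n-1}"
  shows "bij_betw (sigma w k) {1..n} {1..n}"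
proof (induction k)
  case 0
  then show ?case by (simp add: sigma_def bij_betw_def)
next
  case (Suc k)
  show ?case
  proof (cases "k < length w")
    case True
    define p where "p = w ! k"
    have "w ! k \<in> {1..n-1}" using assms True nth_mem by blast
    then have p: "1 \<le> p" "p < n" by (auto simp: p_def)
    have inj: "inj_on (sigma w k) {1..n}" using Suc by (simp add: bij_betw_def)
    have e: "sigma w (Suc k) = sigma w k \<circ> (\<lambda>j. if j = p then p + 1 else if j = p + 1 then p else j)"
      using True by (auto simp: sigma_Suc swap_adj_def p_def)
    have "bij_betw (\<lambda>j. if j = p then p + 1 else if j = p + 1 then p else j) {1..n} {1..n}"
      by (rule bij_betw_byWitness[where f' = "\<lambda>j. if j = p then p + 1 else if j = p + 1 then p else j"])
        (use p in auto)
    then show ?thesis using Suc unfolding e by (rule bij_betw_trans)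
  next
    case False
    then have "sigma w (Suc k) = sigma w k" by (simp add: sigma_def)
    then show ?thesis using Suc by simp
  qed
qed

section \<open>Newton's recursion and power sums of residues\<close>

text \<open>This congruence hands the bound \<open>i \<in> {1..n}\<close> to the termination proof
  of \<open>newton\<close>, so that the recursive argument \<open>n - i\<close> is seen to be
  smaller than \<open>n\<close>.\<close>

lemmas [fundef_cong] = sum.cong

text \<open>These are the coefficients of the exponential of minus the sum of
  \<open>Y i X^i / i\<close>: Newton's identities that turn power sums into signed elementary
  symmetric functions. Only the values \<open>Y i\<close> with \<open>1 \<le> i\<close>
  enter.\<close>

fun newton :: "(nat \<Rightarrow> real) \<Rightarrow> nat \<Rightarrow> real" where
  "newton Y n = (if n = 0 then 1 else - (\<Sum>i\<in>{1..n}. Y i * newton Y (n - i)) / real n)"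

declare newton.simps [simp del]

lemma newton_0 [simp]: "newton Y 0 = 1"
  by (simp add: newton.simps)

lemma newton_rec: "n > 0 \<Longrightarrow> real n * newton Y n = - (\<Sum>i\<in>{1..n}. Y i * newton Y (n - i))"
  by (subst newton.simps) simp

lemma newton_unique:
  assumes "A 0 = 1" "\<And>n. n > 0 \<Longrightarrow> real n * A n = - (\<Sum>i\<in>{1..n}. Y i * A (n - i))"
  shows "A n = newton Y n"
proof (induction n rule: less_induct)
  case (less n)
  show ?case
  proof (cases "n = 0")
    case False
    have "(\<Sum>i\<in>{1..n}. Y i * A (n - i)) = (\<Sum>i\<in>{1..n}. Y i * newton Y (n - i))"
      by (intro sum.cong refl) (use less.IH in auto)
    then have "real n * A n = - (\<Sum>i\<in>{1..n}. Y i * newton Y (n - i))"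
      using assms(2)[of n] False by simp
    also have "\<dots> = real n * newton Y n" using newton_rec False by simp
    finally show ?thesis using False by simp
  qed (simp add: assms(1))
qed

lemma newton_scale: "newton (\<lambda>i. Y i * c ^ i) n = newton Y n * c ^ n"
proof (rule newton_unique[symmetric])
  fix n :: nat assume "n > 0"
  have "real n * (newton Y n * c ^ n) = - (\<Sum>i\<in>{1..n}. Y i * newton Y (n - i)) * c ^ n"
    using newton_rec[OF \<open>n > 0\<close>, of Y] by (metis mult.assoc)
  also have "\<dots> = - (\<Sum>i\<in>{1..n}. Y i * newton Y (n - i) * c ^ n)"
    by (simp add: sum_distrib_right)
  also have "(\<Sum>i\<in>{1..n}. Y i * newton Y (n - i) * c ^ n) =
      (\<Sum>i\<in>{1..n}. Y i * c ^ i * (newton Y (n - i) * c ^ (n - i)))"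
  proof (rule sum.cong[OF refl])
    fix i assume "i \<in> {1..n}"
    then have "c ^ n = c ^ i * c ^ (n - i)" by (simp flip: power_add)
    then show "Y i * newton Y (n - i) * c ^ n = Y i * c ^ i * (newton Y (n - i) * c ^ (n - i))" by simp
  qed
  finally show "real n * (newton Y n * c ^ n) = - (\<Sum>i\<in>{1..n}. Y i * c ^ i * (newton Y (n - i) * c ^ (n - i)))" .
qed simp

definition geo :: "real \<Rightarrow> real fps" where
  "geo a = Abs_fps (\<lambda>n. a ^ n)"

lemma geo_inverse: "(1 - fps_const a * fps_X) * geo a = 1"
proof (rule fps_ext)
  fix n
  show "fps_nth ((1 - fps_const a * fps_X) * geo a) n = fps_nth 1 n"
    by (cases n) (simp_all add: geo_def left_diff_distrib mult.assoc)
qed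

lemma geo_deriv: "fps_deriv (geo a) = fps_const a * geo a ^ 2"
proof -
  let ?L = "1 - fps_const a * fps_X"
  have "fps_deriv (?L * geo a) = 0" by (simp add: geo_inverse)
  then have "?L * fps_deriv (geo a) = fps_const a * geo a" by (simp add: algebra_simps)
  then have "geo a * (?L * fps_deriv (geo a)) = geo a * (fps_const a * geo a)" by (rule arg_cong)
  also have "\<dots> = fps_const a * geo a ^ 2"
    by (simp add: power2_eq_square)
  finally have "geo a * (?L * fps_deriv (geo a)) = fps_const a * geo a ^ 2" .
  then show ?thesis using geo_inverse[of a] by (metis mult.assoc mult.commute mult_1)
qed

text \<open>For \<open>1 - b X\<close> the operator \<open>X d/dX log\<close> gives
  \<open>1 - geo b\<close>; taking the quotient by \<open>1 - a X\<close> makes the constants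
  cancel, which leaves a difference of two geometric series.\<close>

lemma fps_log_deriv_factor:
  fixes a b :: real
  defines "Q \<equiv> (1 - fps_const b * fps_X) * geo a"
  shows "fps_X * fps_deriv Q = - (Q * (geo b - geo a))"
proof -
  let ?La = "1 - fps_const a * fps_X" and ?Lb = "1 - fps_const b * fps_X"
  have 1: "Q * geo b = geo a" unfolding Q_def using geo_inverse[of b]
    by (metis (no_types, lifting) mult.assoc mult.commute mult_1)
  have 2: "fps_deriv Q = ?Lb * (fps_const a * geo a ^ 2) - fps_const b * geo a"
    unfolding Q_def by (simp add: geo_deriv algebra_simps)
  have 3: "geo a = ?La * geo a ^ 2" using geo_inverse[of a]
    by (simp add: power2_eq_square flip: mult.assoc)
  have "fps_X * fps_deriv Q + Q * (geo b - geo a) =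
      fps_X * (?Lb * (fps_const a * geo a ^ 2) - fps_const b * geo a) + geo a - ?Lb * geo a ^ 2"
    unfolding 2 using 1 by (simp add: right_diff_distrib Q_def power2_eq_square algebra_simps)
  also have "\<dots> = ?Lb * (geo a - ?La * geo a ^ 2)" by (simp add: algebra_simps)
  also have "\<dots> = 0" using 3 by simp
  finally show ?thesis by (simp add: eq_neg_iff_add_eq_0)
qed

lemma fps_log_deriv_prod:
  fixes a b :: "'i \<Rightarrow> real"
  assumes "finite I"
  defines "A \<equiv> \<lambda>J. \<Prod>t\<in>J. (1 - fps_const (b t) * fps_X) * geo (a t)"
  shows "fps_X * fps_deriv (A I) = - (A I * Abs_fps (\<lambda>j. \<Sum>t\<in>I. b t ^ j - a t ^ j))"
  using assms(1)
proof (induction I rule: finite_induct)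
  case empty
  then show ?case by (simp add: A_def fps_eq_iff)
next
  case (insert x I)
  define Q where "Q = (1 - fps_const (b x) * fps_X) * geo (a x)"
  let ?P = "\<lambda>I. Abs_fps (\<lambda>j. \<Sum>t\<in>I. b t ^ j - a t ^ j)"
  have A: "A (insert x I) = Q * A I" using insert by (simp add: A_def Q_def)
  have P: "?P (insert x I) = (geo (b x) - geo (a x)) + ?P I"
    using insert by (simp add: fps_eq_iff geo_def)
  have "fps_X * fps_deriv (Q * A I) = (fps_X * fps_deriv Q) * A I + Q * (fps_X * fps_deriv (A I))"
    unfolding fps_deriv_mult by (simp only: algebra_simps)
  also have "\<dots> = - (Q * (geo (b x) - geo (a x))) * A I + Q * (- (A I * ?P I))"
    unfolding insert.IH using fps_log_deriv_factor[of "b x" "a x"] by (simp only: Q_def)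
  also have "\<dots> = - ((Q * A I) * ((geo (b x) - geo (a x)) + ?P I))"
    by (simp add: algebra_simps)
  finally show ?case unfolding A P .
qed

text \<open>This is the partial fraction expansion of the product of
  \<open>(1 - b t X) / (1 - a t X)\<close> with constant term 1, multiplied out so that it becomes
  an identity of polynomials.\<close>

lemma partial_fractions_poly:
  fixes a b :: "'i \<Rightarrow> real"
  assumes fin: "finite I" and inj: "inj_on a I" and nz: "\<And>t. t \<in> I \<Longrightarrow> a t \<noteq> 0"
  defines "c \<equiv> \<lambda>s. (\<Prod>t\<in>I. a s - b t) / (\<Prod>t\<in>I-{s}. a s - a t)"
  shows "(\<Prod>t\<in>I. [:1, - b t:]) =
    (\<Prod>t\<in>I. [:1, - a t:]) + [:0, 1:] * (\<Sum>s\<in>I. smult (c s) (\<Prod>t\<in>I-{s}. [:1, - a t:]))"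
    (is "?L = ?R1 + [:0,1:] * ?R2")
\<comment> \<open>Both sides have degree at most \<open>card I\<close> and are compared at
  \<open>card I + 1\<close> points: 0 and the reciprocals \<open>1 / a s\<close>, at each of which a
  single summand survives.\<close>
proof (rule poly_eqI_degree)
  let ?A = "insert 0 ((\<lambda>s. 1 / a s) ` I)"
  have "inj_on (\<lambda>s. 1 / a s) I" using inj by (auto simp: inj_on_def)
  moreover have "0 \<notin> (\<lambda>s. 1 / a s) ` I" using nz by auto
  ultimately have cA: "card ?A = card I + 1" using fin by (simp add: card_image)
  have d: "degree (\<Prod>t\<in>J. [:1, - f t:]) \<le> card J" if "finite J" for J and f :: "'i \<Rightarrow> real"
  proof -
    have "degree (\<Prod>t\<in>J. [:1, - f t:]) \<le> sum (degree \<circ> (\<lambda>t. [:1, - f t:])) J"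
      by (rule degree_prod_sum_le[OF that])
    also have "\<dots> \<le> sum (\<lambda>_. 1) J" by (intro sum_mono) auto
    finally show ?thesis by simp
  qed
  show "degree ?L < card ?A" using d[OF fin, of b] cA by simp
  have "degree ?R2 \<le> card I - 1"
  proof (rule degree_sum_le[OF fin])
    fix s assume "s \<in> I"
    then show "degree (smult (c s) (\<Prod>t\<in>I-{s}. [:1, - a t:])) \<le> card I - 1"
      using d[of "I-{s}" a] fin by (simp add: degree_smult_eq)
  qed
  then have "degree ([:0,1:] * ?R2) \<le> card I"
  proof (cases "I = {}")
    case False
    then have "card I > 0" using fin by (simp add: card_gt_0_iff)
    have "degree ([:0,1:] * ?R2) \<le> degree [:0,1::real:] + degree ?R2" by (rule degree_mult_le)
    then show ?thesis using \<open>degree ?R2 \<le> card I - 1\<close> \<open>card I > 0\<close> by simp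
  qed simp
  then have "degree (?R1 + [:0,1:] * ?R2) \<le> card I" using d[OF fin, of a] by (intro degree_add_le)
  then show "degree (?R1 + [:0,1:] * ?R2) < card ?A" using cA by simp
  fix x assume "x \<in> ?A"
  then consider "x = 0" | s where "s \<in> I" "x = 1 / a s" by auto
  then show "poly ?L x = poly (?R1 + [:0,1:] * ?R2) x"
  proof cases
    case 1
    then show ?thesis by (simp add: poly_prod)
  next
    case 2
    have as: "a s \<noteq> 0" using nz 2 by simp
    have e: "(\<Prod>t\<in>J. 1 - f t / a s) = (\<Prod>t\<in>J. a s - f t) / a s ^ card J" for J f
      using as by (simp add: prod_dividef[symmetric] diff_divide_distrib flip: prod_constant)
    have z: "(\<Prod>t\<in>J. 1 - a t / a s) = 0" if "s \<in> J" "finite J" for J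
      using that as by (auto intro!: prod_zero bexI[of _ s])
    have "poly ?R2 x = (\<Sum>u\<in>I. c u * (\<Prod>t\<in>I-{u}. 1 - a t / a s))"
      using 2 by (simp add: poly_sum poly_prod)
    also have "\<dots> = (\<Sum>u\<in>I. if u = s then c s * (\<Prod>t\<in>I-{s}. 1 - a t / a s) else 0)"
      using 2 fin by (intro sum.cong refl) (auto simp: z)
    also have "\<dots> = c s * (\<Prod>t\<in>I-{s}. 1 - a t / a s)" using 2 fin by simp
    also have "\<dots> = c s * ((\<Prod>t\<in>I-{s}. a s - a t) / a s ^ (card I - 1))" using 2 fin by (simp add: e)
    also have "\<dots> = (\<Prod>t\<in>I. a s - b t) / a s ^ (card I - 1)"
    proof -
      have "(\<Prod>t\<in>I-{s}. a s - a t) \<noteq> 0" using inj 2 fin by (auto simp: inj_on_def)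
      then show ?thesis by (simp add: c_def)
    qed
    finally have R2: "poly ?R2 x = (\<Prod>t\<in>I. a s - b t) / a s ^ (card I - 1)" .
    have "card I > 0" using 2 fin by (auto simp: card_gt_0_iff)
    then have "a s * a s ^ (card I - 1) = a s ^ card I" by (cases "card I") auto
    have "x * poly ?R2 x = x * ((\<Prod>t\<in>I. a s - b t) / a s ^ (card I - 1))" by (simp only: R2)
    also have "\<dots> = (\<Prod>t\<in>I. a s - b t) / (a s * a s ^ (card I - 1))" by (simp add: 2(2))
    also have "\<dots> = (\<Prod>t\<in>I. a s - b t) / a s ^ card I"
      by (simp only: \<open>a s * a s ^ (card I - 1) = a s ^ card I\<close>)
    finally have "x * poly ?R2 x = (\<Prod>t\<in>I. a s - b t) / a s ^ card I" .
    moreover have "poly ?R1 x = 0" using z[OF 2(1) fin] 2 by (simp add: poly_prod)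
    moreover have "poly ?L x = (\<Prod>t\<in>I. a s - b t) / a s ^ card I"
      using 2 by (simp add: poly_prod e)
    ultimately show ?thesis by simp
  qed
qed

text \<open>Expanding the partial fractions, the coefficient of \<open>X^(m+1)\<close> is the sum of
  the residues weighted by \<open>a s ^ m\<close>. The logarithmic derivative shows that the same
  coefficients obey Newton's recursion for the power sums of \<open>b\<close> minus those of
  \<open>a\<close>.\<close>

theorem residue_moments:
  fixes a b :: "'i \<Rightarrow> real"
  assumes fin: "finite I" and inj: "inj_on a I" and nz: "\<And>t. t \<in> I \<Longrightarrow> a t \<noteq> 0"
  shows "(\<Sum>s\<in>I. (\<Prod>t\<in>I. a s - b t) / (\<Prod>t\<in>I-{s}. a s - a t) * a s ^ m) =
    newton (\<lambda>j. \<Sum>t\<in>I. b t ^ j - a t ^ j) (Suc m)"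
proof -
  define c where "c = (\<lambda>s. (\<Prod>t\<in>I. a s - b t) / (\<Prod>t\<in>I-{s}. a s - a t))"
  define A where "A = (\<Prod>t\<in>I. (1 - fps_const (b t) * fps_X) * geo (a t))"
  let ?P = "\<lambda>j. \<Sum>t\<in>I. b t ^ j - a t ^ j"
  have lin: "fps_of_poly [:1, - x:] = 1 - fps_const x * fps_X" for x :: real
    by (simp add: fps_of_poly_linear')
  have X: "fps_of_poly [:0, 1::real:] = fps_X" by simp
  have pf: "(\<Prod>t\<in>I. 1 - fps_const (b t) * fps_X) =
    (\<Prod>t\<in>I. 1 - fps_const (a t) * fps_X) +
      fps_X * (\<Sum>s\<in>I. fps_const (c s) * (\<Prod>t\<in>I-{s}. 1 - fps_const (a t) * fps_X))"
    using arg_cong[OF partial_fractions_poly[OF fin inj nz, of b], of fps_of_poly]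
    by (simp only: fps_of_poly_prod fps_of_poly_add fps_of_poly_mult fps_of_poly_sum fps_of_poly_smult
       lin X c_def)
  have g1: "(\<Prod>t\<in>J. 1 - fps_const (a t) * fps_X) * (\<Prod>t\<in>J. geo (a t)) = 1" for J
    by (simp add: geo_inverse flip: prod.distrib)
  have "A = (\<Prod>t\<in>I. 1 - fps_const (b t) * fps_X) * (\<Prod>t\<in>I. geo (a t))"
    by (simp add: A_def prod.distrib)
  also have "\<dots> = 1 + fps_X * (\<Sum>s\<in>I. fps_const (c s) *
      ((\<Prod>t\<in>I-{s}. 1 - fps_const (a t) * fps_X) * (\<Prod>t\<in>I. geo (a t))))"
    unfolding pf by (simp add: g1 distrib_right sum_distrib_right mult.assoc)
  also have "(\<Sum>s\<in>I. fps_const (c s) *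
      ((\<Prod>t\<in>I-{s}. 1 - fps_const (a t) * fps_X) * (\<Prod>t\<in>I. geo (a t)))) =
      (\<Sum>s\<in>I. fps_const (c s) * geo (a s))"
  proof (rule sum.cong[OF refl])
    fix s assume "s \<in> I"
    then have "(\<Prod>t\<in>I. geo (a t)) = geo (a s) * (\<Prod>t\<in>I-{s}. geo (a t))" using fin by (simp add: prod.remove)
    then show "fps_const (c s) * ((\<Prod>t\<in>I-{s}. 1 - fps_const (a t) * fps_X) * (\<Prod>t\<in>I. geo (a t))) =
      fps_const (c s) * geo (a s)"
      using g1[of "I-{s}"] by (metis (no_types, lifting) mult.left_commute mult.right_neutral)
  qed
  finally have A: "A = 1 + fps_X * (\<Sum>s\<in>I. fps_const (c s) * geo (a s))" .
  have A0: "fps_nth A 0 = 1" by (simp add: A)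
  have AS: "fps_nth A (Suc m) = (\<Sum>s\<in>I. c s * a s ^ m)" for m
    by (simp add: A fps_sum_nth geo_def)
  have "fps_nth A n = newton ?P n" for n
  proof (rule newton_unique[of "\<lambda>n. fps_nth A n"])
    fix n :: nat assume n: "n > 0"
    have "fps_nth (fps_X * fps_deriv A) n = - fps_nth (Abs_fps ?P * A) n"
      using fps_log_deriv_prod[OF fin, of b a] by (simp add: A_def mult.commute)
    moreover have "fps_nth (fps_X * fps_deriv A) n = real n * fps_nth A n" using n by (simp add: fps_X_mult_nth)
    moreover have "fps_nth (Abs_fps ?P * A) n = (\<Sum>i\<in>{0..n}. ?P i * fps_nth A (n - i))"
      by (simp add: fps_mult_nth)
    moreover have "\<dots> = (\<Sum>i\<in>{1..n}. ?P i * fps_nth A (n - i))"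
      by (rule sum.mono_neutral_right) (auto simp: not_le)
    ultimately show "real n * fps_nth A n = - (\<Sum>i\<in>{1..n}. ?P i * fps_nth A (n - i))" by simp
  qed (rule A0)
  from this[of "Suc m"] AS[of m] show ?thesis by (simp add: c_def)
qed

section \<open>Removing cells and Schur's product formula\<close>

text \<open>Subtracting \<open>{0}\<close> erases a row that has shrunk from 1 to nothing.\<close>

definition pull :: "nat set \<Rightarrow> nat \<Rightarrow> nat set" where
  "pull S s = insert (s - 1) (S - {s}) - {0}"

definition words_to :: "nat set \<Rightarrow> nat list set" where
  "words_to S = {w. valid {} w \<and> shape w = S}"

lemma finite_words_to: "finite (words_to S)"
proof (cases "finite S")
  case True
  then obtain n where "S \<subseteq> {..<n}" using finite_nat_iff_bounded by blast
  then have "words_to S \<subseteq> {w. set w \<subseteq> {..<n} \<and> length w = \<Sum>S}"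
    using foldl_push_bounded[of "{}"] shape_props(3) by (auto simp: words_to_def shape_def)
  then show ?thesis using finite_lists_length_eq[of "{..<n}" "\<Sum>S"] by (rule finite_subset) simp
next
  case False
  then have "words_to S = {}" using shape_props(1) by (auto simp: words_to_def)
  then show ?thesis by simp
qed

lemma words_to_empty: "words_to {} = {[]}"
proof -
  have "w = []" if "valid {} w" "shape w = {}" for w
    using shape_props(3)[OF that(1)] that(2) by simp
  then show ?thesis by (auto simp: words_to_def shape_def)
qed

lemma pull_push:
  assumes "0 \<notin> S" "can_push S p"
  shows "pull (push S p) p = S"
  using assms unfolding pull_def push_def can_push_def by auto

lemma push_pull:
  assumes "0 \<notin> S" "p \<in> S" "p - 1 \<notin> S"
  shows "push (pull S p) p = S" "can_push (pull S p) p"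
proof -
  have "p > 0" using assms by (metis gr0I)
  then show "push (pull S p) p = S" "can_push (pull S p) p"
    using assms by (auto simp: pull_def push_def can_push_def)
qed

lemma pull_props:
  assumes "finite S" "0 \<notin> S" "s \<in> S" "s - 1 \<notin> S"
  shows "finite (pull S s)" "0 \<notin> pull S s" "\<Sum>S = Suc (\<Sum>(pull S s))"
proof -
  show f: "finite (pull S s)" and z: "0 \<notin> pull S s" using assms by (auto simp: pull_def)
  show "\<Sum>S = Suc (\<Sum>(pull S s))"
    using push_props(3)[OF f z push_pull(2)] push_pull(1) assms by metis
qed

lemma snoc_words_to:
  assumes "0 \<notin> S"
  shows "u @ [p] \<in> words_to S \<longleftrightarrow> p \<in> S \<and> p - 1 \<notin> S \<and> u \<in> words_to (pull S p)"
proof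
  assume "u @ [p] \<in> words_to S"
  then have u: "valid {} u" "can_push (shape u) p" and S: "S = push (shape u) p"
    by (auto simp: words_to_def valid_append shape_def)
  note sp = shape_props(1,2)[OF u(1)]
  have "p \<in> S" "p - 1 \<notin> S" using u(2) by (auto simp: S push_def can_push_def)
  moreover have "pull S p = shape u" unfolding S by (rule pull_push[OF sp(2) u(2)])
  ultimately show "p \<in> S \<and> p - 1 \<notin> S \<and> u \<in> words_to (pull S p)" using u by (simp add: words_to_def)
next
  assume "p \<in> S \<and> p - 1 \<notin> S \<and> u \<in> words_to (pull S p)"
  then show "u @ [p] \<in> words_to S" using push_pull[OF assms]
    by (auto simp: words_to_def valid_append shape_def)
qed

lemma sum_words_to:
  fixes \<phi> :: "nat list \<Rightarrow> real"
  assumes "finite S" "0 \<notin> S" "S \<noteq> {}"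
  shows "(\<Sum>w\<in>words_to S. \<phi> w) =
    (\<Sum>s\<in>{s \<in> S. s - 1 \<notin> S}. \<Sum>u\<in>words_to (pull S s). \<phi> (u @ [s]))"
proof -
  have "(\<Sum>w\<in>words_to S. \<phi> w) =
    (\<Sum>(s, u)\<in>Sigma {s \<in> S. s - 1 \<notin> S} (\<lambda>s. words_to (pull S s)). \<phi> (u @ [s]))"
  proof (rule sum.reindex_bij_witness[where i = "\<lambda>(s, u). u @ [s]" and j = "\<lambda>w. (last w, butlast w)"])
    fix w assume w: "w \<in> words_to S"
    then have "w \<noteq> []" using assms(3) by (auto simp: words_to_def shape_def)
    then have e: "w = butlast w @ [last w]" by simp
    then show "(case (last w, butlast w) of (s, u) \<Rightarrow> u @ [s]) = w" by simp
    show "(last w, butlast w) \<in> Sigma {s \<in> S. s - 1 \<notin> S} (\<lambda>s. words_to (pull S s))"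
      using w e snoc_words_to[OF assms(2), of "butlast w" "last w"] by auto
    show "(case (last w, butlast w) of (s, u) \<Rightarrow> \<phi> (u @ [s])) = \<phi> w" using e by simp
  next
    fix x assume "x \<in> Sigma {s \<in> S. s - 1 \<notin> S} (\<lambda>s. words_to (pull S s))"
    then show "(case x of (s, u) \<Rightarrow> u @ [s]) \<in> words_to S"
      "(last (case x of (s, u) \<Rightarrow> u @ [s]), butlast (case x of (s, u) \<Rightarrow> u @ [s])) = x"
      using snoc_words_to[OF assms(2)] by auto
  qed
  also have "\<dots> = (\<Sum>s\<in>{s \<in> S. s - 1 \<notin> S}. \<Sum>u\<in>words_to (pull S s). \<phi> (u @ [s]))"
    by (rule sum.Sigma[symmetric]) (use assms finite_words_to in auto)
  finally show ?thesis .
qed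

text \<open>Schur's product formula for the number of standard fillings of the shifted shape with row
  lengths \<open>S\<close>, with the double product over unordered pairs written as a square root.\<close>

definition schur_count :: "nat set \<Rightarrow> real" where
  "schur_count S = fact (\<Sum>S) * (\<Prod>s\<in>S. 1 / fact s) *
     sqrt (\<Prod>s\<in>S. \<Prod>t\<in>S-{s}. \<bar>real s - real t\<bar> / (real s + real t))"

text \<open>The quotient of \<open>schur_count (pull S s)\<close> by \<open>schur_count S\<close>,
  with the absolute values resolved into a rational function of the parts. It is the probability
  that the last cell of a uniform filling of \<open>S\<close> lies in row \<open>s\<close>.\<close>

definition down_weight :: "nat set \<Rightarrow> nat \<Rightarrow> real" where
  "down_weight S s = real s / real (\<Sum>S) *
     (\<Prod>t\<in>S-{s}. (real s - 1 - real t) * (real s + real t) / ((real s - 1 + real t) * (real s - real t)))"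

text \<open>In the product over ordered pairs every factor involving \<open>x\<close> occurs twice,
  so it leaves the square root as a plain factor.\<close>

lemma schur_count_insert:
  assumes "finite U" "x \<notin> U"
  shows "schur_count (insert x U) = fact (x + \<Sum>U) * (\<Prod>s\<in>U. 1 / fact s) *
     sqrt (\<Prod>s\<in>U. \<Prod>t\<in>U-{s}. \<bar>real s - real t\<bar> / (real s + real t)) / fact x *
     (\<Prod>t\<in>U. \<bar>real x - real t\<bar> / (real x + real t))"
proof -
  let ?q = "\<lambda>s t. \<bar>real s - real t\<bar> / (real s + real t)"
  have "(\<Prod>s\<in>insert x U. \<Prod>t\<in>insert x U-{s}. ?q s t) = (\<Prod>t\<in>U. ?q x t) * (\<Prod>s\<in>U. \<Prod>t\<in>insert x U-{s}. ?q s t)"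
    using assms by simp
  also have "(\<Prod>s\<in>U. \<Prod>t\<in>insert x U-{s}. ?q s t) = (\<Prod>s\<in>U. ?q x s * (\<Prod>t\<in>U-{s}. ?q s t))"
  proof (rule prod.cong[OF refl])
    fix s assume "s \<in> U"
    then have "insert x U - {s} = insert x (U - {s})" using assms by auto
    then show "(\<Prod>t\<in>insert x U-{s}. ?q s t) = ?q x s * (\<Prod>t\<in>U-{s}. ?q s t)"
      using assms by (simp add: add.commute abs_minus_commute)
  qed
  finally have "(\<Prod>s\<in>insert x U. \<Prod>t\<in>insert x U-{s}. ?q s t) =
      (\<Prod>t\<in>U. ?q x t)\<^sup>2 * (\<Prod>s\<in>U. \<Prod>t\<in>U-{s}. ?q s t)"
    by (simp only: prod.distrib power2_eq_square mult.assoc)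
  moreover have "(\<Prod>t\<in>U. ?q x t) \<ge> 0" by (intro prod_nonneg) auto
  ultimately have "sqrt (\<Prod>s\<in>insert x U. \<Prod>t\<in>insert x U-{s}. ?q s t) =
      (\<Prod>t\<in>U. ?q x t) * sqrt (\<Prod>s\<in>U. \<Prod>t\<in>U-{s}. ?q s t)"
    by (simp add: real_sqrt_mult)
  then show ?thesis using assms by (simp add: schur_count_def)
qed

lemma schur_count_pos:
  assumes "finite S" "0 \<notin> S"
  shows "schur_count S > 0"
proof -
  have "(\<Prod>s\<in>S. \<Prod>t\<in>S-{s}. \<bar>real s - real t\<bar> / (real s + real t)) > 0"
    using assms by (intro prod_pos) (auto intro!: divide_pos_pos add_pos_pos gr0I)
  moreover have "(\<Prod>s\<in>S. 1 / fact s :: real) > 0" by (intro prod_pos) auto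
  ultimately show ?thesis unfolding schur_count_def by (intro mult_pos_pos) auto
qed

lemma schur_count_pull:
  assumes S: "finite S" "0 \<notin> S" "s \<in> S" "s - 1 \<notin> S"
  shows "schur_count (pull S s) = down_weight S s * schur_count S"
proof -
  define U where "U = S - {s}"
  have U: "finite U" "0 \<notin> U" "s \<notin> U" "s - 1 \<notin> U" "S = insert s U" using S by (auto simp: U_def)
  have s: "s > 0" using S by (metis gr0I)
  let ?C = "(\<Prod>t\<in>U. 1 / fact t) * sqrt (\<Prod>t\<in>U. \<Prod>u\<in>U-{t}. \<bar>real t - real u\<bar> / (real t + real u))"
  let ?q = "\<lambda>x. (\<Prod>t\<in>U. \<bar>real x - real t\<bar> / (real x + real t))"
  have 1: "schur_count S = fact (s + \<Sum>U) * ?C / fact s * ?q s"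
  proof -
    have "schur_count S = schur_count (insert s U)" using U(5) by (rule arg_cong)
    also note schur_count_insert[OF U(1,3)]
    finally show ?thesis by (simp only: mult.assoc)
  qed
  have pu: "pull S s = insert (s-1) U - {0}" by (simp add: pull_def U_def)
  have 2: "schur_count (pull S s) = fact (s - 1 + \<Sum>U) * ?C / fact (s - 1) * ?q (s-1)"
  proof (cases "s = 1")
    case True
    then have "pull S s = U" using U(2) pu by auto
    \<comment> \<open>A part of size 0 contributes the factor 1 to Schur's product, so deleting the
      row when \<open>s = 1\<close> fits the general formula.\<close>
    moreover have "?q 0 = 1"
    proof (intro prod.neutral ballI)
      fix t assume "t \<in> U"
      then have "t > 0" using U(2) by (metis gr0I)
      then show "\<bar>real 0 - real t\<bar> / (real 0 + real t) = 1" by simp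
    qed
    ultimately show ?thesis using True by (simp add: schur_count_def)
  next
    case False
    then have "pull S s = insert (s-1) U" using U(2) pu s by auto
    then show ?thesis using schur_count_insert[OF U(1,4)] by (simp only: mult.assoc)
  qed
  have s': "real (s - 1) = real s - 1" using s by simp
  have 3: "?q (s-1) = ?q s * (\<Prod>t\<in>U. (real s - 1 - real t) * (real s + real t) / ((real s - 1 + real t) * (real s - real t)))"
    unfolding prod.distrib[symmetric]
  proof (rule prod.cong[OF refl])
    fix t assume t: "t \<in> U"
    then have ts: "t \<noteq> s" "t \<noteq> s - 1" "t > 0" using U(2-4) by (auto intro!: gr0I)
    have ne: "real s - real t \<noteq> 0" "real s + real t \<noteq> 0" "real s - 1 + real t \<noteq> 0" using ts s by auto
    \<comment> \<open>As \<open>t\<close> is an integer other than \<open>s\<close> and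
      \<open>s - 1\<close>, the numbers \<open>s - 1 - t\<close> and \<open>s - t\<close> have the
      same sign, and the absolute values may be dropped in the quotient.\<close>
    have "\<bar>real s - 1 - real t\<bar> * (real s - real t) = \<bar>real s - real t\<bar> * (real s - 1 - real t)"
    proof (cases "t < s")
      case True
      then have "real t + 1 \<le> real s" by linarith
      then show ?thesis by simp
    next
      case False
      then show ?thesis using ts by (simp add: algebra_simps)
    qed
    then have "\<bar>real s - 1 - real t\<bar> = \<bar>real s - real t\<bar> * (real s - 1 - real t) / (real s - real t)"
      using ne by (simp add: field_simps)
    then show "\<bar>real (s-1) - real t\<bar> / (real (s-1) + real t) = \<bar>real s - real t\<bar> / (real s + real t) *
      ((real s - 1 - real t) * (real s + real t) / ((real s - 1 + real t) * (real s - real t)))"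
      unfolding s' using ne by simp
  qed
  have SS: "\<Sum>S = s + \<Sum>U" using S by (simp add: U_def sum.remove)
  have f1: "fact (s + \<Sum>U) = real (\<Sum>S) * fact (s - 1 + \<Sum>U)"
    unfolding SS using s by (cases s) auto
  have f2: "fact s = real s * fact (s - 1)" using s by (simp add: fact_reduce)
  have pos: "real (\<Sum>S) > 0" "real s > 0" unfolding of_nat_0_less_iff using SS s by linarith+
  have gen: "F * D / H * (q * P) = x / y * P * (y * F * D / (x * H) * q)"
    if "y > 0" "x > 0" for F D H q P x y :: real
    using that by simp
  show ?thesis unfolding 1 2 3 down_weight_def f1 f2 U_def[symmetric] by (rule gen[OF pos])
qed

text \<open>The factor with \<open>t = s - 1\<close> vanishes. Sums over removable rows may thus be
  extended to all rows, which is the form in which the residue identity applies.\<close>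

lemma down_weight_eq_0:
  assumes "finite S" "s - 1 \<in> S" "s > 0"
  shows "down_weight S s = 0"
proof -
  have "(\<Prod>t\<in>S-{s}. (real s - 1 - real t) * (real s + real t) / ((real s - 1 + real t) * (real s - real t))) = 0"
  proof (rule prod_zero)
    have "s - 1 \<in> S - {s}" "real s - 1 - real (s - 1) = 0" using assms by auto
    then show "\<exists>t\<in>S-{s}. (real s - 1 - real t) * (real s + real t) / ((real s - 1 + real t) * (real s - real t)) = 0"
      by (metis div_0 mult_zero_left)
  qed (use assms in simp)
  then show ?thesis by (simp add: down_weight_def)
qed

lemma down_weight_nonneg:
  assumes "finite S" "0 \<notin> S" "s \<in> S"
  shows "down_weight S s \<ge> 0"
proof (cases "s - 1 \<in> S")
  case True
  then show ?thesis using down_weight_eq_0[of S s] assms by (metis neq0_conv order_refl)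
next
  case False
  have "finite (pull S s)" "0 \<notin> pull S s" using pull_props assms False by blast+
  then have "schur_count (pull S s) > 0" "schur_count S > 0"
    using schur_count_pos assms by blast+
  then have "down_weight S s > 0" using schur_count_pull[OF assms False] by (simp add: zero_less_mult_iff)
  then show ?thesis by simp
qed

text \<open>To leading order this is the sum of \<open>2 j t^(2j-1)\<close> over the parts. The
  exact difference form is the power sum of \<open>b\<close> minus that of \<open>a\<close> in
  \<open>residue_moments\<close>, and it telescopes on the staircase.\<close>

definition power_diff_sum :: "nat set \<Rightarrow> nat \<Rightarrow> real" where
  "power_diff_sum S j = (\<Sum>t\<in>S. (real t + 1/2) ^ (2 * j) - (real t - 1/2) ^ (2 * j))"

lemma real_sum_pos:
  assumes "finite S" "0 \<notin> S" "S \<noteq> {}"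
  shows "real (\<Sum>S) > 0"
proof -
  obtain x where "x \<in> S" using assms by blast
  then have "x \<le> \<Sum>S" "x \<noteq> 0" using assms member_le_sum[of x S "\<lambda>x. x"] by auto
  then show ?thesis by linarith
qed

text \<open>With \<open>a t = (t - 1/2)^2\<close> and \<open>b t = (t + 1/2)^2\<close> the
  differences factor as \<open>(s - 1 - t)(s + t)\<close> and \<open>(s - 1 + t)(s - t)\<close>,
  exactly the factors of \<open>down_weight\<close>. The diagonal term
  \<open>a s - b s = -2 s\<close> accounts for the prefactor, so the weights are residues up to the
  constant \<open>-2 \<Sum>S\<close>.\<close>

lemma down_weight_moment:
  assumes S: "finite S" "0 \<notin> S" "S \<noteq> {}"
  shows "(\<Sum>s\<in>S. down_weight S s * (real s - 1/2) ^ (2 * m)) =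
    - newton (power_diff_sum S) (Suc m) / (2 * real (\<Sum>S))"
proof -
  define a where "a = (\<lambda>t::nat. (real t - 1/2)\<^sup>2)"
  define b where "b = (\<lambda>t::nat. (real t + 1/2)\<^sup>2)"
  have pos: "t \<ge> 1" if "t \<in> S" for t using S(2) that by (metis One_nat_def Suc_leI gr0I)
  have inj: "inj_on a S"
  proof (rule inj_onI)
    fix x y assume xy: "x \<in> S" "y \<in> S" "a x = a y"
    then have "real x - 1/2 = real y - 1/2"
      using pos[of x] pos[of y] unfolding a_def by (subst (asm) power2_eq_iff_nonneg) auto
    then show "x = y" by simp
  qed
  have nz: "a t \<noteq> 0" if "t \<in> S" for t using pos[OF that] by (auto simp: a_def)
  define K where "K = real (\<Sum>S)"
  have Spos: "K > 0" unfolding K_def using real_sum_pos[OF S] .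
  have c: "(\<Prod>t\<in>S. a s - b t) / (\<Prod>t\<in>S-{s}. a s - a t) = - (2 * K) * down_weight S s"
    if s: "s \<in> S" for s
  proof -
    have ab: "a s - b t = (real s - 1 - real t) * (real s + real t)"
             "a s - a t = (real s - 1 + real t) * (real s - real t)" for t
      by (simp_all add: a_def b_def power2_eq_square algebra_simps)
    have "(\<Prod>t\<in>S. a s - b t) = (a s - b s) * (\<Prod>t\<in>S-{s}. a s - b t)"
      using S s by (simp add: prod.remove)
    then have "(\<Prod>t\<in>S. a s - b t) / (\<Prod>t\<in>S-{s}. a s - a t) = (a s - b s) * (\<Prod>t\<in>S-{s}. (a s - b t) / (a s - a t))"
      by (simp add: prod_dividef)
    also have "\<dots> = - (2 * K) * down_weight S s"
      unfolding down_weight_def ab K_def[symmetric] using Spos by simp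
    finally show ?thesis .
  qed
  have "(\<Sum>s\<in>S. (\<Prod>t\<in>S. a s - b t) / (\<Prod>t\<in>S-{s}. a s - a t) * a s ^ m) =
    newton (\<lambda>j. \<Sum>t\<in>S. b t ^ j - a t ^ j) (Suc m)"
    by (rule residue_moments[OF S(1) inj nz])
  also have "(\<lambda>j. \<Sum>t\<in>S. b t ^ j - a t ^ j) = power_diff_sum S"
    by (simp add: fun_eq_iff power_diff_sum_def a_def b_def power_mult)
  also have "(\<Sum>s\<in>S. (\<Prod>t\<in>S. a s - b t) / (\<Prod>t\<in>S-{s}. a s - a t) * a s ^ m) =
    - (2 * K) * (\<Sum>s\<in>S. down_weight S s * (real s - 1/2) ^ (2 * m))"
    unfolding sum_distrib_left
  proof (rule sum.cong[OF refl])
    fix s assume s: "s \<in> S"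
    have "a s ^ m = (real s - 1/2) ^ (2 * m)" by (simp add: a_def power_mult)
    then show "(\<Prod>t\<in>S. a s - b t) / (\<Prod>t\<in>S-{s}. a s - a t) * a s ^ m =
      - (2 * K) * (down_weight S s * (real s - 1/2) ^ (2 * m))"
      by (simp only: c[OF s] mult.assoc)
  qed
  finally show ?thesis using Spos unfolding K_def[symmetric] by (simp add: field_simps)
qed

text \<open>The case \<open>m = 0\<close> of the moment identity. Besides normalising the transition
  probabilities, it is the recursion over removed cells that proves Schur's formula.\<close>

lemma sum_down_weight:
  assumes S: "finite S" "0 \<notin> S" "S \<noteq> {}"
  shows "(\<Sum>s\<in>S. down_weight S s) = 1"
proof -
  have "newton (power_diff_sum S) (Suc 0) = - power_diff_sum S 1"
    using newton_rec[of 1 "power_diff_sum S"] by simp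
  also have "power_diff_sum S 1 = 2 * real (\<Sum>S)"
    by (simp add: power_diff_sum_def power2_eq_square algebra_simps flip: sum_distrib_right)
  finally show ?thesis using down_weight_moment[OF S, of 0] real_sum_pos[OF S] by simp
qed

text \<open>Removing the last cell gives the same recursion for the number of fillings and for the
  product formula; the latter because the weights sum to 1.\<close>

theorem card_words_to:
  assumes "finite S" "0 \<notin> S"
  shows "real (card (words_to S)) = schur_count S"
  using assms
proof (induction "\<Sum>S" arbitrary: S rule: less_induct)
  case less
  show ?case
  proof (cases "S = {}")
    case True
    then show ?thesis by (simp add: words_to_empty schur_count_def)
  next
    case False
    have "real (card (words_to S)) = (\<Sum>w\<in>words_to S. 1)" by simp
    also have "\<dots> = (\<Sum>s\<in>{s \<in> S. s - 1 \<notin> S}. real (card (words_to (pull S s))))"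
      using sum_words_to[OF less.prems False, of "\<lambda>_. 1"] by simp
    also have "\<dots> = (\<Sum>s\<in>{s \<in> S. s - 1 \<notin> S}. down_weight S s * schur_count S)"
    proof (rule sum.cong[OF refl])
      fix s assume s: "s \<in> {s \<in> S. s - 1 \<notin> S}"
      then have "real (card (words_to (pull S s))) = schur_count (pull S s)"
        using pull_props[OF less.prems, of s] by (intro less.hyps) auto
      then show "real (card (words_to (pull S s))) = down_weight S s * schur_count S"
        using schur_count_pull[OF less.prems, of s] s by simp
    qed
    also have "\<dots> = (\<Sum>s\<in>S. down_weight S s * schur_count S)"
    proof (rule sum.mono_neutral_left[OF less.prems(1)])
      show "\<forall>i\<in>S - {s \<in> S. s - 1 \<notin> S}. down_weight S i * schur_count S = 0"
      proof
        fix i assume "i \<in> S - {s \<in> S. s - 1 \<notin> S}"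
        then have "down_weight S i = 0" using less.prems
          by (intro down_weight_eq_0) (auto intro!: gr0I)
        then show "down_weight S i * schur_count S = 0" by simp
      qed
    qed auto
    also have "\<dots> = schur_count S" using sum_down_weight[OF less.prems False]
      by (simp flip: sum_distrib_right)
    finally show ?thesis .
  qed
qed

lemma sum_words_to_butlast:
  fixes \<Phi> :: "nat set \<Rightarrow> real"
  assumes S: "finite S" "0 \<notin> S" "S \<noteq> {}"
  shows "(\<Sum>w\<in>words_to S. \<Phi> (shape (butlast w))) =
    (\<Sum>w\<in>words_to S. \<Sum>s\<in>S. down_weight S s * \<Phi> (pull S s))"
proof -
  have "(\<Sum>w\<in>words_to S. \<Phi> (shape (butlast w))) =
    (\<Sum>s\<in>{s \<in> S. s - 1 \<notin> S}. \<Sum>u\<in>words_to (pull S s). \<Phi> (shape u))"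
    using sum_words_to[OF S, of "\<lambda>w. \<Phi> (shape (butlast w))"] by simp
  also have "\<dots> = (\<Sum>s\<in>{s \<in> S. s - 1 \<notin> S}. real (card (words_to (pull S s))) * \<Phi> (pull S s))"
    by (intro sum.cong refl) (simp add: words_to_def)
  also have "\<dots> = (\<Sum>s\<in>{s \<in> S. s - 1 \<notin> S}. schur_count S * (down_weight S s * \<Phi> (pull S s)))"
  proof (rule sum.cong[OF refl])
    fix s assume s: "s \<in> {s \<in> S. s - 1 \<notin> S}"
    then have "real (card (words_to (pull S s))) = down_weight S s * schur_count S"
      using card_words_to pull_props[OF S(1,2), of s] schur_count_pull[OF S(1,2), of s] by auto
    then show "real (card (words_to (pull S s))) * \<Phi> (pull S s) = schur_count S * (down_weight S s * \<Phi> (pull S s))"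
      by simp
  qed
  also have "\<dots> = (\<Sum>s\<in>S. schur_count S * (down_weight S s * \<Phi> (pull S s)))"
  proof (rule sum.mono_neutral_left[OF S(1)])
    show "\<forall>i\<in>S - {s \<in> S. s - 1 \<notin> S}. schur_count S * (down_weight S i * \<Phi> (pull S i)) = 0"
    proof
      fix i assume "i \<in> S - {s \<in> S. s - 1 \<notin> S}"
      then have "down_weight S i = 0" using S by (intro down_weight_eq_0) (auto intro!: gr0I)
      then show "schur_count S * (down_weight S i * \<Phi> (pull S i)) = 0" by simp
    qed
  qed auto
  also have "\<dots> = (\<Sum>w\<in>words_to S. \<Sum>s\<in>S. down_weight S s * \<Phi> (pull S s))"
    by (simp add: card_words_to[OF S(1,2)] sum_distrib_left)
  finally show ?thesis .
qed

text \<open>Cut a word at time \<open>k\<close> into a prefix and a remainder. Once the intermediate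
  shape and the remainder are fixed, every filling of that shape can serve as prefix. Conditionally
  on the state and the later letters the prefix is therefore uniform, which is the Markov property
  read backwards.\<close>

lemma sum_words_to_take:
  fixes \<phi> :: "nat list \<Rightarrow> real"
  shows "(\<Sum>w\<in>{w \<in> words_to T. k \<le> length w}. \<phi> (take k w)) =
    (\<Sum>(S, v)\<in>{(S, v). \<exists>w\<in>words_to T. k \<le> length w \<and> S = shape (take k w) \<and> v = drop k w}.
       \<Sum>u\<in>words_to S. \<phi> u)" (is "?L = (\<Sum>(S, v)\<in>?I. _)")
proof -
  let ?W = "{w \<in> words_to T. k \<le> length w}"
  have fI: "finite ?I"
    by (rule finite_subset[of _ "(\<lambda>w. (shape (take k w), drop k w)) ` words_to T"])
      (auto intro: finite_words_to)
  have sh: "shape (u @ v) = foldl push (shape u) v" for u v by (simp add: shape_def)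
  have *: "k = length u \<and> u @ v \<in> words_to T \<and> valid {} u \<and> shape u = S"
    if h: "(S, v) \<in> ?I" "u \<in> words_to S" for S v u
  proof -
    obtain w where w: "w \<in> words_to T" "k \<le> length w" "S = shape (take k w)" "v = drop k w"
      using h(1) by auto
    have v: "valid {} w" "shape w = T" using w by (auto simp: words_to_def)
    have u: "valid {} u" "shape u = S" using h(2) by (auto simp: words_to_def)
    have "length u = length (take k w)"
      using shape_props(3)[OF u(1)] shape_props(3)[OF valid_take[OF v(1)]] u w by metis
    moreover have "valid {} (take k w) \<and> valid (shape (take k w)) v" "shape (take k w @ v) = T"
      using v w unfolding shape_def valid_append[symmetric] by simp_all
    then have "valid {} (take k w)" "valid (shape (take k w)) v"  "foldl push (shape (take k w)) v = T"  unfolding sh by auto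
    then have "valid {} (u @ v)" "shape (u @ v) = T" using u w(3)
      by (simp_all add: valid_append sh flip: shape_def)
    ultimately show ?thesis using w u by (simp add: words_to_def)
  qed
  have **: "take k w \<in> words_to (shape (take k w))" if "w \<in> words_to T" for w
    using that valid_take by (auto simp: words_to_def)
  have "?L = (\<Sum>(x, u)\<in>Sigma ?I (\<lambda>(S, v). words_to S). \<phi> u)"
  proof (rule sum.reindex_bij_witness[where i = "\<lambda>(x, u). u @ snd x"
          and j = "\<lambda>w. ((shape (take k w), drop k w), take k w)"])
    fix w assume w: "w \<in> ?W"
    show "(case ((shape (take k w), drop k w), take k w) of (x, u) \<Rightarrow> u @ snd x) = w" by simp
    show "((shape (take k w), drop k w), take k w) \<in> Sigma ?I (\<lambda>(S, v). words_to S)"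
      using w ** by blast
    show "(case ((shape (take k w), drop k w), take k w) of (x, u) \<Rightarrow> \<phi> u) = \<phi> (take k w)" by simp
  next
    fix z assume z: "z \<in> Sigma ?I (\<lambda>(S, v). words_to S)"
    obtain S v u where ze: "z = ((S, v), u)" by (metis surj_pair)
    have "(S, v) \<in> ?I" "u \<in> words_to S" using z unfolding ze by auto
    from *[OF this] have h: "k = length u" "u @ v \<in> words_to T" "shape u = S" by auto
    show "(case z of (x, u) \<Rightarrow> u @ snd x) \<in> ?W" using h by (simp add: ze)
    show "((shape (take k (case z of (x, u) \<Rightarrow> u @ snd x)), drop k (case z of (x, u) \<Rightarrow> u @ snd x)),
        take k (case z of (x, u) \<Rightarrow> u @ snd x)) = z" using h by (simp add: ze)
  qed
  also have "\<dots> = (\<Sum>x\<in>?I. \<Sum>u\<in>(case x of (S, v) \<Rightarrow> words_to S). \<phi> u)"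
    by (rule sum.Sigma[symmetric]) (use fI finite_words_to in auto)
  also have "\<dots> = (\<Sum>(S, v)\<in>?I. \<Sum>u\<in>words_to S. \<phi> u)"
    by (intro sum.cong) auto
  finally show ?thesis .
qed

text \<open>Summing over all words stands for an unnormalised expectation, so this is the backward
  transition kernel: averaging a function of the earlier state equals averaging its mean over the
  possible removals.\<close>

theorem sum_words_to_step:
  fixes \<Phi> :: "nat set \<Rightarrow> real"
  assumes k: "0 < k" "k \<le> \<Sum>T"
  shows "(\<Sum>w\<in>words_to T. \<Phi> (shape (take (k - 1) w))) =
    (\<Sum>w\<in>words_to T. \<Sum>s\<in>shape (take k w).
       down_weight (shape (take k w)) s * \<Phi> (pull (shape (take k w)) s))"
proof -
  have len: "{w \<in> words_to T. k \<le> length w} = words_to T"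
    using k shape_props(3) by (auto simp: words_to_def)
  let ?I = "{(S, v). \<exists>w\<in>words_to T. k \<le> length w \<and> S = shape (take k w) \<and> v = drop k w}"
  have "butlast (take k w) = take (k - 1) w" if "w \<in> words_to T" for w
  proof -
    have "k \<le> length w" using that len by blast
    then show ?thesis using k by (simp add: butlast_take)
  qed
  then have "(\<Sum>w\<in>words_to T. \<Phi> (shape (take (k - 1) w))) =
      (\<Sum>w\<in>words_to T. \<Phi> (shape (butlast (take k w))))" by simp
  also have "\<dots> = (\<Sum>(S, v)\<in>?I. \<Sum>u\<in>words_to S. \<Phi> (shape (butlast u)))"
    using sum_words_to_take[where T = T and k = k and \<phi> = "\<lambda>u. \<Phi> (shape (butlast u))"] unfolding len .
  also have "\<dots> = (\<Sum>(S, v)\<in>?I. \<Sum>u\<in>words_to S. \<Sum>s\<in>shape u. down_weight (shape u) s * \<Phi> (pull (shape u) s))"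
  proof (rule sum.cong[OF refl])
    fix x assume x: "x \<in> ?I"
    obtain S v where xe: "x = (S, v)" by (cases x)
    then obtain w where w: "w \<in> words_to T" "k \<le> length w" "S = shape (take k w)" using x by auto
    then have v: "valid {} (take k w)" using valid_take by (auto simp: words_to_def)
    have S: "finite S" "0 \<notin> S" "\<Sum>S = k" using shape_props[OF v] w by auto
    have "S \<noteq> {}" using S k by auto
    have "(\<Sum>u\<in>words_to S. \<Phi> (shape (butlast u))) =
      (\<Sum>u\<in>words_to S. \<Sum>s\<in>shape u. down_weight (shape u) s * \<Phi> (pull (shape u) s))"
      unfolding sum_words_to_butlast[OF S(1,2) \<open>S \<noteq> {}\<close>]
      by (intro sum.cong) (auto simp: words_to_def)
    then show "(case x of (S, v) \<Rightarrow> \<Sum>u\<in>words_to S. \<Phi> (shape (butlast u))) =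
      (case x of (S, v) \<Rightarrow> \<Sum>u\<in>words_to S. \<Sum>s\<in>shape u. down_weight (shape u) s * \<Phi> (pull (shape u) s))"
      by (simp add: xe)
  qed
  also have "\<dots> = (\<Sum>w\<in>words_to T. \<Sum>s\<in>shape (take k w).
       down_weight (shape (take k w)) s * \<Phi> (pull (shape (take k w)) s))"
    using sum_words_to_take[where T = T and k = k and \<phi> = "\<lambda>u. \<Sum>s\<in>shape u. down_weight (shape u) s * \<Phi> (pull (shape u) s)", symmetric]
    unfolding len .
  finally show ?thesis .
qed

section \<open>Explicit limiting moments\<close>

definition central :: "nat \<Rightarrow> real" where
  "central n = real ((2 * n) choose n)"

lemma central_0 [simp]: "central 0 = 1"
  by (simp add: central_def)

lemma central_Suc: "real (Suc n) * central (Suc n) = 2 * (2 * real n + 1) * central n"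
proof -
  have 1: "central n = fact (2 * n) / (fact n * fact n)" for n
    by (simp add: central_def binomial_fact)
  have 2: "fact (2 * Suc n) = (2 * real n + 2) * (2 * real n + 1) * fact (2 * n)"
    by (simp add: algebra_simps)
  have 3: "fact (Suc n) = (real n + 1) * fact n" by simp
  have 4: "(x + 1) * ((2 * x + 2) * (2 * x + 1) * F / ((x + 1) * G * ((x + 1) * G))) =
      2 * (2 * x + 1) * (F / (G * G))" if "x \<ge> 0" "G > 0" for x F G :: real
    using that by (simp add: divide_simps) (simp add: algebra_simps)
  have 5: "real (Suc n) = real n + 1" by simp
  show ?thesis unfolding 1 2 3 5 by (rule 4) auto
qed

lemma central_nonneg: "central n \<ge> 0"
  by (simp add: central_def)

text \<open>For index \<open>j + 1\<close> and \<open>0 < \<alpha> < 1\<close> this is the integral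
  of \<open>lim_tail \<alpha> x\<close> against \<open>(2j+2)(2j+1) x^(2j)\<close>, as
  \<open>lim_tail_moment\<close> shows. The value \<open>1 / 2\<close> at index 0 only starts the
  recursion; \<open>newton\<close> never reads it.\<close>

primrec lim_moment :: "real \<Rightarrow> nat \<Rightarrow> real" where
  "lim_moment \<alpha> 0 = 1 / 2"
| "lim_moment \<alpha> (Suc j) = lim_moment \<alpha> j - (1 - 2 * \<alpha>) / 2 * central j * (\<alpha> * (1 - \<alpha>)) ^ j"

lemma lim_moment_at_0: "lim_moment 0 (Suc j) = 0"
  by (induction j) auto

lemma lim_moment_at_1: "lim_moment 1 (Suc j) = 1"
  by (induction j) auto

text \<open>The induction closes because
  \<open>(1 - 2 \<alpha>)^2 = 1 - 4 \<alpha> (1 - \<alpha>)\<close> and consecutive central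
  binomials have a rational ratio. The closed form is what the limiting drift must match.\<close>

lemma lim_moment_deriv:
  "((\<lambda>\<alpha>. lim_moment \<alpha> (Suc j)) has_real_derivative
      real (Suc j) * central (Suc j) / 2 * (\<alpha> * (1 - \<alpha>)) ^ j) (at \<alpha>)"
proof (induction j)
  case 0
  have "central (Suc 0) = 2" by (simp add: central_def)
  then show ?case by (auto intro!: derivative_eq_intros)
next
  case (Suc j)
  define b where "b = \<alpha> * (1 - \<alpha>)"
  have c: "real (Suc (Suc j)) * central (Suc (Suc j)) = 2 * (2 * real (Suc j) + 1) * central (Suc j)"
    by (rule central_Suc)
  define d where "d = 1 - 2 * \<alpha>"
  have sq: "d * d = 1 - 4 * b" by (simp add: d_def b_def algebra_simps)
  have "real (Suc j) * central (Suc j) / 2 * b ^ j -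
      ((- 2) / 2 * central (Suc j) * b ^ Suc j +
       d / 2 * central (Suc j) * (real (Suc j) * (b ^ j * d))) =
     real (Suc j) * central (Suc j) / 2 * b ^ j * (1 - d * d) + central (Suc j) * b ^ Suc j"
    by (simp add: field_simps)
  also have "\<dots> = real (Suc (Suc j)) * central (Suc (Suc j)) / 2 * b ^ Suc j"
    unfolding sq c by (simp add: algebra_simps)
  finally have e0: "real (Suc j) * central (Suc j) / 2 * b ^ j -
      ((- 2) / 2 * central (Suc j) * b ^ Suc j +
       d / 2 * central (Suc j) * (real (Suc j) * (b ^ j * d))) =
      real (Suc (Suc j)) * central (Suc (Suc j)) / 2 * b ^ Suc j" .
  note e = e0[unfolded d_def]
  have db: "((\<lambda>\<alpha>. (\<alpha> * (1 - \<alpha>)) ^ Suc j) has_real_derivative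
     real (Suc j) * (b ^ j * (1 - 2 * \<alpha>))) (at \<alpha>)"
    by (rule derivative_eq_intros refl | simp add: b_def)+
  have dl: "((\<lambda>\<alpha>. (1 - 2 * \<alpha>) / 2 * central (Suc j)) has_real_derivative (- 2) / 2 * central (Suc j)) (at \<alpha>)"
    by (rule derivative_eq_intros refl | simp)+
  have "((\<lambda>\<alpha>. lim_moment \<alpha> (Suc j) - (1 - 2 * \<alpha>) / 2 * central (Suc j) * (\<alpha> * (1 - \<alpha>)) ^ Suc j)
      has_real_derivative real (Suc j) * central (Suc j) / 2 * b ^ j -
      ((- 2) / 2 * central (Suc j) * b ^ Suc j +
       (1 - 2 * \<alpha>) / 2 * central (Suc j) * (real (Suc j) * (b ^ j * (1 - 2 * \<alpha>))))) (at \<alpha>)"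
    using DERIV_diff[OF Suc.IH DERIV_mult[OF dl db]] by (simp add: b_def mult.commute add.commute)
  then show ?case unfolding e by (simp add: b_def)
qed

lemma lim_moment_mono:
  assumes "0 \<le> \<alpha>" "\<alpha> \<le> \<alpha>'" "\<alpha>' \<le> 1"
  shows "lim_moment \<alpha> (Suc j) \<le> lim_moment \<alpha>' (Suc j)"
proof (rule DERIV_nonneg_imp_nondecreasing[OF assms(2)])
  fix x assume "\<alpha> \<le> x" "x \<le> \<alpha>'"
  then show "\<exists>y. ((\<lambda>\<alpha>. lim_moment \<alpha> (Suc j)) has_real_derivative y) (at x) \<and> 0 \<le> y"
    using assms central_nonneg[of "Suc j"]
    by (intro exI[of _ "real (Suc j) * central (Suc j) / 2 * (x * (1 - x)) ^ j"] conjI lim_moment_deriv) auto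
qed

lemma lim_moment_bounds:
  assumes "0 \<le> \<alpha>" "\<alpha> \<le> 1"
  shows "0 \<le> lim_moment \<alpha> (Suc j)" "lim_moment \<alpha> (Suc j) \<le> 1"
  using lim_moment_mono[of 0 \<alpha> j] lim_moment_mono[of \<alpha> 1 j] assms
  by (auto simp only: lim_moment_at_0 lim_moment_at_1)

lemma lim_moment_flip: "lim_moment (1 - \<alpha>) j = 1 - lim_moment \<alpha> j"
  by (induction j) (simp_all add: algebra_simps divide_simps)

lemma continuous_lim_moment: "continuous_on UNIV (\<lambda>\<alpha>. lim_moment \<alpha> j)"
  by (induction j) (auto intro!: continuous_intros)

text \<open>The mean value theorem replaces the increment by the derivative at an intermediate
  point, and \<open>x (1 - x)\<close> is 1-Lipschitz on the unit interval. The step goes backwards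
  in time, as the chain does.\<close>

lemma lim_moment_linear:
  obtains C where "C \<ge> 0" "\<And>x h. 0 \<le> x - h \<Longrightarrow> x \<le> 1 \<Longrightarrow> 0 \<le> h \<Longrightarrow>
    \<bar>lim_moment x (Suc j) - lim_moment (x - h) (Suc j) -
      h * (real (Suc j) * central (Suc j) / 2 * (x * (1 - x)) ^ j)\<bar> \<le> C * h\<^sup>2"
proof
  define K where "K = real (Suc j) * central (Suc j) / 2"
  have K: "K \<ge> 0" using central_nonneg by (simp add: K_def)
  show "K * real j \<ge> 0" using K by simp
  fix x h :: real assume a: "0 \<le> x - h" "x \<le> 1" "0 \<le> h"
  show "\<bar>lim_moment x (Suc j) - lim_moment (x - h) (Suc j) -
      h * (real (Suc j) * central (Suc j) / 2 * (x * (1 - x)) ^ j)\<bar> \<le> K * real j * h\<^sup>2"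
  proof (cases "h = 0")
    case False
    then have "x - h < x" using a by simp
    then obtain z where z: "x - h < z" "z < x" and
      eq: "lim_moment x (Suc j) - lim_moment (x - h) (Suc j) = (x - (x - h)) * (K * (z * (1 - z)) ^ j)"
      using MVT2[of "x-h" x "\<lambda>\<alpha>. lim_moment \<alpha> (Suc j)" "\<lambda>z. K * (z * (1 - z)) ^ j"]
        lim_moment_deriv unfolding K_def by blast
    have "\<bar>(z * (1 - z)) ^ j - (x * (1 - x)) ^ j\<bar> \<le> real j * \<bar>z * (1 - z) - x * (1 - x)\<bar>"
    proof -
      have "0 \<le> z * (1 - z) \<and> z * (1 - z) \<le> 1 * 1" using z a by (intro conjI mult_nonneg_nonneg mult_mono) auto
      moreover have "0 \<le> x * (1 - x) \<and> x * (1 - x) \<le> 1 * 1" using a by (intro conjI mult_nonneg_nonneg mult_mono) auto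
      ultimately show ?thesis using norm_power_diff[of "z * (1 - z)" "x * (1 - x)" j] by simp
    qed
    also have "z * (1 - z) - x * (1 - x) = (z - x) * (1 - (z + x))" by (simp add: algebra_simps)
    also have "\<bar>(z - x) * (1 - (z + x))\<bar> \<le> h * 1" unfolding abs_mult using z a by (intro mult_mono) auto
    finally have d: "\<bar>(z * (1 - z)) ^ j - (x * (1 - x)) ^ j\<bar> \<le> real j * h" by (simp add: mult_left_mono)
    have "lim_moment x (Suc j) - lim_moment (x - h) (Suc j) - h * (K * (x * (1 - x)) ^ j) =
      h * K * ((z * (1 - z)) ^ j - (x * (1 - x)) ^ j)" unfolding eq by (simp add: algebra_simps)
    also have "\<bar>\<dots>\<bar> = h * K * \<bar>(z * (1 - z)) ^ j - (x * (1 - x)) ^ j\<bar>" using a K by (simp add: abs_mult)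
    also have "\<dots> \<le> h * K * (real j * h)" using d a K by (intro mult_left_mono) auto
    finally show ?thesis by (simp add: K_def power2_eq_square algebra_simps)
  qed simp
qed

text \<open>With \<open>b = \<alpha> (1 - \<alpha>)\<close>, \<open>c = 1 - 2 \<alpha>\<close> and \<open>B = \<Sum> central j b\<^sup>j X\<^sup>j = (1 - 4 b X)\<^bsup>-1/2\<^esup>\<close>, the moments have
  generating series \<open>X (1 - c B) / (2 (1 - X))\<close>, which is minus the logarithmic derivative (times
  \<open>X\<close>) of \<open>(c + 1 / B) / (2 (1 - \<alpha>))\<close>.\<close>

theorem newton_lim_moment:
  assumes "\<alpha> \<noteq> 0"
  shows "newton (lim_moment \<alpha>) (Suc j) = - \<alpha> * central j * (\<alpha> * (1 - \<alpha>)) ^ j / real (Suc j)"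
proof -
  define b where "b = \<alpha> * (1 - \<alpha>)"
  define A where "A = (\<lambda>n. case n of 0 \<Rightarrow> 1 | Suc j \<Rightarrow> - \<alpha> * central j * b ^ j / real (Suc j))"
  have "A n = newton (lim_moment \<alpha>) n" for n
  proof (rule newton_unique)
    show "A 0 = 1" by (simp add: A_def)
    fix n :: nat assume n: "n > 0"
    show "real n * A n = - (\<Sum>i\<in>{1..n}. lim_moment \<alpha> i * A (n - i))"
    \<comment> \<open>The generating function argument ends by cancelling
      \<open>2 (1 - \<alpha>)\<close>, which is impossible here. At \<open>\<alpha> = 1\<close> all
      moments from index 1 on are 1 and the series is simply \<open>1 - X\<close>.\<close>
    proof (cases "\<alpha> = 1")
      case True
      then have y: "lim_moment \<alpha> i = 1" if "i \<in> {1..n}" for i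
        using that lim_moment_at_1[of "i-1"] by simp
      have A: "A m = (if m = 0 then 1 else if m = 1 then -1 else 0)" for m
        using True by (cases m; cases "m - 1") (auto simp: A_def b_def)
      have "(\<Sum>i\<in>{1..n}. lim_moment \<alpha> i * A (n - i)) = (\<Sum>i\<in>{1..n}. A (n - i))"
        by (intro sum.cong refl) (simp add: y)
      also have "\<dots> = (\<Sum>i\<in>{n - 1, n} \<inter> {1..n}. A (n - i))"
        by (intro sum.mono_neutral_right) (auto simp: A)
      also have "\<dots> = (if n = 1 then 1 else 0)"
      proof (cases "n = 1")
        case False
        then have "{n - 1, n} \<inter> {1..n} = {n - 1, n}" using n by auto
        then show ?thesis using False n by (simp add: A)
      qed (simp add: A)
      finally show ?thesis using n by (simp add: A)
    next
      case False
      define c where "c = 1 - 2 * \<alpha>"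
      define B where "B = Abs_fps (\<lambda>j. central j * b ^ j)"
      define R where "R = (1 - fps_const (4 * b) * fps_X) * B"
      define Y where "Y = Abs_fps (\<lambda>j. if j = 0 then 0 else lim_moment \<alpha> j)"
      define G where "G = Abs_fps A"
      have c2: "1 - c * c = 4 * b" by (simp add: c_def b_def algebra_simps)
      have cS: "central (Suc n) = 2 * (2 * real n + 1) * central n / real (Suc n)" for n
        using central_Suc[of n] by (simp add: field_simps del: of_nat_Suc)
      have dB: "(1 - fps_const (4 * b) * fps_X) * fps_deriv B = fps_const (2 * b) * B"
      proof (rule fps_ext)
        fix n
        have "fps_nth ((1 - fps_const (4 * b) * fps_X) * fps_deriv B) n =
          real (Suc n) * central (Suc n) * b ^ Suc n - 4 * b * (real n * (central n * b ^ n))"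
          by (cases n) (simp_all add: B_def left_diff_distrib mult.assoc)
        also have "\<dots> = fps_nth (fps_const (2 * b) * B) n"
          unfolding central_Suc by (simp add: B_def algebra_simps)
        finally show "fps_nth ((1 - fps_const (4 * b) * fps_X) * fps_deriv B) n = fps_nth (fps_const (2 * b) * B) n" .
      qed
      have dR: "fps_deriv R = - (fps_const (2 * b) * B)"
      proof -
        have "fps_deriv R = (1 - fps_const (4 * b) * fps_X) * fps_deriv B - fps_const (4 * b) * B"
          unfolding R_def by (simp add: algebra_simps)
        also have "\<dots> = - (fps_const (2 * b) * B)" unfolding dB
          by (simp add: fps_eq_iff)
        finally show ?thesis .
      qed
      \<comment> \<open>Here \<open>R\<close> plays the role of the square root of
        \<open>1 - 4 b X\<close>. The differential equation for \<open>B\<close> makes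
        \<open>R * B\<close> constant, so no root of a power series is taken.\<close>
      have RB: "R * B = 1"
      proof -
        have "fps_deriv (R * B) = R * fps_deriv B - fps_const (2 * b) * B * B"
          by (simp add: dR)
        also have "R * fps_deriv B = ((1 - fps_const (4 * b) * fps_X) * fps_deriv B) * B"
          by (simp only: R_def mult_ac)
        finally have "fps_deriv (R * B) = 0" unfolding dB by simp
        then have "R * B = fps_const (fps_nth (R * B) 0)" by (simp only: fps_deriv_eq_0_iff)
        also have "fps_nth (R * B) 0 = 1" by (simp add: R_def B_def)
        finally show ?thesis by simp
      qed
      have YX: "fps_const 2 * ((1 - fps_X) * Y) = fps_X * (1 - fps_const c * B)"
      proof (rule fps_ext)
        fix n
        show "fps_nth (fps_const 2 * ((1 - fps_X) * Y)) n = fps_nth (fps_X * (1 - fps_const c * B)) n"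
        proof (cases n)
          case (Suc m)
          then show ?thesis
          proof (cases m)
            case 0
            have "2 * lim_moment \<alpha> (Suc 0) = 1 - c" by (simp add: c_def field_simps)
            then show ?thesis using Suc 0
              by (simp add: Y_def B_def left_diff_distrib right_diff_distrib del: lim_moment.simps)
          next
            case (Suc k)
            have "2 * lim_moment \<alpha> (Suc (Suc k)) = 2 * lim_moment \<alpha> (Suc k) - c * (central (Suc k) * b ^ Suc k)"
              unfolding lim_moment.simps(2)[of \<alpha> "Suc k"] by (simp add: c_def b_def del: lim_moment.simps)
            then show ?thesis using \<open>n = Suc m\<close> Suc
              by (simp add: Y_def B_def left_diff_distrib right_diff_distrib del: lim_moment.simps)
          qed
        qed (simp add: Y_def)
      qed
      have GR: "fps_const (2 * (1 - \<alpha>)) * G = fps_const c + R"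
      proof (rule fps_ext)
        fix n
        show "fps_nth (fps_const (2 * (1 - \<alpha>)) * G) n = fps_nth (fps_const c + R) n"
        proof (cases n)
          case 0
          then show ?thesis by (simp add: G_def A_def R_def B_def c_def)
        next
          case (Suc m)
          have "fps_nth (fps_const c + R) n = central (Suc m) * b ^ Suc m - 4 * b * (central m * b ^ m)"
            using Suc by (simp add: R_def B_def left_diff_distrib mult.assoc)
          also have "\<dots> = - 2 * b * central m * b ^ m / real (Suc m)"
            unfolding cS by (simp add: divide_simps) (simp add: algebra_simps)
          also have "\<dots> = 2 * (1 - \<alpha>) * (- \<alpha> * central m * b ^ m / real (Suc m))"
            by (simp add: b_def)
          also have "\<dots> = fps_nth (fps_const (2 * (1 - \<alpha>)) * G) n"
            using Suc by (simp add: G_def A_def)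
          finally show ?thesis by simp
        qed
      qed
      let ?F = "fps_const 2 * fps_const (2 * (1 - \<alpha>)) * (1 - fps_X)"
      have dG: "fps_const (2 * (1 - \<alpha>)) * fps_deriv G = - (fps_const (2 * b) * B)"
        using arg_cong[OF GR, of fps_deriv] by (simp add: dR)
      have "?F * (fps_X * fps_deriv G) = fps_const 2 * (1 - fps_X) * fps_X * (fps_const (2 * (1 - \<alpha>)) * fps_deriv G)"
        by (simp only: mult_ac)
      also have "\<dots> = - ((1 - fps_X) * fps_X * (fps_const (4 * b) * B))"
        unfolding dG by (simp add: fps_const_mult[symmetric] mult_ac del: fps_const_mult)
      finally have L: "?F * (fps_X * fps_deriv G) = - ((1 - fps_X) * fps_X * (fps_const (4 * b) * B))" .
      have "?F * (G * Y) = (fps_const (2 * (1 - \<alpha>)) * G) * (fps_const 2 * ((1 - fps_X) * Y))"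
        by (simp only: mult_ac)
      also have "\<dots> = fps_X * ((fps_const c + R) * (1 - fps_const c * B))"
        unfolding GR YX by (simp only: mult_ac)
      also have "(fps_const c + R) * (1 - fps_const c * B) =
          fps_const c - fps_const c * (fps_const c * B) + R - fps_const c * (R * B)"
        by (simp only: algebra_simps mult_1_left mult_1_right)
      also have "\<dots> = R - fps_const (c * c) * B" unfolding RB
        by (simp add: mult.assoc[symmetric])
      also have "\<dots> = (1 - fps_X) * (fps_const (4 * b) * B)"
      proof -
        have cc: "fps_const (c * c) = 1 - fps_const (4 * b)" using c2 by (simp add: fps_eq_iff)
        show ?thesis unfolding cc R_def by (simp only: algebra_simps mult_1_left mult_1_right)
      qed
      finally have Rr: "?F * (G * Y) = fps_X * ((1 - fps_X) * (fps_const (4 * b) * B))" .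
      have "?F * (fps_X * fps_deriv G) = ?F * (- (G * Y))"
        unfolding L mult_minus_right Rr by (simp only: mult_ac)
      moreover have "?F \<noteq> 0"
      proof
        assume "?F = 0"
        then have "fps_nth ?F 0 = 0" by simp
        then show False using False by simp
      qed
      ultimately have XG: "fps_X * fps_deriv G = - (G * Y)" by (metis mult_left_cancel)
      have "real n * A n = fps_nth (fps_X * fps_deriv G) n" using n by (simp add: G_def)
      also have "\<dots> = - fps_nth (Y * G) n" unfolding XG by (simp add: mult.commute)
      also have "fps_nth (Y * G) n = (\<Sum>i\<in>{0..n}. fps_nth Y i * A (n - i))"
        by (simp add: fps_mult_nth G_def)
      also have "\<dots> = (\<Sum>i\<in>{1..n}. lim_moment \<alpha> i * A (n - i))"
        by (rule sum.mono_neutral_cong_right) (auto simp: Y_def)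
      finally show ?thesis .
    qed
  qed
  from this[of "Suc j"] show ?thesis by (simp add: A_def b_def)
qed

section \<open>Stability of Newton's recursion and Taylor estimates\<close>

text \<open>Boundedness and the Lipschitz estimate are proved together, since the difference of two
  products of the recursion needs a bound on each factor. The factor \<open>1 + M\<close> lets one
  constant serve the new index and all previous ones.\<close>

lemma newton_bounds:
  assumes M: "M \<ge> 0"
  shows "\<exists>K\<ge>1. \<forall>m\<le>n. \<forall>Y y. (\<forall>i\<in>{1..m}. \<bar>Y i\<bar> \<le> M \<and> \<bar>y i\<bar> \<le> M) \<longrightarrow>
    \<bar>newton Y m\<bar> \<le> K \<and> \<bar>newton Y m - newton y m\<bar> \<le> K * (\<Sum>i\<in>{1..m}. \<bar>Y i - y i\<bar>)"
proof (induction n)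
  case 0
  show ?case by (intro exI[of _ 1]) auto
next
  case (Suc n)
  then obtain K where K: "K \<ge> 1" and IH: "\<And>m Y y. m \<le> n \<Longrightarrow> (\<forall>i\<in>{1..m}. \<bar>Y i\<bar> \<le> M \<and> \<bar>y i\<bar> \<le> M) \<Longrightarrow>
    \<bar>newton Y m\<bar> \<le> K \<and> \<bar>newton Y m - newton y m\<bar> \<le> K * (\<Sum>i\<in>{1..m}. \<bar>Y i - y i\<bar>)"
    by blast
  let ?K = "K * (1 + M)"
  have KK: "K \<le> ?K" using K M by (simp add: algebra_simps)
  show ?case
  proof (intro exI[of _ ?K] conjI allI impI)
    show "1 \<le> ?K" using K KK by linarith
  next
    fix m Y y assume m: "m \<le> Suc n" and b: "\<forall>i\<in>{1..m}. \<bar>Y i\<bar> \<le> M \<and> \<bar>y i\<bar> \<le> M"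
    define D where "D = (\<Sum>i\<in>{1..m}. \<bar>Y i - y i\<bar>)"
    have D0: "D \<ge> 0" unfolding D_def by (intro sum_nonneg) auto
    have "\<bar>newton Y m\<bar> \<le> ?K \<and> \<bar>newton Y m - newton y m\<bar> \<le> ?K * D"
    proof (cases "m \<le> n")
      case True
      then have "\<bar>newton Y m\<bar> \<le> K" "\<bar>newton Y m - newton y m\<bar> \<le> K * D" using IH[OF True b] by (auto simp: D_def)
      moreover have "K * D \<le> ?K * D" using KK D0 by (rule mult_right_mono)
      ultimately show ?thesis using KK by linarith
    next
      case False
      then have m': "m = Suc n" using m by simp
      have ih: "\<bar>newton Y (m - i)\<bar> \<le> K" "\<bar>newton y (m - i)\<bar> \<le> K" "\<bar>newton Y (m - i) - newton y (m - i)\<bar> \<le> K * D"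
        if i: "i \<in> {1..m}" for i
      proof -
        have le: "m - i \<le> n" using i m' by auto
        have b': "\<forall>l\<in>{1..m-i}. \<bar>Y l\<bar> \<le> M \<and> \<bar>y l\<bar> \<le> M" "\<forall>l\<in>{1..m-i}. \<bar>y l\<bar> \<le> M \<and> \<bar>Y l\<bar> \<le> M" using b by auto
        have "(\<Sum>l\<in>{1..m-i}. \<bar>Y l - y l\<bar>) \<le> D" unfolding D_def by (intro sum_mono2) auto
        then have "K * (\<Sum>l\<in>{1..m-i}. \<bar>Y l - y l\<bar>) \<le> K * D" using K by (intro mult_left_mono) auto
        then show "\<bar>newton Y (m - i)\<bar> \<le> K" "\<bar>newton y (m - i)\<bar> \<le> K" "\<bar>newton Y (m - i) - newton y (m - i)\<bar> \<le> K * D"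
          using IH[OF le b'(1)] IH[OF le b'(2)] by auto
      qed
      have "real m * \<bar>newton Y m\<bar> = \<bar>\<Sum>i\<in>{1..m}. Y i * newton Y (m - i)\<bar>"
        using newton_rec[of m Y] m' by (metis abs_minus_cancel abs_mult abs_of_nat zero_less_Suc)
      also have "\<dots> \<le> (\<Sum>i\<in>{1..m}. \<bar>Y i * newton Y (m - i)\<bar>)" by (rule sum_abs)
      also have "\<dots> \<le> (\<Sum>i\<in>{1..m}. M * K)"
        unfolding abs_mult using b ih M by (intro sum_mono mult_mono) auto
      also have "\<dots> = real m * (M * K)" by simp
      finally have "\<bar>newton Y m\<bar> \<le> M * K" using m' by (simp del: of_nat_Suc)
      then have 1: "\<bar>newton Y m\<bar> \<le> ?K" using K by (simp add: algebra_simps)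
      have "real m * \<bar>newton Y m - newton y m\<bar> = \<bar>real m * newton Y m - real m * newton y m\<bar>"
        by (simp add: abs_mult flip: right_diff_distrib)
      also have "\<dots> = \<bar>\<Sum>i\<in>{1..m}. y i * newton y (m - i) - Y i * newton Y (m - i)\<bar>"
        using newton_rec[of m Y] newton_rec[of m y] m' by (simp add: sum_subtractf)
      also have "\<dots> \<le> (\<Sum>i\<in>{1..m}. \<bar>y i * newton y (m - i) - Y i * newton Y (m - i)\<bar>)" by (rule sum_abs)
      also have "\<dots> \<le> (\<Sum>i\<in>{1..m}. \<bar>Y i - y i\<bar> * K + M * (K * D))"
      proof (rule sum_mono)
        fix i assume i: "i \<in> {1..m}"
        have "y i * newton y (m - i) - Y i * newton Y (m - i) =
          - ((Y i - y i) * newton Y (m - i) + y i * (newton Y (m - i) - newton y (m - i)))" by (simp add: algebra_simps)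
        then have "\<bar>y i * newton y (m - i) - Y i * newton Y (m - i)\<bar> \<le>
            \<bar>Y i - y i\<bar> * \<bar>newton Y (m - i)\<bar> + \<bar>y i\<bar> * \<bar>newton Y (m - i) - newton y (m - i)\<bar>"
          by (simp only: abs_minus_cancel abs_mult[symmetric] abs_triangle_ineq)
        also have "\<dots> \<le> \<bar>Y i - y i\<bar> * K + M * (K * D)"
          using ih[OF i] b i M by (intro add_mono mult_mono) auto
        finally show "\<bar>y i * newton y (m - i) - Y i * newton Y (m - i)\<bar> \<le> \<bar>Y i - y i\<bar> * K + M * (K * D)" .
      qed
      also have "\<dots> = K * D + real m * (M * (K * D))"
        by (simp add: sum.distrib D_def mult.commute flip: sum_distrib_left)
      also have "\<dots> \<le> real m * (K * D) + real m * (M * (K * D))"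
      proof -
        have "1 * (K * D) \<le> real m * (K * D)" using m' K D0 by (intro mult_right_mono) auto
        then show ?thesis by simp
      qed
      also have "\<dots> = real m * (?K * D)" by (simp add: algebra_simps)
      finally have "\<bar>newton Y m - newton y m\<bar> \<le> ?K * D" using m' by (simp del: of_nat_Suc)
      with 1 show ?thesis by blast
    qed
    then show "\<bar>newton Y m\<bar> \<le> ?K" "\<bar>newton Y m - newton y m\<bar> \<le> ?K * (\<Sum>i\<in>{1..m}. \<bar>Y i - y i\<bar>)"
      by (auto simp: D_def)
  qed
qed

text \<open>The highest argument \<open>Y (Suc j)\<close> enters the recursion only linearly, with
  coefficient \<open>newton Y 0 = 1\<close>. Isolating it shows the exact linear part of the drift;
  everything else is a remainder controlled by errors of lower moments, squared through
  Cauchy-Schwarz.\<close>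

lemma newton_diff:
  obtains K where "K \<ge> 0" "\<And>Y y. (\<forall>i\<in>{1..j}. \<bar>Y i\<bar> \<le> 1 \<and> \<bar>y i\<bar> \<le> 1) \<Longrightarrow>
    \<exists>R. real (Suc j) * (newton Y (Suc j) - newton y (Suc j)) = - ((Y (Suc j) - y (Suc j)) + R) \<and>
      R\<^sup>2 \<le> K * (\<Sum>i\<in>{1..j}. (Y i - y i)\<^sup>2)"
proof -
  obtain K where K: "K \<ge> 1" and B: "\<And>m Y y. m \<le> j \<Longrightarrow> (\<forall>i\<in>{1..m}. \<bar>Y i\<bar> \<le> 1 \<and> \<bar>y i\<bar> \<le> 1) \<Longrightarrow>
    \<bar>newton Y m\<bar> \<le> K \<and> \<bar>newton Y m - newton y m\<bar> \<le> K * (\<Sum>i\<in>{1..m}. \<bar>Y i - y i\<bar>)"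
    using newton_bounds[of 1 j] by fastforce
  let ?K = "(K + real j * K)\<^sup>2 * real j"
  show ?thesis
  proof
    show "?K \<ge> 0" by simp
    fix Y y :: "nat \<Rightarrow> real" assume b: "\<forall>i\<in>{1..j}. \<bar>Y i\<bar> \<le> 1 \<and> \<bar>y i\<bar> \<le> 1"
    define D where "D = (\<Sum>i\<in>{1..j}. \<bar>Y i - y i\<bar>)"
    have D0: "D \<ge> 0" unfolding D_def by (intro sum_nonneg) auto
    define R where "R = (\<Sum>i\<in>{1..j}. Y i * newton Y (Suc j - i) - y i * newton y (Suc j - i))"
    have s: "(\<Sum>i\<in>{1..Suc j}. Z i * newton Z (Suc j - i)) = Z (Suc j) + (\<Sum>i\<in>{1..j}. Z i * newton Z (Suc j - i))" for Z
      by simp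
    have 1: "real (Suc j) * (newton Y (Suc j) - newton y (Suc j)) = - ((Y (Suc j) - y (Suc j)) + R)"
      using newton_rec[of "Suc j" Y] newton_rec[of "Suc j" y]
      unfolding s right_diff_distrib R_def sum_subtractf by simp
    have "\<bar>R\<bar> \<le> (\<Sum>i\<in>{1..j}. \<bar>Y i * newton Y (Suc j - i) - y i * newton y (Suc j - i)\<bar>)"
      unfolding R_def by (rule sum_abs)
    also have "\<dots> \<le> (\<Sum>i\<in>{1..j}. \<bar>Y i - y i\<bar> * K + 1 * (K * D))"
    proof (rule sum_mono)
      fix i assume i: "i \<in> {1..j}"
      have le: "Suc j - i \<le> j" using i by auto
      have b': "\<forall>l\<in>{1..Suc j-i}. \<bar>Y l\<bar> \<le> 1 \<and> \<bar>y l\<bar> \<le> 1" using b i by auto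
      have "(\<Sum>l\<in>{1..Suc j-i}. \<bar>Y l - y l\<bar>) \<le> D" unfolding D_def using i by (intro sum_mono2) auto
      then have d: "K * (\<Sum>l\<in>{1..Suc j-i}. \<bar>Y l - y l\<bar>) \<le> K * D" using K by (intro mult_left_mono) auto
      have "Y i * newton Y (Suc j - i) - y i * newton y (Suc j - i) =
          ((Y i - y i) * newton Y (Suc j - i) + y i * (newton Y (Suc j - i) - newton y (Suc j - i)))" by (simp add: algebra_simps)
      then have "\<bar>Y i * newton Y (Suc j - i) - y i * newton y (Suc j - i)\<bar> \<le>
            \<bar>Y i - y i\<bar> * \<bar>newton Y (Suc j - i)\<bar> + \<bar>y i\<bar> * \<bar>newton Y (Suc j - i) - newton y (Suc j - i)\<bar>"
        by (simp only: abs_mult[symmetric] abs_triangle_ineq)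
      also have "\<dots> \<le> \<bar>Y i - y i\<bar> * K + 1 * (K * D)"
        using B[OF le b'] b i d by (intro add_mono mult_mono) auto
      finally show "\<bar>Y i * newton Y (Suc j - i) - y i * newton y (Suc j - i)\<bar> \<le> \<bar>Y i - y i\<bar> * K + 1 * (K * D)" .
    qed
    also have "\<dots> = K * D + real j * (K * D)"
      by (simp add: sum.distrib D_def mult.commute flip: sum_distrib_left)
    also have "\<dots> = (K + real j * K) * D" by (simp add: algebra_simps)
    finally have "\<bar>R\<bar>\<^sup>2 \<le> ((K + real j * K) * D)\<^sup>2" by (intro power_mono) auto
    then have "R\<^sup>2 \<le> (K + real j * K)\<^sup>2 * D\<^sup>2" by (simp add: power_mult_distrib)
    also have "D\<^sup>2 \<le> real j * (\<Sum>i\<in>{1..j}. (Y i - y i)\<^sup>2)"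
    proof -
      have "(\<Sum>i\<in>{1..j}. 1 * \<bar>Y i - y i\<bar>)\<^sup>2 \<le> (\<Sum>i\<in>{1..j}. 1\<^sup>2) * (\<Sum>i\<in>{1..j}. \<bar>Y i - y i\<bar>\<^sup>2)"
        by (rule Cauchy_Schwarz_ineq_sum)
      then show ?thesis by (simp add: D_def)
    qed
    finally have "R\<^sup>2 \<le> ?K * (\<Sum>i\<in>{1..j}. (Y i - y i)\<^sup>2)" by (simp add: mult_left_mono mult.assoc)
    with 1 show "\<exists>R. real (Suc j) * (newton Y (Suc j) - newton y (Suc j)) = - ((Y (Suc j) - y (Suc j)) + R) \<and>
      R\<^sup>2 \<le> ?K * (\<Sum>i\<in>{1..j}. (Y i - y i)\<^sup>2)" by blast
  qed
qed

text \<open>Induction on the exponent: multiplying the expansion by \<open>w + h\<close> reproduces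
  the next one, and the quadratic coefficient supplies the only new cubic term.\<close>

lemma power_taylor:
  "\<exists>C\<ge>0. \<forall>w h. \<bar>w\<bar> \<le> 1 \<longrightarrow> \<bar>h\<bar> \<le> 1 \<longrightarrow>
    \<bar>(w + h) ^ m - (w ^ m + real m * w ^ (m - 1) * h + real m * (real m - 1) / 2 * w ^ (m - 2) * h\<^sup>2)\<bar> \<le> C * \<bar>h :: real\<bar> ^ 3"
proof (induction m)
  case 0
  show ?case by (intro exI[of _ 0]) auto
next
  case (Suc m)
  then obtain C where C: "C \<ge> 0" and IH: "\<And>w h :: real. \<bar>w\<bar> \<le> 1 \<Longrightarrow> \<bar>h\<bar> \<le> 1 \<Longrightarrow>
    \<bar>(w + h) ^ m - (w ^ m + real m * w ^ (m - 1) * h + real m * (real m - 1) / 2 * w ^ (m - 2) * h\<^sup>2)\<bar> \<le> C * \<bar>h\<bar> ^ 3"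
    by blast
  define cm where "cm = real m * (real m - 1) / 2"
  have c0: "cm \<ge> 0" unfolding cm_def by (cases m) auto
  show ?case
  proof (intro exI[of _ "2 * C + cm"] conjI allI impI)
    show "2 * C + cm \<ge> 0" using C c0 by simp
    fix w h :: real assume wh: "\<bar>w\<bar> \<le> 1" "\<bar>h\<bar> \<le> 1"
    define r where "r = (w + h) ^ m - (w ^ m + real m * w ^ (m - 1) * h + cm * w ^ (m - 2) * h\<^sup>2)"
    have r: "\<bar>r\<bar> \<le> C * \<bar>h\<bar> ^ 3" using IH[OF wh] by (simp only: r_def cm_def)
    \<comment> \<open>For small \<open>m\<close> the truncated exponents \<open>m - 1\<close> and
      \<open>m - 2\<close> are wrong, but the coefficients \<open>m\<close> and \<open>cm\<close>
      then vanish.\<close>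
    have p1: "real m * (w * w ^ (m - 1)) = real m * w ^ m" by (cases m) auto
    have p2: "cm * (w * w ^ (m - 2)) = cm * w ^ (m - 1)"
    proof (cases "m \<le> 1")
      case True
      then have "m = 0 \<or> m = 1" by linarith
      then show ?thesis by (auto simp: cm_def)
    next
      case False
      then have "m - 1 = Suc (m - 2)" by simp
      then show ?thesis by simp
    qed
    have "(w + h) ^ Suc m = (w + h) * (r + (w ^ m + real m * w ^ (m - 1) * h + cm * w ^ (m - 2) * h\<^sup>2))"
      by (simp add: r_def)
    also have "\<dots> = (w + h) * r + w * w ^ m + w ^ m * h + (real m * (w * w ^ (m - 1))) * h + real m * w ^ (m - 1) * h\<^sup>2
         + cm * (w * w ^ (m - 2)) * h\<^sup>2 + cm * w ^ (m - 2) * h ^ 3"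
      by (simp add: algebra_simps power2_eq_square power3_eq_cube)
    also have "\<dots> = (w ^ Suc m + real (Suc m) * w ^ m * h + (real m + cm) * w ^ (m - 1) * h\<^sup>2) + ((w + h) * r + cm * w ^ (m - 2) * h ^ 3)"
      unfolding p1 p2 by (simp add: algebra_simps)
    also have "real m + cm = real (Suc m) * (real (Suc m) - 1) / 2" by (simp add: cm_def field_simps)
    finally have e: "(w + h) ^ Suc m - (w ^ Suc m + real (Suc m) * w ^ (Suc m - 1) * h +
        real (Suc m) * (real (Suc m) - 1) / 2 * w ^ (Suc m - 2) * h\<^sup>2) = (w + h) * r + cm * w ^ (m - 2) * h ^ 3"
      by (simp add: numeral_2_eq_2)
    have "\<bar>(w + h) * r\<bar> \<le> 2 * (C * \<bar>h\<bar> ^ 3)" unfolding abs_mult using wh r by (intro mult_mono) auto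
    moreover have "\<bar>cm * w ^ (m - 2) * h ^ 3\<bar> \<le> cm * 1 * \<bar>h\<bar> ^ 3"
    proof -
      have "\<bar>w ^ (m - 2)\<bar> \<le> 1" using wh by (simp add: power_abs power_le_one)
      then show ?thesis unfolding abs_mult power_abs using c0 by (intro mult_mono) auto
    qed
    ultimately have "\<bar>(w + h) * r + cm * w ^ (m - 2) * h ^ 3\<bar> \<le> (2 * C + cm) * \<bar>h\<bar> ^ 3"
      by (simp add: algebra_simps)
    then show "\<bar>(w + h) ^ Suc m - (w ^ Suc m + real (Suc m) * w ^ (Suc m - 1) * h +
        real (Suc m) * (real (Suc m) - 1) / 2 * w ^ (Suc m - 2) * h\<^sup>2)\<bar> \<le> (2 * C + cm) * \<bar>h\<bar> ^ 3" unfolding e .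
  qed
qed

lemma power_second_difference:
  obtains C where "C \<ge> 0" "\<And>w h :: real. \<bar>w\<bar> \<le> 1 \<Longrightarrow> 0 \<le> h \<Longrightarrow> h \<le> 1 \<Longrightarrow>
    \<bar>((w + h) ^ m - 2 * w ^ m + (w - h) ^ m) - real m * (real m - 1) * w ^ (m - 2) * h\<^sup>2\<bar> \<le> C * h ^ 3"
proof -
  obtain C where C: "C \<ge> 0" and T: "\<And>w h :: real. \<bar>w\<bar> \<le> 1 \<Longrightarrow> \<bar>h\<bar> \<le> 1 \<Longrightarrow>
    \<bar>(w + h) ^ m - (w ^ m + real m * w ^ (m - 1) * h + real m * (real m - 1) / 2 * w ^ (m - 2) * h\<^sup>2)\<bar> \<le> C * \<bar>h\<bar> ^ 3"
    using power_taylor[of m] by blast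
  show ?thesis
  proof (rule that[of "2 * C"])
    show "2 * C \<ge> 0" using C by simp
    fix w h :: real assume a: "\<bar>w\<bar> \<le> 1" "0 \<le> h" "h \<le> 1"
    define x where "x = real m * (real m - 1) / 2 * w ^ (m - 2) * h\<^sup>2"
    define y where "y = real m * w ^ (m - 1) * h"
    have "\<bar>(w + h) ^ m - (w ^ m + y + x)\<bar> \<le> C * h ^ 3" using T[of w h] a by (simp add: x_def y_def)
    moreover have "\<bar>(w - h) ^ m - (w ^ m - y + x)\<bar> \<le> C * h ^ 3" using T[of w "-h"] a by (simp add: x_def y_def)
    moreover have "real m * (real m - 1) * w ^ (m - 2) * h\<^sup>2 = 2 * x" by (simp add: x_def)
    ultimately show "\<bar>((w + h) ^ m - 2 * w ^ m + (w - h) ^ m) - real m * (real m - 1) * w ^ (m - 2) * h\<^sup>2\<bar> \<le> 2 * C * h ^ 3"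
      by linarith
  qed
qed

declare lim_moment.simps(2) [simp del]

section \<open>Scaled empirical moments and one backward step\<close>

definition emp_moment :: "nat \<Rightarrow> nat set \<Rightarrow> nat \<Rightarrow> real" where
  "emp_moment n S j = power_diff_sum S j / real n ^ (2 * j)"

lemma power_diff_nonneg: "(real t - 1/2) ^ (2 * j) \<le> (real t + 1/2) ^ (2 * j)"
proof (cases "t = 0")
  case True
  then show ?thesis by (simp add: power_mult power2_eq_square)
next
  case False
  then show ?thesis by (intro power_mono) auto
qed

lemma power_diff_sum_full:
  "power_diff_sum {1..n} j = (real n + 1/2) ^ (2 * j) - (1/2) ^ (2 * j)"
proof (induction n)
  case (Suc n)
  have e: "real n + 1/2 = real (Suc n) - 1/2" by simp
  have "power_diff_sum {1..Suc n} j = power_diff_sum {1..n} j +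
      ((real (Suc n) + 1/2) ^ (2 * j) - (real (Suc n) - 1/2) ^ (2 * j))"
    by (simp add: power_diff_sum_def)
  then show ?case unfolding Suc e by simp
qed (simp add: power_diff_sum_def)

lemma emp_moment_full:
  assumes "n \<ge> 1"
  shows "emp_moment n {1..n-1} j = (1 - 1 / (2 * real n)) ^ (2 * j) - (1 / (2 * real n)) ^ (2 * j)"
proof -
  have n: "real n > 0" using assms by simp
  have "real (n - 1) + 1/2 = real n * (1 - 1 / (2 * real n))" "1/2 = real n * (1 / (2 * real n))"
    using assms n by (simp_all add: of_nat_diff field_simps)
  then have "power_diff_sum {1..n-1} j =
      (real n * (1 - 1 / (2 * real n))) ^ (2 * j) - (real n * (1 / (2 * real n))) ^ (2 * j)"
    using power_diff_sum_full[of "n-1" j] by metis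
  also have "\<dots> = real n ^ (2 * j) * ((1 - 1 / (2 * real n)) ^ (2 * j) - (1 / (2 * real n)) ^ (2 * j))"
    unfolding power_mult_distrib by (rule right_diff_distrib[symmetric])
  finally show ?thesis using n by (simp add: emp_moment_def)
qed

lemma emp_moment_bounds:
  assumes "S \<subseteq> {1..n-1}"
  shows "0 \<le> emp_moment n S j" "emp_moment n S j \<le> 1"
proof -
  show "0 \<le> emp_moment n S j" unfolding emp_moment_def power_diff_sum_def
    using power_diff_nonneg by (intro divide_nonneg_nonneg sum_nonneg) auto
  show "emp_moment n S j \<le> 1"
  proof (cases "n = 0")
    case True
    then show ?thesis using assms by (simp add: emp_moment_def power_diff_sum_def)
  next
    case False
    then have n: "n \<ge> 1" by simp
    have "power_diff_sum S j \<le> power_diff_sum {1..n-1} j" unfolding power_diff_sum_def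
      using assms power_diff_nonneg by (intro sum_mono2) auto
    then have "emp_moment n S j \<le> emp_moment n {1..n-1} j"
      unfolding emp_moment_def by (intro divide_right_mono) auto
    also have "\<dots> \<le> 1 ^ (2 * j) - 0"
      unfolding emp_moment_full[OF n] using n by (intro diff_mono power_mono) (auto simp: field_simps)
    finally show ?thesis by simp
  qed
qed

lemma emp_moment_full_error:
  assumes "n \<ge> 1" "j \<ge> 1"
  shows "\<bar>emp_moment n {1..n-1} j - 1\<bar> \<le> (real j + 1) / real n"
proof -
  define h where "h = 1 / (2 * real n)"
  have h: "0 \<le> h" "h \<le> 1" using assms by (auto simp: h_def field_simps)
  have "1 + real (2 * j) * (- h) \<le> (1 + (- h)) ^ (2 * j)" using h by (intro Bernoulli_inequality) auto
  then have "1 - 2 * (real j * h) \<le> (1 - h) ^ (2 * j)" by simp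
  moreover have "(1 - h) ^ (2 * j) \<le> 1" using h by (intro power_le_one) auto
  moreover have "h ^ (2 * j) \<le> h ^ 1" using h assms by (intro power_decreasing) auto
  moreover have "h ^ (2 * j) \<ge> 0" "0 \<le> real j * h" using h by auto
  ultimately have "\<bar>(1 - h) ^ (2 * j) - h ^ (2 * j) - 1\<bar> \<le> 2 * real j * h + h"
    unfolding abs_le_iff power_one_right by (intro conjI) linarith+
  also have "\<dots> \<le> 2 * (real j + 1) * h" using h by (simp add: algebra_simps)
  also have "\<dots> = (real j + 1) / real n" using assms by (simp add: h_def field_simps)
  finally show ?thesis unfolding emp_moment_full[OF assms(1)] h_def .
qed

text \<open>A part contributes a first difference of the power \<open>2 j\<close>; lowering the part
  by one turns the change into a second difference, centred at \<open>(s - 1/2) / n\<close>, the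
  very point at which \<open>down_weight_moment\<close> takes powers.\<close>

definition moment_drop :: "nat \<Rightarrow> nat \<Rightarrow> nat \<Rightarrow> real" where
  "moment_drop n j s = ((real s - 1/2) / n + 1 / n) ^ (2 * j) - 2 * ((real s - 1/2) / n) ^ (2 * j) +
     ((real s - 1/2) / n - 1 / n) ^ (2 * j)"

lemma emp_moment_pull:
  assumes S: "finite S" "0 \<notin> S" "s \<in> S" "s - 1 \<notin> S" and n: "n \<ge> 1"
  shows "emp_moment n (pull S s) j = emp_moment n S j - moment_drop n j s"
proof -
  let ?g = "\<lambda>t::nat. (real t + 1/2) ^ (2 * j) - (real t - 1/2) ^ (2 * j)"
  have s: "s \<ge> 1" using S by (metis One_nat_def Suc_leI gr0I)
  have 1: "power_diff_sum S j = ?g s + power_diff_sum (S - {s}) j"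
    unfolding power_diff_sum_def using S by (simp add: sum.remove)
  \<comment> \<open>The exponent is even, so a fictitious part 0 contributes nothing and the removal
    of a part 1 follows the general pattern.\<close>
  have g0: "?g 0 = 0" by (simp add: power_mult power2_eq_square)
  have 2: "power_diff_sum (pull S s) j = ?g (s - 1) + power_diff_sum (S - {s}) j"
  proof (cases "s = 1")
    case True
    then have "pull S s = S - {s}" using S by (auto simp: pull_def)
    then show ?thesis using True g0 by simp
  next
    case False
    then have "pull S s = insert (s - 1) (S - {s})" using S s by (auto simp: pull_def)
    then show ?thesis using S by (simp add: power_diff_sum_def)
  qed
  have "power_diff_sum (pull S s) j = power_diff_sum S j -
      ((real s + 1/2) ^ (2 * j) - 2 * (real s - 1/2) ^ (2 * j) + (real s - 3/2) ^ (2 * j))"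
    unfolding 1 2 using s by (simp add: of_nat_diff algebra_simps)
  moreover have "moment_drop n j s = ((real s + 1/2) / n) ^ (2 * j) - 2 * ((real s - 1/2) / n) ^ (2 * j) + ((real s - 3/2) / n) ^ (2 * j)"
  proof -
    have "(real s - 1/2) / n + 1 / n = (real s + 1/2) / n" "(real s - 1/2) / n - 1 / n = (real s - 3/2) / n"
      using n by (simp_all add: field_simps)
    then show ?thesis unfolding moment_drop_def by simp
  qed
  ultimately show ?thesis
    unfolding emp_moment_def power_divide by (simp add: diff_divide_distrib add_divide_distrib)
qed

text \<open>By homogeneity of Newton's recursion the scaling is absorbed into the moments. The shift
  from \<open>m\<close> to \<open>Suc m\<close> leaves a factor \<open>n^2\<close>, which balances
  the size \<open>1 / n^2\<close> of \<open>moment_drop\<close>.\<close>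

lemma down_weight_scaled_moment:
  assumes S: "finite S" "0 \<notin> S" "S \<noteq> {}" and n: "n \<ge> 1"
  shows "(\<Sum>s\<in>S. down_weight S s * ((real s - 1/2) / real n) ^ (2 * m)) =
    - (real n)\<^sup>2 * newton (emp_moment n S) (Suc m) / (2 * real (\<Sum>S))"
proof -
  have "emp_moment n S = (\<lambda>i. power_diff_sum S i * (1 / (real n)\<^sup>2) ^ i)"
    by (simp add: fun_eq_iff emp_moment_def power_mult power_divide)
  then have "newton (emp_moment n S) (Suc m) = newton (power_diff_sum S) (Suc m) * (1 / (real n)\<^sup>2) ^ Suc m"
    by (simp only: newton_scale)
  also have "\<dots> = newton (power_diff_sum S) (Suc m) / ((real n)\<^sup>2 * real n ^ (2 * m))"
    by (simp add: power_mult power_divide)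
  finally have 1: "newton (power_diff_sum S) (Suc m) = newton (emp_moment n S) (Suc m) * ((real n)\<^sup>2 * real n ^ (2 * m))"
    using n by (simp add: field_simps)
  have "(\<Sum>s\<in>S. down_weight S s * ((real s - 1/2) / real n) ^ (2 * m)) =
    (\<Sum>s\<in>S. down_weight S s * (real s - 1/2) ^ (2 * m)) / real n ^ (2 * m)"
    by (simp add: sum_divide_distrib power_divide)
  then show ?thesis unfolding down_weight_moment[OF S] 1 using n by (simp add: field_simps)
qed

lemma moment_drop_taylor:
  obtains C where "C \<ge> 0" "\<And>n s. n \<ge> 1 \<Longrightarrow> 1 \<le> s \<Longrightarrow> s \<le> n \<Longrightarrow>
    \<bar>moment_drop n (Suc m) s - 2 * real (Suc m) * (2 * real (Suc m) - 1) * ((real s - 1/2) / real n) ^ (2 * m) / (real n)\<^sup>2\<bar>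
      \<le> C / real n ^ 3"
proof -
  obtain C where C: "C \<ge> 0" and T: "\<And>w h :: real. \<bar>w\<bar> \<le> 1 \<Longrightarrow> 0 \<le> h \<Longrightarrow> h \<le> 1 \<Longrightarrow>
    \<bar>((w + h) ^ (2 * Suc m) - 2 * w ^ (2 * Suc m) + (w - h) ^ (2 * Suc m)) -
      real (2 * Suc m) * (real (2 * Suc m) - 1) * w ^ (2 * Suc m - 2) * h\<^sup>2\<bar> \<le> C * h ^ 3"
    by (rule power_second_difference[of "2 * Suc m"]) (erule that, blast)
  show ?thesis
  proof (rule that[OF C])
    fix n s :: nat assume ns: "n \<ge> 1" "1 \<le> s" "s \<le> n"
    have w: "\<bar>(real s - 1/2) / real n\<bar> \<le> 1" using ns by (simp add: field_simps)
    have e: "2 * Suc m - 2 = 2 * m" by simp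
    have "\<bar>moment_drop n (Suc m) s - real (2 * Suc m) * (real (2 * Suc m) - 1) * ((real s - 1/2) / real n) ^ (2 * m) * (1 / real n)\<^sup>2\<bar>
       \<le> C * (1 / real n) ^ 3"
      using T[OF w, of "1 / real n"] ns unfolding moment_drop_def e by simp
    moreover have "real (2 * Suc m) = 2 * real (Suc m)" by simp
    ultimately show "\<bar>moment_drop n (Suc m) s - 2 * real (Suc m) * (2 * real (Suc m) - 1) * ((real s - 1/2) / real n) ^ (2 * m) / (real n)\<^sup>2\<bar>
      \<le> C / real n ^ 3"
      by (simp only: power_divide power_one times_divide_eq_right mult_1_right)
  qed
qed

lemma two_choose_two: "2 * real (n choose 2) = real n * (real n - 1)"
proof (cases n)
  case (Suc m)
  have "even (n * (n - 1))" using Suc by simp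
  then have "2 * (n choose 2) = n * m" unfolding choose_two using Suc by simp
  then have "real (2 * (n choose 2)) = real (n * m)" by (rule arg_cong)
  then show ?thesis using Suc by (simp add: algebra_simps)
qed simp

lemma choose_two_ge:
  assumes "n \<ge> 2"
  shows "real (n choose 2) \<ge> (real n)\<^sup>2 / 4"
proof -
  have "real n * (real n - 1) \<ge> real n * (real n / 2)"
    using assms by (intro mult_left_mono) auto
  then show ?thesis using two_choose_two[of n] by (simp add: power2_eq_square)
qed

lemma choose_two_le: "real (n choose 2) \<le> (real n)\<^sup>2"
proof -
  have "real n * (real n - 1) \<le> real n * real n" by (intro mult_left_mono) auto
  then have "2 * real (n choose 2) \<le> (real n)\<^sup>2" using two_choose_two[of n] by (simp add: power2_eq_square)
  moreover have "real (n choose 2) \<ge> 0" by simp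
  ultimately show ?thesis by linarith
qed

text \<open>The linearised drift of the error is
  \<open>-(2j-1)/k\<close> times itself, so its sign absorbs the cross terms with the lower moments.\<close>

lemma moment_error_step:
  fixes j :: nat
  obtains C where "C \<ge> 0"
    "\<And>n S k. n \<ge> 2 \<Longrightarrow> S \<subseteq> {1..n-1} \<Longrightarrow> \<Sum>S = k \<Longrightarrow> k \<ge> 1 \<Longrightarrow> k \<le> n choose 2 \<Longrightarrow>
      (\<Sum>s\<in>S. down_weight S s *
         (emp_moment n (pull S s) (Suc j) - lim_moment (real (k - 1) / real (n choose 2)) (Suc j))\<^sup>2)
      \<le> (emp_moment n S (Suc j) - lim_moment (real k / real (n choose 2)) (Suc j))\<^sup>2 +
        C / real k * (\<Sum>i\<in>{1..j}. (emp_moment n S i - lim_moment (real k / real (n choose 2)) i)\<^sup>2) + C / real n ^ 3"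
proof -
  define J where "J = real (Suc j)"
  define a where "a = 2 * J * (2 * J - 1)"
  have J: "J \<ge> 1" by (simp add: J_def)
  have a0: "a \<ge> 0" using J by (simp add: a_def)
  obtain K where K: "K \<ge> 0" and ND: "\<And>Y y. (\<forall>i\<in>{1..j}. \<bar>Y i\<bar> \<le> 1 \<and> \<bar>y i\<bar> \<le> 1) \<Longrightarrow>
    \<exists>R. real (Suc j) * (newton Y (Suc j) - newton y (Suc j)) = - ((Y (Suc j) - y (Suc j)) + R) \<and>
      R\<^sup>2 \<le> K * (\<Sum>i\<in>{1..j}. (Y i - y i)\<^sup>2)"
    by (rule newton_diff[of j]) (erule that, blast)
  obtain C1 where C1: "C1 \<ge> 0" and T: "\<And>n s. n \<ge> 1 \<Longrightarrow> 1 \<le> s \<Longrightarrow> s \<le> n \<Longrightarrow>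
    \<bar>moment_drop n (Suc j) s - a * ((real s - 1/2) / real n) ^ (2 * j) / (real n)\<^sup>2\<bar> \<le> C1 / real n ^ 3"
    by (rule moment_drop_taylor[of j, folded J_def, folded a_def]) (erule that, blast)
  define c where "c = J * central (Suc j) / 2"
  have c0: "c \<ge> 0" using central_nonneg J by (simp add: c_def)
  obtain C2 where C2: "C2 \<ge> 0" and Lin: "\<And>x h. 0 \<le> x - h \<Longrightarrow> x \<le> 1 \<Longrightarrow> 0 \<le> h \<Longrightarrow>
    \<bar>lim_moment x (Suc j) - lim_moment (x - h) (Suc j) - h * (c * (x * (1 - x)) ^ j)\<bar> \<le> C2 * h\<^sup>2"
    by (rule lim_moment_linear[of j, folded J_def, folded c_def]) (erule that, blast)
  define C3 where "C3 = a + C1 + 4 * c + 16 * C2"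
  have C3: "C3 \<ge> 0" using a0 C1 c0 C2 by (simp add: C3_def)
  \<comment> \<open>The first summand pays for the lower moments. The second collects the Taylor
    errors multiplied by \<open>2 \<bar>D\<bar> \<le> 4\<close> and the squared increments.\<close>
  define C where "C = 2 * J * K + (4 * (C1 + 16 * C2) + C3\<^sup>2)"
  have Ca: "2 * J * K \<le> C" "4 * (C1 + 16 * C2) + C3\<^sup>2 \<le> C" "C \<ge> 0"
    using J K C1 C2 by (auto simp: C_def)
  show ?thesis
  proof (rule that[OF Ca(3)])
    fix n S k assume n: "n \<ge> 2" and S: "S \<subseteq> {1..n-1}" "\<Sum>S = k" and k: "k \<ge> 1" "k \<le> n choose 2"
    have fin: "finite S" "0 \<notin> S" "S \<noteq> {}" using S k by (auto intro: finite_subset)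
    define N where "N = real (n choose 2)"
    define x where "x = real k / N"
    have N: "N \<ge> (real n)\<^sup>2 / 4" using choose_two_ge[OF n] by (simp add: N_def)
    have np: "real n \<ge> 2" using n by simp
    then have n2: "(real n)\<^sup>2 > 0" by simp
    then have Np: "N > 0" using N by linarith
    have x: "0 < x" "x \<le> 1" using k Np by (auto simp: x_def N_def)
    have xh: "real (k - 1) / N = x - 1 / N" using k by (simp add: x_def of_nat_diff diff_divide_distrib)
    have xh0: "0 \<le> x - 1 / N" unfolding xh[symmetric] using Np by simp
    have hN: "1 / N \<le> 4 / (real n)\<^sup>2"
    proof -
      have "1 / N \<le> 1 / ((real n)\<^sup>2 / 4)" using N n2 Np by (intro divide_left_mono) auto
      then show ?thesis by simp
    qed
    have n3: "1 / (real n) ^ 4 \<le> 1 / real n ^ 3" using np by (intro divide_left_mono power_increasing) auto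
    have n32: "1 / (real n) ^ 3 \<le> 1 / real n ^ 2" using np by (intro divide_left_mono power_increasing) auto
    have hN2: "(1 / N)\<^sup>2 \<le> 16 / real n ^ 3"
    proof -
      have "(1 / N)\<^sup>2 \<le> (4 / (real n)\<^sup>2)\<^sup>2" using hN Np by (intro power_mono) auto
      also have "\<dots> = 16 * (1 / real n ^ 4)" by (simp add: power_divide flip: power_mult)
      also have "\<dots> \<le> 16 * (1 / real n ^ 3)" using n3 by simp
      finally show ?thesis by simp
    qed
    define Y where "Y = emp_moment n S"
    define y where "y = lim_moment x"
    define D where "D = Y (Suc j) - y (Suc j)"
    define dy where "dy = lim_moment x (Suc j) - lim_moment (x - 1 / N) (Suc j)"
    define p where "p = down_weight S"
    have p0: "p s \<ge> 0" if "s \<in> S" for s using down_weight_nonneg[OF fin(1,2) that] by (simp add: p_def)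
    have p1: "(\<Sum>s\<in>S. p s) = 1" using sum_down_weight[OF fin] by (simp add: p_def)
    define eta where "eta = (\<lambda>s. moment_drop n (Suc j) s - dy)"
    have sS: "1 \<le> s" "s \<le> n" if "s \<in> S" for s
    proof -
      have "s \<in> {1..n-1}" using S(1) that by blast
      then show "1 \<le> s" "s \<le> n" by auto
    qed
    \<comment> \<open>terms with \<open>s - 1 \<in> S\<close> carry weight zero\<close>
    have "(\<Sum>s\<in>S. p s * (emp_moment n (pull S s) (Suc j) - lim_moment (x - 1 / N) (Suc j))\<^sup>2) =
       (\<Sum>s\<in>S. p s * (D - eta s)\<^sup>2)"
    proof (rule sum.cong[OF refl])
      fix s assume s: "s \<in> S"
      show "p s * (emp_moment n (pull S s) (Suc j) - lim_moment (x - 1 / N) (Suc j))\<^sup>2 = p s * (D - eta s)\<^sup>2"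
      proof (cases "s - 1 \<in> S")
        case True
        then have "p s = 0" using down_weight_eq_0[OF fin(1) True] sS[OF s] by (simp add: p_def)
        then show ?thesis by simp
      next
        case False
        have "emp_moment n (pull S s) (Suc j) - lim_moment (x - 1 / N) (Suc j) = D - eta s"
          using emp_moment_pull[OF fin(1,2) s False, of n "Suc j"] n
          by (simp add: D_def eta_def dy_def Y_def y_def)
        then show ?thesis by simp
      qed
    qed
    also have "\<dots> = (\<Sum>s\<in>S. p s * D\<^sup>2 - 2 * D * (p s * eta s) + p s * (eta s)\<^sup>2)"
      by (intro sum.cong refl) (simp add: power2_eq_square algebra_simps)
    also have "\<dots> = D\<^sup>2 - 2 * D * (\<Sum>s\<in>S. p s * eta s) + (\<Sum>s\<in>S. p s * (eta s)\<^sup>2)"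
      by (simp add: sum.distrib sum_subtractf p1 flip: sum_distrib_left sum_distrib_right)
    finally have main: "(\<Sum>s\<in>S. p s * (emp_moment n (pull S s) (Suc j) - lim_moment (x - 1 / N) (Suc j))\<^sup>2) =
        D\<^sup>2 - 2 * D * (\<Sum>s\<in>S. p s * eta s) + (\<Sum>s\<in>S. p s * (eta s)\<^sup>2)" .
    define q where "q = (x * (1 - x)) ^ j"
    have q: "0 \<le> q" "q \<le> 1"
    proof -
      have "0 \<le> x * (1 - x) \<and> x * (1 - x) \<le> 1 * 1"
        using x by (intro conjI mult_nonneg_nonneg mult_mono) auto
      then show "0 \<le> q" "q \<le> 1" unfolding q_def by (auto intro!: power_le_one)
    qed
    have dy: "\<bar>dy - 1 / N * (c * q)\<bar> \<le> C2 * (1 / N)\<^sup>2"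
      using Lin[OF xh0 x(2)] Np by (simp add: dy_def q_def)
    have C2N: "C2 * (1 / N)\<^sup>2 \<le> 16 * C2 / real n ^ 3" using mult_left_mono[OF hN2 C2] by (simp add: mult.commute)
    \<comment> \<open>Each increment of the error is of order \<open>1 / n^2\<close>, so its square
      is of order \<open>1 / n^4\<close>. This is smaller than the Taylor remainder
      \<open>1 / n^3\<close>, whose total over the order \<open>n^2\<close> steps is
      \<open>1 / n\<close>.\<close>
    have eta_bound: "\<bar>eta s\<bar> \<le> C3 / (real n)\<^sup>2" if s: "s \<in> S" for s
    proof -
      define w where "w = ((real s - 1/2) / real n) ^ (2 * j)"
      have "0 \<le> (real s - 1/2) / real n" "(real s - 1/2) / real n \<le> 1" using sS[OF s] np by (auto simp: field_simps)
      then have w: "0 \<le> w" "w \<le> 1" unfolding w_def by (auto intro!: power_le_one)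
      have "\<bar>moment_drop n (Suc j) s - a * w / (real n)\<^sup>2\<bar> \<le> C1 / real n ^ 3"
        using T[of n s] sS[OF s] n by (simp add: w_def)
      moreover have "0 \<le> a * w / (real n)\<^sup>2" using a0 w by simp
      moreover have "a * w / (real n)\<^sup>2 \<le> a * 1 / (real n)\<^sup>2"
        using a0 w by (intro divide_right_mono mult_left_mono) auto
      moreover have "C1 / real n ^ 3 \<le> C1 / (real n)\<^sup>2" using mult_left_mono[OF n32 C1] by simp
      moreover have "0 \<le> 1 / N * (c * q)" using Np c0 q by simp
      moreover have "1 / N * (c * q) \<le> 4 / (real n)\<^sup>2 * (c * 1)"
        using hN Np c0 q by (intro mult_mono mult_nonneg_nonneg) auto
      moreover have "16 * C2 / real n ^ 3 \<le> 16 * C2 / (real n)\<^sup>2" using mult_left_mono[OF n32, of "16 * C2"] C2 by simp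
      moreover have "C3 / (real n)\<^sup>2 = a * 1 / (real n)\<^sup>2 + C1 / (real n)\<^sup>2 + 4 / (real n)\<^sup>2 * (c * 1) + 16 * C2 / (real n)\<^sup>2"
        by (simp add: C3_def add_divide_distrib)
      ultimately show ?thesis using dy C2N unfolding eta_def abs_le_iff by linarith
    qed
    have second: "(\<Sum>s\<in>S. p s * (eta s)\<^sup>2) \<le> C3\<^sup>2 / real n ^ 3"
    proof -
      have "(\<Sum>s\<in>S. p s * (eta s)\<^sup>2) \<le> (\<Sum>s\<in>S. p s * (C3 / (real n)\<^sup>2)\<^sup>2)"
      proof (intro sum_mono mult_left_mono p0)
        fix s assume "s \<in> S"
        then have "\<bar>eta s\<bar>\<^sup>2 \<le> (C3 / (real n)\<^sup>2)\<^sup>2" using eta_bound by (intro power_mono) auto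
        then show "(eta s)\<^sup>2 \<le> (C3 / (real n)\<^sup>2)\<^sup>2" by simp
      qed
      also have "\<dots> = (\<Sum>s\<in>S. p s) * (C3 / (real n)\<^sup>2)\<^sup>2" by (simp only: sum_distrib_right)
      also have "\<dots> = C3\<^sup>2 * (1 / real n ^ 4)" unfolding p1
        by (simp add: power_divide flip: power_mult)
      also have "\<dots> \<le> C3\<^sup>2 * (1 / real n ^ 3)" using n3 by (intro mult_left_mono) auto
      finally show ?thesis by simp
    qed
    obtain R where R: "J * (newton Y (Suc j) - newton y (Suc j)) = - (D + R)"
      "R\<^sup>2 \<le> K * (\<Sum>i\<in>{1..j}. (Y i - y i)\<^sup>2)"
    proof -
      have "\<forall>i\<in>{1..j}. \<bar>Y i\<bar> \<le> 1 \<and> \<bar>y i\<bar> \<le> 1"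
      proof
        fix i assume "i \<in> {1..j}"
        then show "\<bar>Y i\<bar> \<le> 1 \<and> \<bar>y i\<bar> \<le> 1"
          using emp_moment_bounds[OF S(1), of i] lim_moment_bounds[of x "i - 1"] x
          by (simp add: Y_def y_def del: lim_moment.simps)
      qed
      from ND[OF this] show ?thesis using that by (auto simp: D_def J_def)
    qed
    have kp: "real k > 0" using k by simp
    \<comment> \<open>The derivative of the limit moment is Newton's expression evaluated at the
      limit moments themselves, with the same factor \<open>J (2 J - 1) / k\<close> as the empirical
      drift. Subtracting the two leaves a difference of Newton values, to which
      \<open>newton_diff\<close> applies.\<close>
    have drift: "1 / N * (c * q) = - (J * (2 * J - 1) / real k) * newton y (Suc j)"
    proof -
      have "newton y (Suc j) = - x * central j * q / J"
        unfolding y_def using newton_lim_moment[of x j] x by (simp add: q_def J_def)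
      then have Jn: "J * newton y (Suc j) = - (x * central j * q)" using J by simp
      have "- (J * (2 * J - 1) / real k) * newton y (Suc j) = - ((2 * J - 1) / real k) * (J * newton y (Suc j))"
        by simp
      also have "\<dots> = (2 * J - 1) * (x / real k) * central j * q" unfolding Jn by simp
      finally have "- (J * (2 * J - 1) / real k) * newton y (Suc j) = (2 * J - 1) * (x / real k) * central j * q" .
      also have "x / real k = 1 / N" using kp by (simp add: x_def)
      also have "(2 * J - 1) * (1 / N) * central j * q = 1 / N * (J * central (Suc j) / 2 * q)"
      proof -
        have "J * central (Suc j) = 2 * (2 * J - 1) * central j"
          unfolding J_def central_Suc by simp
        then have "J * central (Suc j) / 2 = (2 * J - 1) * central j" by simp
        then show ?thesis by simp
      qed
      finally show ?thesis by (simp add: c_def)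
    qed
    \<comment> \<open>What remains of the mean increment after the linearised drift: the Taylor
      remainder of \<open>moment_drop\<close> and that of \<open>lim_moment\<close>.\<close>
    define e where "e = (\<Sum>s\<in>S. p s * eta s) - (2 * J - 1) / real k * (D + R)"
    have e: "\<bar>e\<bar> \<le> (C1 + 16 * C2) / real n ^ 3"
    proof -
      define r where "r = (\<lambda>s. moment_drop n (Suc j) s - a * ((real s - 1/2) / real n) ^ (2 * j) / (real n)\<^sup>2)"
      have "(\<Sum>s\<in>S. p s * eta s) =
        (\<Sum>s\<in>S. p s * r s + a / (real n)\<^sup>2 * (p s * ((real s - 1/2) / real n) ^ (2 * j)) - p s * dy)"
        by (intro sum.cong refl) (simp add: eta_def r_def algebra_simps)
      also have "\<dots> = (\<Sum>s\<in>S. p s * r s) + a / (real n)\<^sup>2 * (\<Sum>s\<in>S. p s * ((real s - 1/2) / real n) ^ (2 * j)) - (\<Sum>s\<in>S. p s) * dy"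
        by (simp only: sum.distrib sum_subtractf sum_distrib_left sum_distrib_right)
      also have "(\<Sum>s\<in>S. p s) * dy = dy" unfolding p1 by simp
      also have "(\<Sum>s\<in>S. p s * ((real s - 1/2) / real n) ^ (2 * j)) = - (real n)\<^sup>2 * newton Y (Suc j) / (2 * real k)"
        unfolding p_def Y_def using down_weight_scaled_moment[OF fin, of n j] n S(2) by simp
      also have "a / (real n)\<^sup>2 * (- (real n)\<^sup>2 * newton Y (Suc j) / (2 * real k)) = - (J * (2 * J - 1) / real k) * newton Y (Suc j)"
        using n2 by (simp add: a_def)
      finally have "(\<Sum>s\<in>S. p s * eta s) = (\<Sum>s\<in>S. p s * r s) - (dy - 1 / N * (c * q))
          - (2 * J - 1) / real k * (J * (newton Y (Suc j) - newton y (Suc j)))"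
        unfolding drift by (simp add: algebra_simps diff_divide_distrib)
      then have "e = (\<Sum>s\<in>S. p s * r s) - (dy - 1 / N * (c * q))"
        unfolding e_def R(1) mult_minus_right by linarith
      moreover have "\<bar>\<Sum>s\<in>S. p s * r s\<bar> \<le> C1 / real n ^ 3"
      proof -
        have "\<bar>\<Sum>s\<in>S. p s * r s\<bar> \<le> (\<Sum>s\<in>S. \<bar>p s * r s\<bar>)" by (rule sum_abs)
        also have "\<dots> \<le> (\<Sum>s\<in>S. p s * (C1 / real n ^ 3))"
        proof (rule sum_mono)
          fix s assume s: "s \<in> S"
          have "\<bar>r s\<bar> \<le> C1 / real n ^ 3" using T[of n s] sS[OF s] n by (simp add: r_def)
          then show "\<bar>p s * r s\<bar> \<le> p s * (C1 / real n ^ 3)" unfolding abs_mult using p0[OF s]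
            by (simp only: abs_of_nonneg mult_left_mono)
        qed
        also have "\<dots> = (\<Sum>s\<in>S. p s) * (C1 / real n ^ 3)" by (simp only: sum_distrib_right)
        also have "\<dots> = C1 / real n ^ 3" unfolding p1 by simp
        finally show ?thesis .
      qed
      moreover have "(C1 + 16 * C2) / real n ^ 3 = C1 / real n ^ 3 + 16 * C2 / real n ^ 3" by (rule add_divide_distrib)
      ultimately show ?thesis using dy C2N by linarith
    qed
    have D2: "\<bar>D\<bar> \<le> 2"
      using emp_moment_bounds[OF S(1), of "Suc j"] lim_moment_bounds[of x j] x
      unfolding D_def Y_def y_def by linarith
    have "- 2 * D * (\<Sum>s\<in>S. p s * eta s) \<le> 2 * J / real k * R\<^sup>2 + 4 * ((C1 + 16 * C2) / real n ^ 3)"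
    proof -
      have "- 2 * D * (\<Sum>s\<in>S. p s * eta s) = (2 * J - 1) / real k * (- 2 * D * (D + R)) + - 2 * D * e"
      proof -
        define M where "M = (2 * J - 1) / real k"
        have "(\<Sum>s\<in>S. p s * eta s) = e + M * (D + R)" by (simp add: e_def M_def)
        then show ?thesis unfolding M_def[symmetric] by (simp add: algebra_simps)
      qed
      \<comment> \<open>The contraction \<open>-2 D^2\<close> of the linear drift swallows the cross
        term \<open>-2 D R\<close> and leaves only the square of \<open>R\<close>, which contains
        lower moments alone.\<close>
      moreover have "- 2 * D * (D + R) \<le> R\<^sup>2"
      proof -
        have "R\<^sup>2 - (- 2 * D * (D + R)) = (D + R)\<^sup>2 + D\<^sup>2" by (simp add: power2_eq_square algebra_simps)
        moreover have "(D + R)\<^sup>2 + D\<^sup>2 \<ge> 0" by simp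
        ultimately show ?thesis by linarith
      qed
      then have "(2 * J - 1) / real k * (- 2 * D * (D + R)) \<le> (2 * J - 1) / real k * R\<^sup>2"
        using J kp by (intro mult_left_mono) auto
      moreover have "(2 * J - 1) / real k * R\<^sup>2 \<le> 2 * J / real k * R\<^sup>2"
        using kp by (intro mult_right_mono divide_right_mono) auto
      moreover have "\<bar>- 2 * D * e\<bar> \<le> 4 * ((C1 + 16 * C2) / real n ^ 3)"
        unfolding abs_mult using D2 e by (intro mult_mono) auto
      ultimately show ?thesis by linarith
    qed
    also have "2 * J / real k * R\<^sup>2 \<le> C / real k * (\<Sum>i\<in>{1..j}. (Y i - y i)\<^sup>2)"
    proof -
      define Q where "Q = (\<Sum>i\<in>{1..j}. (Y i - y i)\<^sup>2)"
      have Q: "Q \<ge> 0" unfolding Q_def by (intro sum_nonneg) auto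
      have "2 * J / real k * R\<^sup>2 \<le> 2 * J / real k * (K * Q)" using R(2) J kp unfolding Q_def by (intro mult_left_mono) auto
      also have "\<dots> = (2 * J * K) / real k * Q" by simp
      also have "\<dots> \<le> C / real k * Q" using Ca Q kp by (intro mult_right_mono divide_right_mono) auto
      finally show ?thesis by (simp add: Q_def)
    qed
    finally have "- 2 * D * (\<Sum>s\<in>S. p s * eta s) \<le>
        C / real k * (\<Sum>i\<in>{1..j}. (Y i - y i)\<^sup>2) + 4 * ((C1 + 16 * C2) / real n ^ 3)" by simp
    moreover have "4 * ((C1 + 16 * C2) / real n ^ 3) + C3\<^sup>2 / real n ^ 3 \<le> C / real n ^ 3"
    proof -
      have "(4 * (C1 + 16 * C2) + C3\<^sup>2) / real n ^ 3 \<le> C / real n ^ 3" using Ca(2) by (intro divide_right_mono) auto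
      then show ?thesis by (simp add: add_divide_distrib)
    qed
    ultimately have "(\<Sum>s\<in>S. p s * (emp_moment n (pull S s) (Suc j) - lim_moment (x - 1 / N) (Suc j))\<^sup>2)
        \<le> D\<^sup>2 + C / real k * (\<Sum>i\<in>{1..j}. (Y i - y i)\<^sup>2) + C / real n ^ 3"
      unfolding main using second by linarith
    then show "(\<Sum>s\<in>S. down_weight S s *
         (emp_moment n (pull S s) (Suc j) - lim_moment (real (k - 1) / real (n choose 2)) (Suc j))\<^sup>2)
      \<le> (emp_moment n S (Suc j) - lim_moment (real k / real (n choose 2)) (Suc j))\<^sup>2 +
        C / real k * (\<Sum>i\<in>{1..j}. (emp_moment n S i - lim_moment (real k / real (n choose 2)) i)\<^sup>2) + C / real n ^ 3"
      unfolding N_def[symmetric] xh x_def[symmetric] p_def D_def Y_def y_def .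
  qed
qed

section \<open>The limit profile and its derivatives\<close>

text \<open>Constant continuation of \<open>arccos\<close> beyond \<open>-1\<close> and 1. It keeps
  the profile continuous across the edge of its support, where the arguments leave the
  interval.\<close>

definition clipped_arccos :: "real \<Rightarrow> real" where
  "clipped_arccos x = arccos (max (- 1) (min 1 x))"

lemma continuous_on_clipped_arccos [continuous_intros]:
  assumes "continuous_on A f"
  shows "continuous_on A (\<lambda>x. clipped_arccos (f x))"
  unfolding clipped_arccos_def
  by (rule continuous_on_compose2[OF continuous_on_arccos'])
    (use assms in \<open>auto intro!: continuous_intros\<close>)

lemma clipped_arccos_ge: "x \<ge> 1 \<Longrightarrow> clipped_arccos x = 0"
  by (simp add: clipped_arccos_def)

lemma clipped_arccos_le: "x \<le> - 1 \<Longrightarrow> clipped_arccos x = pi"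
  by (simp add: clipped_arccos_def)

lemma clipped_arccos_eq: "\<bar>x\<bar> \<le> 1 \<Longrightarrow> clipped_arccos x = arccos x"
  by (simp add: clipped_arccos_def abs_le_iff)

lemma clipped_arccos_minus: "clipped_arccos (- x) = pi - clipped_arccos x"
proof -
  have "max (- 1) (min 1 (- x)) = - max (- 1) (min 1 x)" by (auto simp: max_def min_def)
  then show ?thesis by (simp add: clipped_arccos_def arccos_minus)
qed

lemma clipped_arccos_strict: "\<bar>x\<bar> < 1 \<Longrightarrow> 0 < clipped_arccos x \<and> clipped_arccos x < pi"
proof -
  assume "\<bar>x\<bar> < 1"
  then show ?thesis using arccos_lt_bounded[of x] clipped_arccos_eq[of x] by auto
qed

lemma DERIV_clipped_arccos:
  assumes "\<bar>x\<bar> < 1"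
  shows "(clipped_arccos has_real_derivative - 1 / sqrt (1 - x\<^sup>2)) (at x)"
proof -
  have "(arccos has_real_derivative - 1 / sqrt (1 - x\<^sup>2)) (at x)"
    using DERIV_arccos[of x] assms by (simp add: abs_less_iff divide_inverse)
  then show ?thesis
    by (rule has_field_derivative_transform_within_open[of _ _ _ "{- 1<..<1}"])
      (use assms in \<open>auto simp: clipped_arccos_eq abs_less_iff abs_le_iff\<close>)
qed

text \<open>With \<open>s = y - x = - sqrt 2 * u\<close>, the range of \<open>u\<close> allowed for
  the curve of index \<open>\<alpha>\<close> is \<open>s \<le> radius \<alpha>\<close>. It is also
  the scaled size of the largest non-frozen part.\<close>

definition radius :: "real \<Rightarrow> real" where
  "radius \<alpha> = 2 * sqrt (\<alpha> * (1 - \<alpha>))"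

lemma radius_sq:
  assumes "0 \<le> \<alpha>" "\<alpha> \<le> 1"
  shows "(radius \<alpha>)\<^sup>2 = 1 - (1 - 2 * \<alpha>)\<^sup>2"
proof -
  have "0 \<le> \<alpha> * (1 - \<alpha>)" using assms by (intro mult_nonneg_nonneg) auto
  then have "(sqrt (\<alpha> * (1 - \<alpha>)))\<^sup>2 = \<alpha> * (1 - \<alpha>)" by (rule real_sqrt_pow2)
  then have "(radius \<alpha>)\<^sup>2 = 4 * (\<alpha> * (1 - \<alpha>))" unfolding radius_def power_mult_distrib by simp
  also have "\<dots> = 1 - (1 - 2 * \<alpha>)\<^sup>2" by (simp add: power2_eq_square algebra_simps)
  finally show ?thesis .
qed

lemma radius_nonneg: "0 \<le> \<alpha> \<Longrightarrow> \<alpha> \<le> 1 \<Longrightarrow> 0 \<le> radius \<alpha>"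
  by (simp add: radius_def)

lemma radius_pos: "0 < \<alpha> \<Longrightarrow> \<alpha> < 1 \<Longrightarrow> 0 < radius \<alpha>"
  by (simp add: radius_def)

lemma radius_le_1:
  assumes "0 \<le> \<alpha>" "\<alpha> \<le> 1"
  shows "radius \<alpha> \<le> 1"
proof (rule power2_le_imp_le)
  have "0 \<le> (1 - 2 * \<alpha>)\<^sup>2" by simp
  then show "(radius \<alpha>)\<^sup>2 \<le> 1\<^sup>2" using radius_sq[OF assms] unfolding power_one by linarith
qed simp

lemma radius_flip: "radius (1 - \<alpha>) = radius \<alpha>"
  by (simp add: radius_def mult.commute)

text \<open>The limiting number (over \<open>n\<close>) of parts of size at least \<open>s n\<close> at time \<open>\<alpha>\<close>. With \<open>c = 1 - 2 \<alpha>\<close>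
  and \<open>a = radius \<alpha>\<close> its density \<open>arccos (c s / (a sqrt (1 - s\<^sup>2))) / pi\<close> lives on \<open>s < a\<close>; clipping
  makes the formula valid on all of \<open>[0, 1]\<close>, except at \<open>\<alpha> = 0\<close> and \<open>\<alpha> = 1\<close> where \<open>a = 0\<close>.\<close>

definition lim_tail :: "real \<Rightarrow> real \<Rightarrow> real" where
  "lim_tail \<alpha> s = (if \<alpha> \<le> 0 then 0 else if \<alpha> \<ge> 1 then 1 - s else
     (clipped_arccos ((1 - 2 * \<alpha>) / sqrt (1 - s\<^sup>2)) -
      s * clipped_arccos ((1 - 2 * \<alpha>) * s / (radius \<alpha> * sqrt (1 - s\<^sup>2)))) / pi)"

text \<open>Both arguments of \<open>arccos\<close> are odd in \<open>1 - 2 \<alpha>\<close> because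
  the radius is symmetric. The symmetry exchanges \<open>lim_tail\<close> with the tail of the
  complementary set of parts and reduces every claim to \<open>\<alpha> \<le> 1 / 2\<close>.\<close>

lemma lim_tail_flip: "lim_tail (1 - \<alpha>) s = 1 - s - lim_tail \<alpha> s"
proof -
  have c: "1 - 2 * (1 - \<alpha>) = - (1 - 2 * \<alpha>)" by simp
  have m: "- (1 - 2 * \<alpha>) / y = - ((1 - 2 * \<alpha>) / y)"
    "- (1 - 2 * \<alpha>) * s / y = - ((1 - 2 * \<alpha>) * s / y)" for y :: real 
    by (simp_all only: mult_minus_left minus_divide_left)
  have e: "(pi - x - s * (pi - y)) / pi = 1 - s - (x - s * y) / pi" for x y :: real
    by (simp add: diff_divide_distrib right_diff_distrib)
  consider "\<alpha> \<le> 0" | "\<alpha> \<ge> 1" | "0 < \<alpha>" "\<alpha> < 1" by linarith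
  then show ?thesis
  proof cases
    case 3
    then show ?thesis unfolding lim_tail_def radius_flip c m clipped_arccos_minus e by simp
  qed (auto simp: lim_tail_def)
qed

text \<open>Past the radius, \<open>sqrt (1 - s^2) \<le> 1 - 2 \<alpha>\<close>, so both arguments
  are at least 1 and both clipped values are 0.\<close>

lemma lim_tail_beyond:
  assumes "0 \<le> \<alpha>" "\<alpha> \<le> 1 / 2" "radius \<alpha> \<le> s" "s \<le> 1"
  shows "lim_tail \<alpha> s = 0"
proof (cases "\<alpha> = 0 \<or> s = 1")
  case True
  then show ?thesis by (auto simp: lim_tail_def)
next
  case False
  then have a: "0 < \<alpha>" "\<alpha> < 1" "s < 1" using assms by auto
  define r where "r = sqrt (1 - s\<^sup>2)"
  have ra: "radius \<alpha> > 0" by (rule radius_pos[OF a(1,2)])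
  have s0: "s > 0" using ra assms by linarith
  have "s\<^sup>2 < 1" using a s0 by (simp add: power_less_one_iff)
  then have r: "r > 0" "r\<^sup>2 = 1 - s\<^sup>2" by (auto simp: r_def)
  have "(radius \<alpha>)\<^sup>2 \<le> s\<^sup>2" using ra assms by (intro power_mono) auto
  moreover have "(radius \<alpha>)\<^sup>2 = 1 - (1 - 2 * \<alpha>)\<^sup>2" using a by (intro radius_sq) auto
  ultimately have "r\<^sup>2 \<le> (1 - 2 * \<alpha>)\<^sup>2" using r(2) by linarith
  then have rc: "r \<le> 1 - 2 * \<alpha>" by (rule power2_le_imp_le) (use assms in simp)
  then have 1: "1 \<le> (1 - 2 * \<alpha>) / r" using r(1) by (simp only: le_divide_eq_1_pos)
  have "radius \<alpha> * r \<le> s * (1 - 2 * \<alpha>)" using assms(3) rc r(1) s0 by (intro mult_mono) auto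
  then have 2: "1 \<le> (1 - 2 * \<alpha>) * s / (radius \<alpha> * r)"
    using mult_pos_pos[OF ra r(1)] by (simp only: le_divide_eq_1_pos mult.commute)
  have "\<not> \<alpha> \<le> 0" "\<not> 1 \<le> \<alpha>" using a by auto
  then show ?thesis
    unfolding lim_tail_def r_def[symmetric] clipped_arccos_ge[OF 1] clipped_arccos_ge[OF 2] by simp
qed

lemma lim_tail_beyond':
  assumes "1 / 2 \<le> \<alpha>" "\<alpha> \<le> 1" "radius \<alpha> \<le> s" "s \<le> 1"
  shows "lim_tail \<alpha> s = 1 - s"
  using lim_tail_beyond[of "1 - \<alpha>" s] lim_tail_flip[of \<alpha> s] assms by (simp add: radius_flip)

lemma lim_tail_at_1: "0 \<le> \<alpha> \<Longrightarrow> \<alpha> \<le> 1 \<Longrightarrow> lim_tail \<alpha> 1 = 0"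
  using lim_tail_beyond[of \<alpha> 1] lim_tail_beyond'[of \<alpha> 1] radius_le_1[of \<alpha>] by (cases "\<alpha> \<le> 1/2") auto

text \<open>The open region in which both \<open>arccos\<close> arguments lie strictly between
  \<open>-1\<close> and 1. The abbreviations satisfy \<open>a^2 + c^2 = 1\<close> and
  \<open>q^2 + c^2 = r^2\<close>, and these two relations turn all square roots of the derivatives
  into quotients of \<open>q\<close>, \<open>r\<close> and \<open>a\<close>.\<close>

locale inside =
  fixes \<alpha> s :: real
  assumes \<alpha>: "0 < \<alpha>" "\<alpha> < 1" and s: "0 \<le> s" "s < radius \<alpha>"
begin

definition "c = 1 - 2 * \<alpha>"
definition "a = radius \<alpha>"
definition "r = sqrt (1 - s\<^sup>2)"
definition "q = sqrt (a\<^sup>2 - s\<^sup>2)"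

lemma facts: "a > 0" "a\<^sup>2 = 1 - c\<^sup>2" "s < 1" "r > 0" "r\<^sup>2 = 1 - s\<^sup>2" "q > 0" "q\<^sup>2 = a\<^sup>2 - s\<^sup>2"
proof -
  show a: "a > 0" using radius_pos \<alpha> by (simp add: a_def)
  show "a\<^sup>2 = 1 - c\<^sup>2" using radius_sq \<alpha> by (simp add: a_def c_def)
  show s1: "s < 1" using radius_le_1[of \<alpha>] \<alpha> s by simp
  then have "s\<^sup>2 < 1" using s by (simp add: power_less_one_iff)
  then show "r > 0" "r\<^sup>2 = 1 - s\<^sup>2" by (auto simp: r_def)
  have "s\<^sup>2 < a\<^sup>2" using s by (intro power_strict_mono) (auto simp: a_def)
  then show "q > 0" "q\<^sup>2 = a\<^sup>2 - s\<^sup>2" by (auto simp: q_def)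
qed

lemma one_minus_U: "1 - (c / r)\<^sup>2 = (q / r)\<^sup>2"
proof -
  have "(c / r)\<^sup>2 + (q / r)\<^sup>2 = (c\<^sup>2 + q\<^sup>2) / r\<^sup>2" by (simp add: power_divide add_divide_distrib)
  also have "c\<^sup>2 + q\<^sup>2 = r\<^sup>2" using facts by simp
  also have "r\<^sup>2 / r\<^sup>2 = 1" using facts(4) by simp
  finally show ?thesis by linarith
qed

lemma one_minus_V: "1 - (c * s / (a * r))\<^sup>2 = (q / (a * r))\<^sup>2"
proof -
  have "(c * s / (a * r))\<^sup>2 + (q / (a * r))\<^sup>2 = (c\<^sup>2 * s\<^sup>2 + q\<^sup>2) / (a\<^sup>2 * r\<^sup>2)"
    by (simp add: power_divide power_mult_distrib add_divide_distrib)
  also have "c\<^sup>2 * s\<^sup>2 + q\<^sup>2 = a\<^sup>2 * r\<^sup>2" proof -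
    have c2: "c\<^sup>2 = 1 - a\<^sup>2" using facts(2) by simp
    show ?thesis unfolding facts(5,7) c2 by (simp add: algebra_simps)
  qed
  also have "(a\<^sup>2 * r\<^sup>2) / (a\<^sup>2 * r\<^sup>2) = 1" using facts(1,4) by simp
  finally show ?thesis by linarith
qed

lemma U_V_bounds: "\<bar>c / r\<bar> < 1" "\<bar>c * s / (a * r)\<bar> < 1"
proof -
  have "(q / r)\<^sup>2 > 0" "(q / (a * r))\<^sup>2 > 0" using facts by auto
  then have "(c / r)\<^sup>2 < 1" "(c * s / (a * r))\<^sup>2 < 1" using one_minus_U one_minus_V by linarith+
  then show "\<bar>c / r\<bar> < 1" "\<bar>c * s / (a * r)\<bar> < 1" by (simp_all only: abs_square_less_1)
qed

lemma sqrt_U: "sqrt (1 - (c / r)\<^sup>2) = q / r"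
  unfolding one_minus_U using facts by simp

lemma sqrt_V: "sqrt (1 - (c * s / (a * r))\<^sup>2) = q / (a * r)"
  unfolding one_minus_V using facts by simp

lemma DERIV_r: "((\<lambda>s. sqrt (1 - s\<^sup>2)) has_real_derivative - s / r) (at s)"
proof -
  have "1 - s\<^sup>2 > 0" using facts by (metis zero_less_power)
  then show ?thesis by (auto intro!: derivative_eq_intros simp: r_def divide_simps)
qed

lemma DERIV_density:
  "((\<lambda>s. clipped_arccos (c * s / (a * sqrt (1 - s\<^sup>2)))) has_real_derivative - c / (r\<^sup>2 * q)) (at s)"
proof -
  have "((\<lambda>s. c * s / (a * sqrt (1 - s\<^sup>2))) has_real_derivative
     (c * (a * sqrt (1 - s\<^sup>2)) - c * s * (a * (- s / r))) / ((a * sqrt (1 - s\<^sup>2)) * (a * sqrt (1 - s\<^sup>2)))) (at s)"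
    using facts by (intro DERIV_divide DERIV_cmult DERIV_cmult_Id DERIV_r) (auto simp: r_def)
  also have "(c * (a * sqrt (1 - s\<^sup>2)) - c * s * (a * (- s / r))) / ((a * sqrt (1 - s\<^sup>2)) * (a * sqrt (1 - s\<^sup>2))) =
      c * (r\<^sup>2 + s\<^sup>2) / (a * r ^ 3)"
    unfolding r_def[symmetric] using facts(1,4) by (simp add: divide_simps power2_eq_square power3_eq_cube) (simp add: algebra_simps)
  also have "r\<^sup>2 + s\<^sup>2 = 1" using facts by simp
  finally have V: "((\<lambda>s. c * s / (a * sqrt (1 - s\<^sup>2))) has_real_derivative c * 1 / (a * r ^ 3)) (at s)" .
  have "((\<lambda>s. clipped_arccos (c * s / (a * sqrt (1 - s\<^sup>2)))) has_real_derivative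
      - 1 / sqrt (1 - (c * s / (a * r))\<^sup>2) * (c * 1 / (a * r ^ 3))) (at s)"
    by (rule DERIV_chain2[OF _ V]) (use DERIV_clipped_arccos[OF U_V_bounds(2)] in \<open>simp add: r_def\<close>)
  also have "- 1 / sqrt (1 - (c * s / (a * r))\<^sup>2) * (c * 1 / (a * r ^ 3)) = - c / (r\<^sup>2 * q)"
    unfolding sqrt_V using facts(1,4,6) by (simp add: divide_simps power2_eq_square power3_eq_cube)
  finally show ?thesis .
qed

text \<open>The two terms with \<open>1 / (r^2 q)\<close>, one from each \<open>arccos\<close>,
  cancel, and the derivative is minus the local density of parts.\<close>

lemma DERIV_lim_tail:
  "(lim_tail \<alpha> has_real_derivative - clipped_arccos (c * s / (a * r)) / pi) (at s)"
proof -
  have "((\<lambda>s. c / sqrt (1 - s\<^sup>2)) has_real_derivative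
     (0 * sqrt (1 - s\<^sup>2) - c * (- s / r)) / (sqrt (1 - s\<^sup>2) * sqrt (1 - s\<^sup>2))) (at s)"
    using facts by (intro DERIV_divide DERIV_const DERIV_r) (auto simp: r_def)
  also have "(0 * sqrt (1 - s\<^sup>2) - c * (- s / r)) / (sqrt (1 - s\<^sup>2) * sqrt (1 - s\<^sup>2)) = c * s / r ^ 3"
    unfolding r_def[symmetric] using facts(4) by (simp add: divide_simps power2_eq_square power3_eq_cube)
  finally have U: "((\<lambda>s. c / sqrt (1 - s\<^sup>2)) has_real_derivative c * s / r ^ 3) (at s)" .
  have "((\<lambda>s. clipped_arccos (c / sqrt (1 - s\<^sup>2))) has_real_derivative
      - 1 / sqrt (1 - (c / r)\<^sup>2) * (c * s / r ^ 3)) (at s)"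
    by (rule DERIV_chain2[OF _ U]) (use DERIV_clipped_arccos[OF U_V_bounds(1)] in \<open>simp add: r_def\<close>)
  also have "- 1 / sqrt (1 - (c / r)\<^sup>2) * (c * s / r ^ 3) = - c * s / (r\<^sup>2 * q)"
    unfolding sqrt_U using facts(4,6) by (simp add: divide_simps power2_eq_square power3_eq_cube)
  finally have U': "((\<lambda>s. clipped_arccos (c / sqrt (1 - s\<^sup>2))) has_real_derivative - c * s / (r\<^sup>2 * q)) (at s)" .
  have "((\<lambda>s. (clipped_arccos (c / sqrt (1 - s\<^sup>2)) - s * clipped_arccos (c * s / (a * sqrt (1 - s\<^sup>2)))) / pi)
     has_real_derivative (- c * s / (r\<^sup>2 * q) - (1 * clipped_arccos (c * s / (a * sqrt (1 - s\<^sup>2))) + - c / (r\<^sup>2 * q) * s)) / pi) (at s)"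
    by (intro DERIV_cdivide DERIV_diff U' DERIV_mult DERIV_ident DERIV_density)
  moreover have "(\<lambda>s. (clipped_arccos (c / sqrt (1 - s\<^sup>2)) - s * clipped_arccos (c * s / (a * sqrt (1 - s\<^sup>2)))) / pi) = lim_tail \<alpha>"
    using \<alpha> by (simp add: fun_eq_iff lim_tail_def c_def a_def)
  ultimately show ?thesis by (simp add: r_def)
qed

text \<open>The growth rate at scaled size \<open>s\<close> is the semicircle density of radius
  \<open>a\<close>. Only its positivity matters later, for strict monotonicity in time.\<close>

lemma DERIV_lim_tail_time:
  "((\<lambda>\<alpha>. lim_tail \<alpha> s) has_real_derivative 2 * q / (pi * a\<^sup>2)) (at \<alpha>)"
proof -
  have pos: "\<alpha> * (1 - \<alpha>) > 0" using \<alpha> by simp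
  have dc: "((\<lambda>\<alpha>. 1 - 2 * \<alpha>) has_real_derivative - 2) (at \<alpha>)" by (auto intro!: derivative_eq_intros)
  have "((\<lambda>\<alpha>. \<alpha> * (1 - \<alpha>)) has_real_derivative c) (at \<alpha>)"
    by (auto intro!: derivative_eq_intros simp: c_def)
  then have "((\<lambda>\<alpha>. sqrt (\<alpha> * (1 - \<alpha>))) has_real_derivative inverse (sqrt (\<alpha> * (1 - \<alpha>))) / 2 * c) (at \<alpha>)"
    by (rule DERIV_chain2[where f = sqrt and g = "\<lambda>\<alpha>. \<alpha> * (1 - \<alpha>)", OF DERIV_real_sqrt[OF pos]])
  then have 1: "((\<lambda>\<alpha>. 2 * sqrt (\<alpha> * (1 - \<alpha>))) has_real_derivative 2 * (inverse (sqrt (\<alpha> * (1 - \<alpha>))) / 2 * c)) (at \<alpha>)"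
    by (rule DERIV_cmult)
  have 2: "(\<lambda>\<alpha>. 2 * sqrt (\<alpha> * (1 - \<alpha>))) = radius" by (simp add: fun_eq_iff radius_def)
  have 3: "2 * (inverse z / 2 * y) = 2 * y / (2 * z)" for y z :: real
    by (cases "z = 0") (simp_all add: field_simps)
  have 4: "2 * sqrt (\<alpha> * (1 - \<alpha>)) = a" by (simp add: a_def radius_def)
  have da: "(radius has_real_derivative 2 * c / a) (at \<alpha>)"
    using 1[unfolded 2 3 4] .
  have U: "((\<lambda>\<alpha>. (1 - 2 * \<alpha>) / r) has_real_derivative - 2 / r) (at \<alpha>)"
    by (intro DERIV_cdivide dc)
  have U': "((\<lambda>\<alpha>. clipped_arccos ((1 - 2 * \<alpha>) / r)) has_real_derivative - 1 / sqrt (1 - (c / r)\<^sup>2) * (- 2 / r)) (at \<alpha>)"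
    by (rule DERIV_chain2[OF _ U]) (use DERIV_clipped_arccos[OF U_V_bounds(1)] in \<open>simp add: c_def\<close>)
  have "((\<lambda>\<alpha>. (1 - 2 * \<alpha>) * s / (radius \<alpha> * r)) has_real_derivative
      ((- 2) * s * (radius \<alpha> * r) - (1 - 2 * \<alpha>) * s * (2 * c / a * r)) / ((radius \<alpha> * r) * (radius \<alpha> * r))) (at \<alpha>)"
    using facts by (intro DERIV_divide DERIV_cmult_right dc da) (auto simp: a_def)
  also have "((- 2) * s * (radius \<alpha> * r) - (1 - 2 * \<alpha>) * s * (2 * c / a * r)) / ((radius \<alpha> * r) * (radius \<alpha> * r)) =
      - 2 * s * (a\<^sup>2 + c\<^sup>2) / (a ^ 3 * r)"
    unfolding a_def[symmetric] c_def[symmetric] using facts(1,4)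
    by (simp add: divide_simps power2_eq_square power3_eq_cube) (simp add: algebra_simps)
  also have "a\<^sup>2 + c\<^sup>2 = 1" using facts by simp
  finally have V: "((\<lambda>\<alpha>. (1 - 2 * \<alpha>) * s / (radius \<alpha> * r)) has_real_derivative - 2 * s * 1 / (a ^ 3 * r)) (at \<alpha>)" .
  have V': "((\<lambda>\<alpha>. clipped_arccos ((1 - 2 * \<alpha>) * s / (radius \<alpha> * r))) has_real_derivative
     - 1 / sqrt (1 - (c * s / (a * r))\<^sup>2) * (- 2 * s * 1 / (a ^ 3 * r))) (at \<alpha>)"
    by (rule DERIV_chain2[OF _ V]) (use DERIV_clipped_arccos[OF U_V_bounds(2)] in \<open>simp add: c_def a_def\<close>)
  have "((\<lambda>\<alpha>. (clipped_arccos ((1 - 2 * \<alpha>) / r) - s * clipped_arccos ((1 - 2 * \<alpha>) * s / (radius \<alpha> * r))) / pi)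
    has_real_derivative (- 1 / sqrt (1 - (c / r)\<^sup>2) * (- 2 / r) -
      s * (- 1 / sqrt (1 - (c * s / (a * r))\<^sup>2) * (- 2 * s * 1 / (a ^ 3 * r)))) / pi) (at \<alpha>)"
    by (intro DERIV_cdivide DERIV_diff U' DERIV_cmult V')
  also have "(- 1 / sqrt (1 - (c / r)\<^sup>2) * (- 2 / r) -
      s * (- 1 / sqrt (1 - (c * s / (a * r))\<^sup>2) * (- 2 * s * 1 / (a ^ 3 * r)))) / pi = 2 * (a\<^sup>2 - s\<^sup>2) / (q * (pi * a\<^sup>2))"
    unfolding sqrt_U sqrt_V using facts(1,4,6)
    by (simp add: divide_simps power2_eq_square power3_eq_cube)
  also have "\<dots> = 2 * q / (pi * a\<^sup>2)" using facts(6)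
    unfolding facts(7)[symmetric] by (simp add: power2_eq_square)
  finally show ?thesis
    by (rule has_field_derivative_transform_within_open[of _ _ _ "{0<..<1}"])
      (use \<alpha> in \<open>auto simp: lim_tail_def r_def\<close>)
qed

end

section \<open>Monotonicity, frozen times and joint continuity of the profile\<close>

lemma lim_tail_half: "0 \<le> s \<Longrightarrow> s \<le> 1 \<Longrightarrow> lim_tail (1/2) s = (1 - s) / 2"
  using lim_tail_flip[of "1/2" s] by simp

lemma continuous_lim_tail_low:
  assumes "0 < \<alpha>" "\<alpha> < 1/2"
  shows "continuous_on {0..radius \<alpha>} (lim_tail \<alpha>)"
proof -
  have "(radius \<alpha>)\<^sup>2 < 1" using radius_sq[of \<alpha>] assms by simp
  then have r1: "radius \<alpha> < 1" using radius_nonneg[of \<alpha>] assms by (simp add: power_less_one_iff)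
  have r0: "radius \<alpha> > 0" using radius_pos assms by simp
  have "1 - s\<^sup>2 > 0" if "s \<in> {0..radius \<alpha>}" for s
    using that r1 by (simp add: power_less_one_iff)
  then have "continuous_on {0..radius \<alpha>} (\<lambda>s. (clipped_arccos ((1 - 2 * \<alpha>) / sqrt (1 - s\<^sup>2)) -
      s * clipped_arccos ((1 - 2 * \<alpha>) * s / (radius \<alpha> * sqrt (1 - s\<^sup>2)))) / pi)"
    using r0 by (intro continuous_intros) (auto simp: less_le)
  then show ?thesis by (rule continuous_on_eq) (use assms in \<open>simp add: lim_tail_def\<close>)
qed

text \<open>Within the radius the density lies strictly between 0 and 1, so the tail strictly
  decreases while position plus tail strictly increases.\<close>

lemma lim_tail_strict_low:
  assumes "0 < \<alpha>" "\<alpha> < 1/2" "0 \<le> s" "s < s'" "s' \<le> radius \<alpha>"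
  shows "lim_tail \<alpha> s' < lim_tail \<alpha> s" "s + lim_tail \<alpha> s < s' + lim_tail \<alpha> s'"
proof -
  have cont: "continuous_on {s..s'} (lim_tail \<alpha>)"
    by (rule continuous_on_subset[OF continuous_lim_tail_low]) (use assms in auto)
  have D: "\<exists>\<rho>. 0 < \<rho> \<and> \<rho> < 1 \<and> (lim_tail \<alpha> has_real_derivative - \<rho>) (at x)" if "s < x" "x < s'" for x
  proof -
    interpret inside \<alpha> x using that assms by unfold_locales auto
    show ?thesis
      using DERIV_lim_tail clipped_arccos_strict[OF U_V_bounds(2)]
      by (intro exI[of _ "clipped_arccos (c * x / (a * r)) / pi"]) auto
  qed
  show "lim_tail \<alpha> s' < lim_tail \<alpha> s"
  proof (rule DERIV_neg_imp_decreasing_open[OF assms(4) _ cont])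
    fix x assume "s < x" "x < s'"
    then obtain \<rho> where "0 < \<rho>" "(lim_tail \<alpha> has_real_derivative - \<rho>) (at x)" using D by blast
    then show "\<exists>y. (lim_tail \<alpha> has_real_derivative y) (at x) \<and> y < 0" by (intro exI[of _ "- \<rho>"]) auto
  qed
  show "s + lim_tail \<alpha> s < s' + lim_tail \<alpha> s'"
  proof (rule DERIV_pos_imp_increasing_open[OF assms(4)])
    show "continuous_on {s..s'} (\<lambda>x. x + lim_tail \<alpha> x)" by (intro continuous_intros cont)
    fix x assume "s < x" "x < s'"
    then obtain \<rho> where "\<rho> < 1" "(lim_tail \<alpha> has_real_derivative - \<rho>) (at x)" using D by blast
    then show "\<exists>y. ((\<lambda>x. x + lim_tail \<alpha> x) has_real_derivative y) (at x) \<and> 0 < y"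
      by (intro exI[of _ "1 + - \<rho>"] conjI DERIV_add DERIV_ident) auto
  qed
qed

lemma lim_tail_low:
  assumes "0 \<le> \<alpha>" "\<alpha> < 1/2" "0 \<le> s" "s < s'" "s' \<le> 1"
  shows "lim_tail \<alpha> s' \<le> lim_tail \<alpha> s" "s + lim_tail \<alpha> s < s' + lim_tail \<alpha> s'"
    "lim_tail \<alpha> s > 0 \<Longrightarrow> lim_tail \<alpha> s' < lim_tail \<alpha> s"
proof -
  have "lim_tail \<alpha> s' \<le> lim_tail \<alpha> s \<and> s + lim_tail \<alpha> s < s' + lim_tail \<alpha> s' \<and>
    (lim_tail \<alpha> s > 0 \<longrightarrow> lim_tail \<alpha> s' < lim_tail \<alpha> s)"
  proof (cases "\<alpha> = 0")
    case True
    then show ?thesis using assms by (simp add: lim_tail_def)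
  next
    case False
    then have a: "0 < \<alpha>" using assms by simp
    have z: "lim_tail \<alpha> x = 0" if "radius \<alpha> \<le> x" "x \<le> 1" for x
      using lim_tail_beyond[of \<alpha> x] that assms by simp
    consider "s' \<le> radius \<alpha>" | "s < radius \<alpha>" "radius \<alpha> < s'" | "radius \<alpha> \<le> s" by linarith
    then show ?thesis
    proof cases
      case 1
      then show ?thesis using lim_tail_strict_low[OF a assms(2-4)] by auto
    next
      case 2
      then have "radius \<alpha> \<le> 1" using assms by simp
      then show ?thesis using lim_tail_strict_low[OF a assms(2,3) 2(1)] z[of "radius \<alpha>"] z[of s'] 2 assms by auto
    next
      case 3
      then show ?thesis using z[of s] z[of s'] assms by auto
    qed
  qed
  then show "lim_tail \<alpha> s' \<le> lim_tail \<alpha> s" "s + lim_tail \<alpha> s < s' + lim_tail \<alpha> s'"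
    "lim_tail \<alpha> s > 0 \<Longrightarrow> lim_tail \<alpha> s' < lim_tail \<alpha> s" by auto
qed

text \<open>Strictness of each function can fail only where the tail has reached 0 or where position
  plus tail has reached 1. For \<open>\<alpha> > 1/2\<close> the flip exchanges the two functions up
  to sign and an additive constant.\<close>

lemma lim_tail_mono:
  assumes "0 \<le> \<alpha>" "\<alpha> \<le> 1" "0 \<le> s" "s < s'" "s' \<le> 1"
  shows "lim_tail \<alpha> s' \<le> lim_tail \<alpha> s" "s + lim_tail \<alpha> s \<le> s' + lim_tail \<alpha> s'"
    "lim_tail \<alpha> s > 0 \<Longrightarrow> lim_tail \<alpha> s' < lim_tail \<alpha> s"
    "s + lim_tail \<alpha> s < 1 \<Longrightarrow> s + lim_tail \<alpha> s < s' + lim_tail \<alpha> s'"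
proof -
  consider "\<alpha> < 1/2" | "\<alpha> = 1/2" | "\<alpha> > 1/2" by linarith
  then have "lim_tail \<alpha> s' \<le> lim_tail \<alpha> s \<and> s + lim_tail \<alpha> s \<le> s' + lim_tail \<alpha> s' \<and>
    (lim_tail \<alpha> s > 0 \<longrightarrow> lim_tail \<alpha> s' < lim_tail \<alpha> s) \<and>
    (s + lim_tail \<alpha> s < 1 \<longrightarrow> s + lim_tail \<alpha> s < s' + lim_tail \<alpha> s')"
  proof cases
    case 1
    then show ?thesis using lim_tail_low[OF assms(1) 1 assms(3-5)] by auto
  next
    case 2
    show ?thesis unfolding 2 using lim_tail_half[of s] lim_tail_half[of s'] assms by auto
  next
    case 3
    have "lim_tail (1 - \<alpha>) s' \<le> lim_tail (1 - \<alpha>) s" "s + lim_tail (1 - \<alpha>) s < s' + lim_tail (1 - \<alpha>) s'"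
      "lim_tail (1 - \<alpha>) s > 0 \<Longrightarrow> lim_tail (1 - \<alpha>) s' < lim_tail (1 - \<alpha>) s"
      using lim_tail_low[of "1 - \<alpha>" s s'] 3 assms by auto
    then show ?thesis unfolding lim_tail_flip by auto
  qed
  then show "lim_tail \<alpha> s' \<le> lim_tail \<alpha> s" "s + lim_tail \<alpha> s \<le> s' + lim_tail \<alpha> s'"
    "lim_tail \<alpha> s > 0 \<Longrightarrow> lim_tail \<alpha> s' < lim_tail \<alpha> s"
    "s + lim_tail \<alpha> s < 1 \<Longrightarrow> s + lim_tail \<alpha> s < s' + lim_tail \<alpha> s'" by auto
qed

text \<open>The two opposite monotonicities, of the tail and of position plus tail, confine every
  increment between \<open>-\<bar>s - s'\<bar>\<close> and
  \<open>\<bar>s - s'\<bar>\<close>.\<close>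

lemma lim_tail_lipschitz:
  assumes "0 \<le> \<alpha>" "\<alpha> \<le> 1" "s \<in> {0..1}" "s' \<in> {0..1}"
  shows "\<bar>lim_tail \<alpha> s - lim_tail \<alpha> s'\<bar> \<le> \<bar>s - s'\<bar>"
  using lim_tail_mono(1,2)[OF assms(1,2), of s s'] lim_tail_mono(1,2)[OF assms(1,2), of s' s] assms(3,4)
  by (cases s s' rule: linorder_cases) auto

lemma lim_tail_bounds:
  assumes "0 \<le> \<alpha>" "\<alpha> \<le> 1" "s \<in> {0..1}"
  shows "0 \<le> lim_tail \<alpha> s" "s + lim_tail \<alpha> s \<le> 1"
  using lim_tail_mono(1,2)[OF assms(1,2), of s 1] lim_tail_at_1[OF assms(1,2)] assms(3)
  by (cases "s = 1"; auto)+

lemma continuous_lim_tail: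
  assumes "0 \<le> \<alpha>" "\<alpha> \<le> 1"
  shows "continuous_on {0..1} (lim_tail \<alpha>)"
proof (rule lipschitz_on_continuous_on[of 1])
  show "1-lipschitz_on {0..1} (lim_tail \<alpha>)"
    using lim_tail_lipschitz[OF assms] by (auto intro!: lipschitz_onI simp: dist_real_def)
qed

text \<open>The time at which the growing radius first equals \<open>s\<close>: before it the tail
  at \<open>s\<close> is 0, and after \<open>1 - entry_time s\<close> it is frozen at
  \<open>1 - s\<close>. The thresholds of \<open>frak_t\<close> are of this form.\<close>

definition entry_time :: "real \<Rightarrow> real" where
  "entry_time s = (1 - sqrt (1 - s\<^sup>2)) / 2"

lemma entry_time_bounds:
  assumes "0 \<le> s" "s \<le> 1"
  shows "0 \<le> entry_time s" "entry_time s \<le> 1/2" "0 < s \<Longrightarrow> 0 < entry_time s"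
proof -
  have s2: "0 \<le> s\<^sup>2" "s\<^sup>2 \<le> 1" using assms by (auto simp: power_le_one)
  then show "0 \<le> entry_time s" "entry_time s \<le> 1/2" by (auto simp: entry_time_def)
  assume "0 < s"
  then have "s\<^sup>2 > 0" by simp
  then show "0 < entry_time s" by (simp add: entry_time_def)
qed

lemma radius_less_iff:
  assumes "0 \<le> \<alpha>" "\<alpha> \<le> 1" "0 \<le> s" "s \<le> 1"
  shows "s < radius \<alpha> \<longleftrightarrow> entry_time s < \<alpha> \<and> \<alpha> < 1 - entry_time s"
proof -
  have s2: "0 \<le> 1 - s\<^sup>2" using assms by (simp add: power_le_one)
  have "s < radius \<alpha> \<longleftrightarrow> s\<^sup>2 < (radius \<alpha>)\<^sup>2"
    using assms radius_nonneg[of \<alpha>] by (metis abs_le_square_iff abs_of_nonneg not_le)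
  also have "\<dots> \<longleftrightarrow> \<bar>1 - 2 * \<alpha>\<bar>\<^sup>2 < (sqrt (1 - s\<^sup>2))\<^sup>2" using radius_sq[of \<alpha>] assms s2 by auto
  also have "\<dots> \<longleftrightarrow> \<bar>1 - 2 * \<alpha>\<bar> < sqrt (1 - s\<^sup>2)"
    using s2 by (metis abs_ge_zero power2_less_imp_less power_strict_mono real_sqrt_ge_zero zero_less_numeral)
  also have "\<dots> \<longleftrightarrow> entry_time s < \<alpha> \<and> \<alpha> < 1 - entry_time s"
    by (auto simp: entry_time_def abs_less_iff field_simps)
  finally show ?thesis .
qed

lemma lim_tail_early:
  assumes "0 \<le> \<alpha>" "\<alpha> \<le> entry_time s" "0 \<le> s" "s \<le> 1"
  shows "lim_tail \<alpha> s = 0"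
  using lim_tail_beyond[of \<alpha> s] radius_less_iff[of \<alpha> s] entry_time_bounds[of s] assms by auto

lemma lim_tail_late:
  assumes "1 - entry_time s \<le> \<alpha>" "\<alpha> \<le> 1" "0 \<le> s" "s \<le> 1"
  shows "lim_tail \<alpha> s = 1 - s"
  using lim_tail_beyond'[of \<alpha> s] radius_less_iff[of \<alpha> s] entry_time_bounds[of s] assms by auto

text \<open>At \<open>s = 0\<close> the interval reaches times 0 and 1, where the radius vanishes;
  there the second \<open>arccos\<close> carries the factor \<open>s = 0\<close> and only the first
  remains. For \<open>s > 0\<close> the radius stays positive throughout.\<close>

lemma continuous_lim_tail_time_mid:
  assumes "0 \<le> s" "s < 1"
  shows "continuous_on {entry_time s..1 - entry_time s} (\<lambda>\<alpha>. lim_tail \<alpha> s)"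
proof (cases "s = 0")
  case True
  have e: "lim_tail \<alpha> 0 = clipped_arccos (1 - 2 * \<alpha>) / pi" if "\<alpha> \<in> {0..1}" for \<alpha>
    using that by (auto simp: lim_tail_def clipped_arccos_ge clipped_arccos_le)
  have "continuous_on {0..1} (\<lambda>\<alpha>. clipped_arccos (1 - 2 * \<alpha>) / pi)"
    by (intro continuous_intros) auto
  then have "continuous_on {0..1} (\<lambda>\<alpha>. lim_tail \<alpha> 0)"
    by (rule continuous_on_eq) (simp add: e)
  then show ?thesis using True by (simp add: entry_time_def)
next
  case False
  then have e: "0 < entry_time s" using entry_time_bounds[of s] assms by auto
  have "s\<^sup>2 < 1" using assms by (simp add: power_less_one_iff)
  then have r: "sqrt (1 - s\<^sup>2) > 0" by simp
  have cr: "continuous_on A radius" for A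
    unfolding radius_def by (intro continuous_intros)
  have "continuous_on {entry_time s..1 - entry_time s} (\<lambda>\<alpha>. (clipped_arccos ((1 - 2 * \<alpha>) / sqrt (1 - s\<^sup>2)) -
      s * clipped_arccos ((1 - 2 * \<alpha>) * s / (radius \<alpha> * sqrt (1 - s\<^sup>2)))) / pi)"
  proof (intro continuous_intros cr)
    show "\<forall>\<alpha>\<in>{entry_time s..1 - entry_time s}. radius \<alpha> * sqrt (1 - s\<^sup>2) \<noteq> 0"
    proof
      fix \<alpha> assume "\<alpha> \<in> {entry_time s..1 - entry_time s}"
      then have "radius \<alpha> > 0" using e by (intro radius_pos) auto
      then show "radius \<alpha> * sqrt (1 - s\<^sup>2) \<noteq> 0" using r by simp
    qed
  qed (use r in auto)
  then show ?thesis by (rule continuous_on_eq) (use e in \<open>simp add: lim_tail_def\<close>)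
qed

lemma lim_tail_time_strict:
  assumes "0 \<le> s" "s < 1" "entry_time s \<le> \<alpha>" "\<alpha> < \<alpha>'" "\<alpha>' \<le> 1 - entry_time s"
  shows "lim_tail \<alpha> s < lim_tail \<alpha>' s"
proof (rule DERIV_pos_imp_increasing_open[OF assms(4)])
  show "continuous_on {\<alpha>..\<alpha>'} (\<lambda>\<alpha>. lim_tail \<alpha> s)"
    by (rule continuous_on_subset[OF continuous_lim_tail_time_mid[OF assms(1,2)]]) (use assms in auto)
  fix x assume x: "\<alpha> < x" "x < \<alpha>'"
  have x01: "0 < x" "x < 1" using x assms entry_time_bounds[of s] by auto
  then have "s < radius x" using radius_less_iff[of x s] x assms by auto
  then interpret inside x s using x01 assms by unfold_locales auto
  have "2 * q / (pi * a\<^sup>2) > 0" using facts(1,6) by simp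
  then show "\<exists>y. ((\<lambda>\<alpha>. lim_tail \<alpha> s) has_real_derivative y) (at x) \<and> 0 < y"
    using DERIV_lim_tail_time by blast
qed

lemma continuous_lim_tail_time:
  assumes "s \<in> {0..1}"
  shows "continuous_on {0..1} (\<lambda>\<alpha>. lim_tail \<alpha> s)"
proof (cases "s = 1")
  case True
  have "continuous_on {0..1::real} (\<lambda>\<alpha>. 0 :: real)" by simp
  then show ?thesis by (rule continuous_on_eq) (simp add: True lim_tail_at_1)
next
  case False
  let ?e = "entry_time s"
  have e: "0 \<le> ?e" "?e \<le> 1/2" using entry_time_bounds[of s] assms by auto
  have 1: "continuous_on {0..?e} (\<lambda>\<alpha>. lim_tail \<alpha> s)"
    by (rule continuous_on_eq[of _ "\<lambda>_. 0"]) (use lim_tail_early assms in auto)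
  have 2: "continuous_on {1 - ?e..1} (\<lambda>\<alpha>. lim_tail \<alpha> s)"
    by (rule continuous_on_eq[of _ "\<lambda>_. 1 - s"]) (use lim_tail_late assms in auto)
  have 3: "continuous_on {?e..1 - ?e} (\<lambda>\<alpha>. lim_tail \<alpha> s)"
    using continuous_lim_tail_time_mid[of s] assms False by auto
  have "continuous_on (({0..?e} \<union> {?e..1 - ?e}) \<union> {1 - ?e..1}) (\<lambda>\<alpha>. lim_tail \<alpha> s)"
    using 1 2 3 by (intro continuous_on_closed_Un closed_Un) auto
  moreover have "({0..?e} \<union> {?e..1 - ?e}) \<union> {1 - ?e..1} = {0..1}" using e by auto
  ultimately show ?thesis by simp
qed

text \<open>Continuity in time for each fixed \<open>s\<close> suffices, because the Lipschitz bound
  in \<open>s\<close> holds with constant 1 at all times.\<close>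

lemma continuous_lim_tail_joint:
  "continuous_on ({0..1} \<times> {0..1}) (\<lambda>(\<alpha>, s). lim_tail \<alpha> s)"
proof (rule continuous_onI)
  fix z :: "real \<times> real" and e :: real assume z: "z \<in> {0..1} \<times> {0..1}" and e: "e > 0"
  obtain \<alpha>0 s0 where z0: "z = (\<alpha>0, s0)" by (cases z)
  then have in0: "\<alpha>0 \<in> {0..1}" "s0 \<in> {0..1}" using z by auto
  obtain d where d: "d > 0" "\<And>\<alpha>. \<alpha> \<in> {0..1} \<Longrightarrow> dist \<alpha> \<alpha>0 < d \<Longrightarrow> dist (lim_tail \<alpha> s0) (lim_tail \<alpha>0 s0) < e / 2"
    using continuous_lim_tail_time[OF in0(2)] in0 e unfolding continuous_on_iff
    by (metis half_gt_zero)
  show "\<exists>d>0. \<forall>x'\<in>{0..1} \<times> {0..1}. dist x' z < d \<longrightarrow>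
      dist (case x' of (\<alpha>, s) \<Rightarrow> lim_tail \<alpha> s) (case z of (\<alpha>, s) \<Rightarrow> lim_tail \<alpha> s) \<le> e"
  proof (intro exI[of _ "min d (e/2)"] conjI ballI impI)
    show "min d (e/2) > 0" using d e by simp
    fix x' assume x': "x' \<in> {0..1} \<times> {0..1}" "dist x' z < min d (e/2)"
    obtain \<alpha> s where xs: "x' = (\<alpha>, s)" by (cases x')
    have in1: "\<alpha> \<in> {0..1}" "s \<in> {0..1}" using x' xs by auto
    have "dist \<alpha> \<alpha>0 \<le> dist x' z" "dist s s0 \<le> dist x' z"
      using dist_fst_le[of x' z] dist_snd_le[of x' z] by (auto simp: xs z0)
    then have ds: "dist \<alpha> \<alpha>0 < d" "dist s s0 < e / 2" using x' by auto
    have "dist (lim_tail \<alpha> s) (lim_tail \<alpha> s0) < e / 2"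
      using lim_tail_lipschitz[of \<alpha> s s0] in0 in1 ds by (auto simp: dist_real_def)
    moreover have "dist (lim_tail \<alpha> s0) (lim_tail \<alpha>0 s0) < e / 2" using d(2)[OF in1(1) ds(1)] .
    ultimately have "dist (lim_tail \<alpha> s) (lim_tail \<alpha>0 s0) < e"
      using dist_triangle[of "lim_tail \<alpha> s" "lim_tail \<alpha>0 s0" "lim_tail \<alpha> s0"] by linarith
    then show "dist (case x' of (\<alpha>, s) \<Rightarrow> lim_tail \<alpha> s) (case z of (\<alpha>, s) \<Rightarrow> lim_tail \<alpha> s) \<le> e"
      by (simp add: xs z0)
  qed
qed

lemma lim_tail_uniform:
  assumes "e > 0"
  obtains d where "d > 0" "\<And>\<alpha> \<alpha>' s s'. \<alpha> \<in> {0..1} \<Longrightarrow> \<alpha>' \<in> {0..1} \<Longrightarrow> s \<in> {0..1} \<Longrightarrow> s' \<in> {0..1} \<Longrightarrow>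
    \<bar>\<alpha> - \<alpha>'\<bar> \<le> d \<Longrightarrow> \<bar>s - s'\<bar> \<le> d \<Longrightarrow> \<bar>lim_tail \<alpha> s - lim_tail \<alpha>' s'\<bar> < e"
proof -
  have "uniformly_continuous_on ({0..1} \<times> {0..1}) (\<lambda>(\<alpha>, s). lim_tail \<alpha> s)"
    by (rule compact_uniformly_continuous[OF continuous_lim_tail_joint]) (intro compact_Times compact_Icc)
  then obtain d where d: "d > 0" and U: "\<And>z z'. z \<in> {0..1} \<times> {0..1} \<Longrightarrow> z' \<in> {0..1} \<times> {0..1} \<Longrightarrow> dist z' z < d \<Longrightarrow>
     dist (case z' of (\<alpha>, s) \<Rightarrow> lim_tail \<alpha> s) (case z of (\<alpha>, s) \<Rightarrow> lim_tail \<alpha> s) < e"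
    using assms unfolding uniformly_continuous_on_def by meson
  show ?thesis
  proof (rule that[of "d / 3"])
    show "d / 3 > 0" using d by simp
    fix \<alpha> \<alpha>' s s' :: real assume a: "\<alpha> \<in> {0..1}" "\<alpha>' \<in> {0..1}" "s \<in> {0..1}" "s' \<in> {0..1}" "\<bar>\<alpha> - \<alpha>'\<bar> \<le> d / 3" "\<bar>s - s'\<bar> \<le> d / 3"
    have "dist (\<alpha>, s) (\<alpha>', s') \<le> \<bar>\<alpha> - \<alpha>'\<bar> + \<bar>s - s'\<bar>"
      using sqrt_sum_squares_le_sum_abs[of "\<alpha> - \<alpha>'" "s - s'"] by (simp add: dist_Pair_Pair dist_real_def)
    then have "dist (\<alpha>, s) (\<alpha>', s') < d" using a d by linarith
    then show "\<bar>lim_tail \<alpha> s - lim_tail \<alpha>' s'\<bar> < e" using U[of "(\<alpha>', s')" "(\<alpha>, s)"] a by (simp add: dist_real_def)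
  qed
qed

subsection \<open>The level curves of L\<close>

text \<open>Both arccosines become arctangents. The first is inverted by
  \<open>arctan_inverse\<close>, for which \<open>c > 0\<close> is essential; this is the reason for
  \<open>\<alpha> < 1/2\<close>, as in the definition of \<open>g_low\<close>.\<close>

lemma arctan_form:
  assumes "0 < \<alpha>" "\<alpha> < 1/2" "0 \<le> s" "s < radius \<alpha>"
  defines "c \<equiv> 1 - 2 * \<alpha>" and "q \<equiv> sqrt ((radius \<alpha>)\<^sup>2 - s\<^sup>2)"
  shows "s + 2 * lim_tail \<alpha> s = 2 / pi * (s * arctan (c * s / q) + arctan (q / c))"
proof -
  interpret I: inside \<alpha> s using assms by unfold_locales auto
  have cq: "I.c = c" "I.q = q" by (simp_all add: I.c_def c_def I.q_def q_def I.a_def)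
  have c: "c > 0" using assms by (simp add: c_def)
  have f: "I.a > 0" "I.r > 0" "q > 0" using I.facts cq by auto
  have U: "clipped_arccos (c / I.r) = arctan (q / c)"
  proof -
    have "clipped_arccos (c / I.r) = arccos (c / I.r)"
      using I.U_V_bounds(1) unfolding cq by (intro clipped_arccos_eq) auto
    also have "\<dots> = pi / 2 - arctan ((c / I.r) / sqrt (1 - (c / I.r)\<^sup>2))"
      using I.U_V_bounds(1) unfolding cq abs_less_iff by (intro arccos_arctan) linarith+
    also have "(c / I.r) / sqrt (1 - (c / I.r)\<^sup>2) = c / q"
      using I.sqrt_U f unfolding cq by simp
    also have "pi / 2 - arctan (c / q) = arctan (q / c)"
      using arctan_inverse[of "c / q"] c f by simp
    finally show ?thesis .
  qed
  have V: "clipped_arccos (c * s / (I.a * I.r)) = pi / 2 - arctan (c * s / q)"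
  proof -
    have "clipped_arccos (c * s / (I.a * I.r)) = arccos (c * s / (I.a * I.r))"
      using I.U_V_bounds(2) unfolding cq by (intro clipped_arccos_eq) auto
    also have "\<dots> = pi / 2 - arctan ((c * s / (I.a * I.r)) / sqrt (1 - (c * s / (I.a * I.r))\<^sup>2))"
      using I.U_V_bounds(2) unfolding cq abs_less_iff by (intro arccos_arctan) linarith+
    also have "(c * s / (I.a * I.r)) / sqrt (1 - (c * s / (I.a * I.r))\<^sup>2) = c * s / q"
      using I.sqrt_V f unfolding cq by simp
    finally show ?thesis .
  qed
  have "lim_tail \<alpha> s = (clipped_arccos (c / I.r) - s * clipped_arccos (c * s / (I.a * I.r))) / pi"
    using assms by (simp add: lim_tail_def I.r_def I.a_def c_def)
  also have "\<dots> = (arctan (q / c) - s * (pi / 2 - arctan (c * s / q))) / pi" unfolding U V ..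
  finally have l: "lim_tail \<alpha> s = (arctan (q / c) - s * (pi / 2 - arctan (c * s / q))) / pi" .
  have "s + 2 * ((B - s * (pi / 2 - A)) / pi) = 2 / pi * (s * A + B)" for A B :: real
    by (simp add: divide_simps) (simp add: algebra_simps)
  then show ?thesis unfolding l .
qed

lemma radius_half_sq:
  assumes "0 \<le> \<alpha>" "\<alpha> \<le> 1"
  shows "2 * \<alpha> * (1 - \<alpha>) = (radius \<alpha>)\<^sup>2 / 2"
  unfolding radius_sq[OF assms] by (simp add: power2_eq_square algebra_simps)

lemma g_low_eq:
  assumes "0 < \<alpha>" "\<alpha> < 1/2" "0 \<le> s" "s \<le> radius \<alpha>"
  shows "sqrt 2 * g_low \<alpha> (- s / sqrt 2) = s + 2 * lim_tail \<alpha> s"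
proof -
  have h: "2 * \<alpha> * (1 - \<alpha>) = (radius \<alpha>)\<^sup>2 / 2" by (rule radius_half_sq) (use assms in auto)
  have u2: "(- s / sqrt 2)\<^sup>2 = s\<^sup>2 / 2" by (simp add: power_divide)
  have rn: "radius \<alpha> \<ge> 0" using assms by linarith
  show ?thesis
  proof (cases "s = radius \<alpha>")
    case True
    have "radius \<alpha> \<le> 1" using radius_le_1[of \<alpha>] assms by simp
    then have "lim_tail \<alpha> s = 0" using lim_tail_beyond[of \<alpha> s] True assms by simp
    then show ?thesis using assms True unfolding g_low_def u2 h by simp
  next
    case False
    then have s: "s < radius \<alpha>" using assms by simp
    define q where "q = sqrt ((radius \<alpha>)\<^sup>2 - s\<^sup>2)"
    have s2: "s\<^sup>2 < (radius \<alpha>)\<^sup>2" using s assms by (intro power_strict_mono) auto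
    then have q: "q > 0" by (simp add: q_def)
    have ne: "s\<^sup>2 / 2 \<noteq> (radius \<alpha>)\<^sup>2 / 2" using s2 by simp
    have r1: "sqrt ((radius \<alpha>)\<^sup>2 / 2 - s\<^sup>2 / 2) = q / sqrt 2"
      by (simp add: q_def diff_divide_distrib[symmetric] real_sqrt_divide)
    have r2: "sqrt (2 * ((radius \<alpha>)\<^sup>2 / 2 - s\<^sup>2 / 2)) = q" by (simp add: q_def algebra_simps)
    have e: "(1 - 2 * \<alpha>) * (- s / sqrt 2) / (q / sqrt 2) = - ((1 - 2 * \<alpha>) * s / q)"
      using q by simp
    have gl: "g_low \<alpha> (- s / sqrt 2) = 2 * (- s / sqrt 2) / pi * arctan (- ((1 - 2 * \<alpha>) * s / q)) +
        sqrt 2 / pi * arctan (q / (1 - 2 * \<alpha>))"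
      unfolding g_low_def u2 h r1 r2 e using ne by simp
    have k: "sqrt 2 * (2 * (- s / sqrt 2) / pi * (- A) + sqrt 2 / pi * B) = 2 / pi * (s * A + B)" for A B :: real
    proof -
      have gen: "z * (2 * (- s / z) / pi * (- A) + z / pi * B) = 2 * s / pi * A + (z * z) / pi * B"
        if "z \<noteq> 0" for z :: real using that by (simp add: distrib_left)
      have "sqrt 2 * (2 * (- s / sqrt 2) / pi * (- A) + sqrt 2 / pi * B) = 2 * s / pi * A + (sqrt 2 * sqrt 2) / pi * B"
        by (rule gen) simp
      also have "\<dots> = 2 / pi * (s * A + B)" by (simp add: distrib_left)
      finally show ?thesis .
    qed
    show ?thesis unfolding gl arctan_minus k
      using arctan_form[OF assms(1-3) s] by (simp add: q_def)
  qed
qed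

text \<open>In the rotated coordinates \<open>sqrt 2 * v = x + y\<close> and
  \<open>y - x = s\<close>. The curve \<open>v = g \<alpha> u\<close> therefore reads
  \<open>x + y = s + 2 * lim_tail \<alpha> s\<close>, that is
  \<open>x = lim_tail \<alpha> (y - x)\<close>.\<close>

lemma g_eq:
  assumes "0 < \<alpha>" "\<alpha> < 1" "0 \<le> s" "s \<le> radius \<alpha>"
  shows "sqrt 2 * g \<alpha> (- s / sqrt 2) = s + 2 * lim_tail \<alpha> s"
proof -
  have s1: "s \<le> 1" using radius_le_1[of \<alpha>] assms by simp
  consider "\<alpha> < 1/2" | "\<alpha> = 1/2" | "\<alpha> > 1/2" by linarith
  then show ?thesis
  proof cases
    case 1
    then show ?thesis using g_low_eq[of \<alpha> s] assms by (simp add: g_def)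
  next
    case 2
    show ?thesis unfolding 2 lim_tail_half[OF assms(3) s1] by (simp add: g_def field_simps)
  next
    case 3
    have "sqrt 2 * g_low (1 - \<alpha>) (- s / sqrt 2) = s + 2 * lim_tail (1 - \<alpha>) s"
      using 3 assms by (intro g_low_eq) (auto simp: radius_flip)
    then have "sqrt 2 * g_low (1 - \<alpha>) (- s / sqrt 2) = 2 - s - 2 * lim_tail \<alpha> s"
      unfolding lim_tail_flip by simp
    moreover have "g \<alpha> (- s / sqrt 2) = sqrt 2 - g_low (1 - \<alpha>) (- s / sqrt 2)" using 3 by (simp add: g_def)
    ultimately show ?thesis by (simp add: right_diff_distrib)
  qed
qed

lemma L_eq_iff:
  assumes xy: "0 \<le> x" "x \<le> y" "y \<le> 1" and nc: "\<not> (x = 0 \<and> y = 0)" "\<not> (x = 1 \<and> y = 1)" and \<alpha>: "0 < \<alpha>" "\<alpha> < 1"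
  shows "L x y = \<alpha> \<longleftrightarrow> y - x \<le> radius \<alpha> \<and> x = lim_tail \<alpha> (y - x)"
proof -
  define s where "s = y - x"
  have s: "0 \<le> s" "s \<le> 1" "x \<le> 1 - s" using xy by (auto simp: s_def)
  define P where "P = (\<lambda>\<alpha>. 0 < \<alpha> \<and> \<alpha> < 1 \<and> \<bar>(x - y) / sqrt 2\<bar> \<le> sqrt (2 * \<alpha> * (1 - \<alpha>)) \<and> (x + y) / sqrt 2 = g \<alpha> ((x - y) / sqrt 2))"
  have P: "P a \<longleftrightarrow> 0 < a \<and> a < 1 \<and> s \<le> radius a \<and> x = lim_tail a s" for a
  proof (cases "0 < a \<and> a < 1")
    case True
    have u: "(x - y) / sqrt 2 = - s / sqrt 2" by (simp add: s_def)
    have "sqrt (2 * a * (1 - a)) = sqrt ((radius a)\<^sup>2 / 2)" using radius_half_sq[of a] True by simp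
    also have "\<dots> = radius a / sqrt 2" using radius_nonneg[of a] True by (simp add: real_sqrt_divide)
    finally have "\<bar>(x - y) / sqrt 2\<bar> \<le> sqrt (2 * a * (1 - a)) \<longleftrightarrow> s \<le> radius a"
      unfolding u using s(1) by (simp add: divide_le_cancel)
    moreover have "(x + y) / sqrt 2 = g a ((x - y) / sqrt 2) \<longleftrightarrow> x = lim_tail a s" if "s \<le> radius a"
    proof -
      have "(x + y) / sqrt 2 = g a (- s / sqrt 2) \<longleftrightarrow> sqrt 2 * ((x + y) / sqrt 2) = sqrt 2 * g a (- s / sqrt 2)"
        by (rule mult_left_cancel[symmetric]) simp
      also have "\<dots> \<longleftrightarrow> x + y = s + 2 * lim_tail a s" using g_eq[of a s] True s(1) that by simp
      also have "\<dots> \<longleftrightarrow> x = lim_tail a s" by (auto simp: s_def)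
      finally show ?thesis unfolding u .
    qed
    ultimately show ?thesis unfolding P_def using True by blast
  qed (auto simp: P_def)
  have ex: "\<exists>!a. P a"
  proof -
    let ?e = "entry_time s"
    have e: "0 \<le> ?e" "?e \<le> 1/2" "0 < s \<Longrightarrow> 0 < ?e" using entry_time_bounds[OF s(1,2)] by auto
    have in_range: "s \<le> radius a \<longleftrightarrow> ?e \<le> a \<and> a \<le> 1 - ?e" if "0 < a" "a < 1" for a
    proof -
      have "sqrt (1 - s\<^sup>2) \<ge> 0" using s by (simp add: power_le_one)
      have "s \<le> radius a \<longleftrightarrow> s\<^sup>2 \<le> (radius a)\<^sup>2"
        using s(1) radius_nonneg[of a] that by (metis abs_le_square_iff abs_of_nonneg less_imp_le)
      also have "\<dots> \<longleftrightarrow> (1 - 2 * a)\<^sup>2 \<le> (sqrt (1 - s\<^sup>2))\<^sup>2"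
        using radius_sq[of a] that s by (auto simp: power_le_one)
      also have "\<dots> \<longleftrightarrow> \<bar>1 - 2 * a\<bar> \<le> sqrt (1 - s\<^sup>2)"
        using \<open>sqrt (1 - s\<^sup>2) \<ge> 0\<close> by (metis abs_le_square_iff abs_of_nonneg)
      also have "\<dots> \<longleftrightarrow> ?e \<le> a \<and> a \<le> 1 - ?e" by (auto simp: entry_time_def abs_le_iff field_simps)
      finally show ?thesis .
    qed
    show ?thesis
    proof (cases "s = 1")
      case True
      then have "?e = 1/2" "x = 0" using s xy by (auto simp: entry_time_def)
      moreover have "lim_tail (1/2) s = 0" using True lim_tail_half[of 1] by simp
      moreover have "(1/2::real) > 0" "(1/2::real) < 1" by auto
      ultimately have "P (1/2)" unfolding P using in_range[of "1/2"] by auto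
      moreover have "b = 1/2" if "P b" for b
      proof -
        have "?e \<le> b \<and> b \<le> 1 - ?e" using that in_range[of b] unfolding P by blast
        then show ?thesis using \<open>?e = 1/2\<close> by linarith
      qed
      ultimately show ?thesis by (rule ex1I)
    next
      case False
      then have s1: "s < 1" using s by simp
      have "lim_tail ?e s \<le> x" using lim_tail_early[of ?e s] e s xy by simp
      moreover have "x \<le> lim_tail (1 - ?e) s" using lim_tail_late[of s "1 - ?e"] e s by simp
      ultimately obtain a where a: "?e \<le> a" "a \<le> 1 - ?e" "lim_tail a s = x"
        using IVT'[of "\<lambda>a. lim_tail a s" ?e x "1 - ?e"] continuous_lim_tail_time_mid[OF s(1) s1] e by auto
      have a01: "0 < a" "a < 1"
      proof -
        have "0 < a \<and> a < 1"
        proof (cases "s > 0")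
          case True
          then show ?thesis using a e by auto
        next
          case False
          then have s0: "s = 0" using s by simp
          then have "x \<noteq> 0" "x \<noteq> 1" using nc by (auto simp: s_def)
          moreover have "lim_tail 0 0 = 0" "lim_tail 1 0 = 1" by (simp_all add: lim_tail_def)
          ultimately have "a \<noteq> 0" "a \<noteq> 1" using a s0 by auto
          then show ?thesis using a e by auto
        qed
        then show "0 < a" "a < 1" by auto
      qed
      show ?thesis
      proof (rule ex1I[of _ a])
        show "P a" unfolding P using a a01 in_range[OF a01] by auto
        fix b assume "P b"
        then have b: "0 < b" "b < 1" "s \<le> radius b" "x = lim_tail b s" unfolding P by auto
        then have b': "?e \<le> b" "b \<le> 1 - ?e" using in_range by auto
        show "b = a"
          using lim_tail_time_strict[OF s(1) s1, of a b] lim_tail_time_strict[OF s(1) s1, of b a] a b b'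
          by (cases a b rule: linorder_cases) auto
      qed
    qed
  qed
  have uv: "\<not> ((x - y) / sqrt 2 = 0 \<and> (x + y) / sqrt 2 = 0)"
  proof
    assume "(x - y) / sqrt 2 = 0 \<and> (x + y) / sqrt 2 = 0"
    then have "x = y" "x + y = 0" by auto
    then show False using nc(1) by auto
  qed
  have uv': "\<not> ((x - y) / sqrt 2 = 0 \<and> (x + y) / sqrt 2 = sqrt 2)"
  proof
    assume a: "(x - y) / sqrt 2 = 0 \<and> (x + y) / sqrt 2 = sqrt 2"
    then have "x + y = sqrt 2 * sqrt 2" by (simp add: field_simps)
    then have "x = y" "x + y = 2" using a by auto
    then show False using nc(2) by auto
  qed
  have "L x y = (THE a. P a)" unfolding L_def Lbar_def P_def using uv uv' by (simp only: if_False)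
  moreover have "(THE a. P a) = \<alpha> \<longleftrightarrow> P \<alpha>"
    using theI'[OF ex] the1_equality[OF ex, of \<alpha>] by blast
  ultimately have "L x y = \<alpha> \<longleftrightarrow> P \<alpha>" by simp
  then show ?thesis unfolding P using \<alpha> by (simp add: s_def)
qed

text \<open>With \<open>x = lim_tail \<alpha> t\<close> and \<open>y = x + t\<close>, the
  alternatives are the two arms \<open>x = \<beta>\<close> and \<open>y = \<beta>\<close> of
  \<open>D_beta\<close>.\<close>

definition on_curve :: "real \<Rightarrow> real \<Rightarrow> real \<Rightarrow> bool" where
  "on_curve \<beta> \<alpha> t \<longleftrightarrow> lim_tail \<alpha> t = \<beta> \<or> t + lim_tail \<alpha> t = \<beta>"

text \<open>As \<open>0 < \<beta> < 1\<close>, any solution lies where the relevant monotonicity is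
  strict. In the mixed cases the weak monotonicity of one function reduces the conflict to
  strictness of one of them.\<close>

lemma on_curve_unique:
  assumes "0 \<le> \<alpha>" "\<alpha> \<le> 1" "0 < \<beta>" "\<beta> < 1" "t \<in> {0..1}" "t' \<in> {0..1}" "on_curve \<beta> \<alpha> t" "on_curve \<beta> \<alpha> t'"
  shows "t = t'"
proof -
  have False if tt: "t \<in> {0..1}" "t' \<in> {0..1}" "on_curve \<beta> \<alpha> t" "on_curve \<beta> \<alpha> t'" and less: "t < t'" for t t'
  proof -
    note m = lim_tail_mono[OF assms(1,2), of t t'] 
    note m0 = lim_tail_mono[OF assms(1,2), of 0 t]
    have r: "0 \<le> t" "t' \<le> 1" using tt by auto
    have b: "t' + lim_tail \<alpha> t' \<le> 1" "0 \<le> lim_tail \<alpha> t'" using lim_tail_bounds[OF assms(1,2), of t'] tt by auto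
    consider "lim_tail \<alpha> t = \<beta>" "lim_tail \<alpha> t' = \<beta>" | "lim_tail \<alpha> t = \<beta>" "t' + lim_tail \<alpha> t' = \<beta>"
      | "t + lim_tail \<alpha> t = \<beta>" "lim_tail \<alpha> t' = \<beta>" | "t + lim_tail \<alpha> t = \<beta>" "t' + lim_tail \<alpha> t' = \<beta>"
      using tt(3,4) unfolding on_curve_def by blast
    then show False
    proof cases
      case 1
      then show False using m(3)[OF r(1) less r(2)] assms(3) by simp
    next
      case 2
      then have "t' + lim_tail \<alpha> t' \<le> t + lim_tail \<alpha> t" using r by simp
      moreover have "t + lim_tail \<alpha> t < 1"
        using 2 m(2)[OF r(1) less r(2)] assms(4) by linarith
      ultimately show False using m(4)[OF r(1) less r(2)] by simp
    next
      case 3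
      then show False using m(3)[OF r(1) less r(2)] m(1)[OF r(1) less r(2)] r assms(3) by auto
    next
      case 4
      then show False using m(4)[OF r(1) less r(2)] assms(4) by simp
    qed
  qed
  from this[of t t'] this[of t' t] show ?thesis using assms(5-8) by (cases t t' rule: linorder_cases) auto
qed

text \<open>The thresholds in \<open>frak_t\<close> are \<open>entry_time \<beta>\<close> and
  \<open>1 - entry_time (1 - \<beta>)\<close>. Before the first the tail at \<open>\<beta>\<close>
  is 0, so \<open>t = \<beta>\<close> solves the second equation; after the second the tail at
  \<open>1 - \<beta>\<close> equals \<open>\<beta>\<close>. In between the level curve of
  \<open>L\<close> decides.\<close>

lemma on_curve_frak_t:
  assumes \<beta>: "0 < \<beta>" "\<beta> < 1" and \<alpha>: "0 \<le> \<alpha>" "\<alpha> \<le> 1"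
  shows "frak_t \<beta> \<alpha> \<in> {0..1} \<and> on_curve \<beta> \<alpha> (frak_t \<beta> \<alpha>)"
proof -
  have e1: "(1 - sqrt (1 - \<beta>\<^sup>2)) / 2 = entry_time \<beta>" by (simp add: entry_time_def)
  have "1 - (1 - \<beta>)\<^sup>2 = 2 * \<beta> - \<beta>\<^sup>2" by (simp add: power2_eq_square algebra_simps)
  then have e2: "(1 + sqrt (2 * \<beta> - \<beta>\<^sup>2)) / 2 = 1 - entry_time (1 - \<beta>)"
    by (simp add: entry_time_def field_simps)
  consider "\<alpha> \<le> entry_time \<beta>" | "\<not> \<alpha> \<le> entry_time \<beta>" "1 - entry_time (1 - \<beta>) \<le> \<alpha>"
    | "entry_time \<beta> < \<alpha>" "\<alpha> < 1 - entry_time (1 - \<beta>)" by linarith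
  then show ?thesis
  proof cases
    case 1
    then have "frak_t \<beta> \<alpha> = \<beta>" by (simp add: frak_t_def e1)
    moreover have "lim_tail \<alpha> \<beta> = 0" using 1 \<alpha> \<beta> by (intro lim_tail_early) auto
    ultimately show ?thesis using \<beta> by (simp add: on_curve_def)
  next
    case 2
    then have "frak_t \<beta> \<alpha> = 1 - \<beta>" unfolding frak_t_def e1 e2 by simp
    moreover have "lim_tail \<alpha> (1 - \<beta>) = \<beta>" using lim_tail_late[of "1 - \<beta>" \<alpha>] 2 \<alpha> \<beta> by simp
    ultimately show ?thesis using \<beta> by (simp add: on_curve_def)
  next
    case 3
    have \<alpha>': "0 < \<alpha>" "\<alpha> < 1" using 3 entry_time_bounds[of \<beta>] entry_time_bounds[of "1 - \<beta>"] \<beta> by auto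
    have ft: "frak_t \<beta> \<alpha> = frak_f \<beta> \<alpha>" using 3 unfolding frak_t_def e1 e2 by simp
    have nc: "\<not> (x = 0 \<and> y = 0)" "\<not> (x = 1 \<and> y = 1)" if "(x, y) \<in> D_beta \<beta>" for x y
      using that \<beta> by (auto simp: D_beta_def)
    have L: "L x y = \<alpha> \<longleftrightarrow> y - x \<le> radius \<alpha> \<and> x = lim_tail \<alpha> (y - x)" if d: "(x, y) \<in> D_beta \<beta>" for x y
      by (rule L_eq_iff[OF _ _ _ nc[OF d] \<alpha>']) (use d in \<open>auto simp: D_beta_def\<close>)
    have curve: "d \<in> {0..1} \<and> on_curve \<beta> \<alpha> d" if ex: "\<exists>x y. (x, y) \<in> D_beta \<beta> \<and> L x y = \<alpha> \<and> d = y - x" for d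
    proof -
      obtain x y where xy: "(x, y) \<in> D_beta \<beta>" "L x y = \<alpha>" "d = y - x" using ex by blast
      then have "x = lim_tail \<alpha> d" using L by auto
      then show ?thesis using xy by (auto simp: D_beta_def on_curve_def)
    qed
    have "\<exists>t. t \<in> {0..1} \<and> on_curve \<beta> \<alpha> t"
    \<comment> \<open>The tail at 0 decides which arm is met: from a value at least
      \<open>\<beta>\<close> the tail falls to 0, otherwise position plus tail rises from below
      \<open>\<beta>\<close> to 1.\<close>
    proof (cases "\<beta> \<le> lim_tail \<alpha> 0")
      case True
      then obtain t where "0 \<le> t" "t \<le> 1" "lim_tail \<alpha> t = \<beta>"
        using IVT2'[of "lim_tail \<alpha>" 1 \<beta> 0] continuous_lim_tail[OF \<alpha>] lim_tail_at_1[OF \<alpha>] \<beta> by auto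
      then show ?thesis by (auto simp: on_curve_def)
    next
      case False
      have "continuous_on {0..1} (\<lambda>t. t + lim_tail \<alpha> t)" by (intro continuous_intros continuous_lim_tail[OF \<alpha>])
      then obtain t where "0 \<le> t" "t \<le> 1" "t + lim_tail \<alpha> t = \<beta>"
        using IVT'[of "\<lambda>t. t + lim_tail \<alpha> t" 0 \<beta> 1] lim_tail_at_1[OF \<alpha>] \<beta> False by auto
      then show ?thesis by (auto simp: on_curve_def)
    qed
    then obtain t where t: "t \<in> {0..1}" "on_curve \<beta> \<alpha> t" by blast
    \<comment> \<open>Beyond the radius the profile is frozen, which would force
      \<open>t = \<beta>\<close> or \<open>t = 1 - \<beta>\<close>; the assumed time range places
      both of these inside the radius.\<close>
    have tr: "t \<le> radius \<alpha>"
    proof (rule ccontr)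
      assume "\<not> t \<le> radius \<alpha>"
      then have tr: "radius \<alpha> \<le> t" by simp
      consider "\<alpha> \<le> 1/2" | "1/2 \<le> \<alpha>" by linarith
      then show False
      proof cases
        case 1
        then have "lim_tail \<alpha> t = 0" using lim_tail_beyond[of \<alpha> t] tr t \<alpha> by auto
        then have "t = \<beta>" using t \<beta> by (auto simp: on_curve_def)
        then have "\<not> \<beta> < radius \<alpha>" using tr by simp
        then show False using radius_less_iff[of \<alpha> \<beta>] \<alpha> \<beta> 3 1 entry_time_bounds[of "\<beta>"] by auto
      next
        case 2
        then have "lim_tail \<alpha> t = 1 - t" using lim_tail_beyond'[of \<alpha> t] tr t \<alpha> by auto
        then have "t = 1 - \<beta>" using t \<beta> by (auto simp: on_curve_def)
        then have "\<not> 1 - \<beta> < radius \<alpha>" using tr by simp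
        then show False using radius_less_iff[of \<alpha> "1 - \<beta>"] \<alpha> \<beta> 3 2 entry_time_bounds[of "1 - \<beta>"] by auto
      qed
    qed
    define x where "x = lim_tail \<alpha> t"
    have xb: "0 \<le> x" "t + x \<le> 1" using lim_tail_bounds[OF \<alpha> t(1)] by (auto simp: x_def)
    have xD: "(x, x + t) \<in> D_beta \<beta>" using t xb by (auto simp: D_beta_def on_curve_def x_def)
    then have ex: "\<exists>x y. (x, y) \<in> D_beta \<beta> \<and> L x y = \<alpha> \<and> t = y - x"
      using L[OF xD] tr by (intro exI[of _ x] exI[of _ "x + t"]) (auto simp: x_def)
    have "frak_f \<beta> \<alpha> = t" unfolding frak_f_def
    proof (rule the_equality)
      show "\<exists>x y. (x, y) \<in> D_beta \<beta> \<and> L x y = \<alpha> \<and> t = y - x" by (rule ex)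
    next
      fix d assume "\<exists>x y. (x, y) \<in> D_beta \<beta> \<and> L x y = \<alpha> \<and> d = y - x"
      then show "d = t" using on_curve_unique[OF \<alpha> \<beta> _ t(1) _ t(2)] curve by blast
    qed
    then show ?thesis using t ft by simp
  qed
qed

text \<open>Uniqueness is upgraded by compactness: among pairs of points at distance at least
  \<open>e\<close>, the sum of their two defects \<open>h\<close> is positive and continuous, hence
  bounded below by some \<open>d\<close>. Taking \<open>frak_t\<close> as one of the points, with
  defect 0, leaves a bound for the other alone.\<close>

lemma on_curve_stable:
  assumes \<beta>: "0 < \<beta>" "\<beta> < 1" and e: "e > 0"
  obtains d where "d > 0" "\<And>\<alpha> t. \<alpha> \<in> {0..1} \<Longrightarrow> t \<in> {0..1} \<Longrightarrow>
    \<bar>lim_tail \<alpha> t - \<beta>\<bar> < d \<or> \<bar>t + lim_tail \<alpha> t - \<beta>\<bar> < d \<Longrightarrow> \<bar>t - frak_t \<beta> \<alpha>\<bar> < e"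
proof -
  define h where "h = (\<lambda>\<alpha> t. min \<bar>lim_tail \<alpha> t - \<beta>\<bar> \<bar>t + lim_tail \<alpha> t - \<beta>\<bar>)"
  have h0: "h \<alpha> t = 0 \<longleftrightarrow> on_curve \<beta> \<alpha> t" for \<alpha> t by (auto simp: h_def on_curve_def min_def)
  have hp: "h \<alpha> t \<ge> 0" for \<alpha> t by (simp add: h_def)
  let ?C = "{0..1::real} \<times> {0..1::real} \<times> {0..1::real}"
  let ?K = "?C \<inter> {z. e \<le> \<bar>fst (snd z) - snd (snd z)\<bar>}"
  have "compact ?K"
    by (intro compact_Int_closed compact_Times compact_Icc closed_Collect_le continuous_intros)
  have c1: "continuous_on ?C (\<lambda>z. lim_tail (fst z) (fst (snd z)))"
  proof -
    have "continuous_on ?C (\<lambda>z. (\<lambda>(\<alpha>, s). lim_tail \<alpha> s) (fst z, fst (snd z)))"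
      by (rule continuous_on_compose2[OF continuous_lim_tail_joint]) (auto intro!: continuous_intros)
    then show ?thesis by simp
  qed
  have c2: "continuous_on ?C (\<lambda>z. lim_tail (fst z) (snd (snd z)))"
  proof -
    have "continuous_on ?C (\<lambda>z. (\<lambda>(\<alpha>, s). lim_tail \<alpha> s) (fst z, snd (snd z)))"
      by (rule continuous_on_compose2[OF continuous_lim_tail_joint]) (auto intro!: continuous_intros)
    then show ?thesis by simp
  qed
  have "continuous_on ?C (\<lambda>z. h (fst z) (fst (snd z)) + h (fst z) (snd (snd z)))"
    unfolding h_def by (intro continuous_intros c1 c2)
  then have cont: "continuous_on ?K (\<lambda>z. h (fst z) (fst (snd z)) + h (fst z) (snd (snd z)))"
    by (rule continuous_on_subset) auto
  have pos: "h (fst z) (fst (snd z)) + h (fst z) (snd (snd z)) > 0" if "z \<in> ?K" for z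
  proof (rule ccontr)
    assume "\<not> h (fst z) (fst (snd z)) + h (fst z) (snd (snd z)) > 0"
    then have "on_curve \<beta> (fst z) (fst (snd z))" "on_curve \<beta> (fst z) (snd (snd z))"
      using hp[of "fst z" "fst (snd z)"] hp[of "fst z" "snd (snd z)"] unfolding h0[symmetric] by linarith+
    then have "fst (snd z) = snd (snd z)"
      using that \<beta> by (intro on_curve_unique[of "fst z" \<beta>]) auto
    then show False using that e by auto
  qed
  obtain d where d: "d > 0" "\<And>z. z \<in> ?K \<Longrightarrow> d \<le> h (fst z) (fst (snd z)) + h (fst z) (snd (snd z))"
  proof (cases "?K = {}")
    case True
    then show ?thesis by (intro that[of 1]) auto
  next
    case False
    obtain m where m: "m \<in> ?K" "\<And>z. z \<in> ?K \<Longrightarrow>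
       h (fst m) (fst (snd m)) + h (fst m) (snd (snd m)) \<le> h (fst z) (fst (snd z)) + h (fst z) (snd (snd z))"
      using continuous_attains_inf[OF \<open>compact ?K\<close> False cont] by blast
    show ?thesis by (rule that[OF pos[OF m(1)] m(2)])
  qed
  show ?thesis
  proof (rule that[OF d(1)])
    fix \<alpha> t :: real assume a: "\<alpha> \<in> {0..1}" "t \<in> {0..1}" "\<bar>lim_tail \<alpha> t - \<beta>\<bar> < d \<or> \<bar>t + lim_tail \<alpha> t - \<beta>\<bar> < d"
    then have hd: "h \<alpha> t < d" by (auto simp: h_def)
    have f: "frak_t \<beta> \<alpha> \<in> {0..1}" "h \<alpha> (frak_t \<beta> \<alpha>) = 0"
      using on_curve_frak_t[OF \<beta>, of \<alpha>] a unfolding h0 by auto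
    show "\<bar>t - frak_t \<beta> \<alpha>\<bar> < e"
    proof (rule ccontr)
      assume "\<not> \<bar>t - frak_t \<beta> \<alpha>\<bar> < e"
      then have "(\<alpha>, t, frak_t \<beta> \<alpha>) \<in> ?K" using a f by auto
      from d(2)[OF this] show False using hd f by simp
    qed
  qed
qed

subsection \<open>Moments of the limit profile\<close>

text \<open>Integrating by parts moves two derivatives onto the tail and leaves the kernel
  \<open>1 / ((1 - x^2) w)\<close>. Splitting off \<open>1 / (1 - x^2)\<close> reduces its moments
  to those of the arcsine law, whose central binomials are the ones in the recursion of
  \<open>lim_moment\<close>.\<close>

lemma lim_tail_moment_low:
  assumes \<alpha>: "0 < \<alpha>" "\<alpha> < 1/2"
  shows "((\<lambda>x. lim_tail \<alpha> x * (real (2 * m + 2) * real (2 * m + 1) * x ^ (2 * m))) has_integral lim_moment \<alpha> (Suc m)) {0..1}"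
proof -
  define a where "a = radius \<alpha>"
  define c where "c = 1 - 2 * \<alpha>"
  have a0: "a > 0" using radius_pos \<alpha> by (simp add: a_def)
  have c0: "c > 0" using \<alpha> by (simp add: c_def)
  have a2: "a\<^sup>2 = 1 - c\<^sup>2" using radius_sq[of \<alpha>] \<alpha> by (simp add: a_def c_def)
  then have "a\<^sup>2 < 1" using c0 by simp
  then have a1: "a < 1" using a0 by (simp add: power_less_one_iff)
  have x1: "1 - x\<^sup>2 > 0" if "x \<in> {0..a}" for x
    using that a1 by (simp add: power_less_one_iff)
  define \<rho> where "\<rho> = (\<lambda>x. clipped_arccos (c * x / (a * sqrt (1 - x\<^sup>2))) / pi)"
  have c\<rho>: "continuous_on {0..a} \<rho>" unfolding \<rho>_def
    using a0 x1 by (intro continuous_intros) (auto simp: less_le)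
  have cF: "continuous_on {0..a} (lim_tail \<alpha>)" unfolding a_def by (rule continuous_lim_tail_low[OF \<alpha>])
  have \<rho>a: "\<rho> a = 0"
  proof -
    have "sqrt (1 - a\<^sup>2) = c" using a2 c0 by simp
    then show ?thesis using a0 c0 by (simp add: \<rho>_def clipped_arccos_ge)
  qed
  have \<rho>0: "\<rho> 0 = 1/2" by (simp add: \<rho>_def clipped_arccos_def)
  define w where "w = (\<lambda>x. sqrt (a\<^sup>2 - x\<^sup>2))"
  have D: "(\<rho> has_real_derivative - (c / pi) / ((1 - x\<^sup>2) * w x)) (at x)"
    "(lim_tail \<alpha> has_real_derivative - \<rho> x) (at x)" "w x > 0" "(w x)\<^sup>2 = a\<^sup>2 - x\<^sup>2" if "x \<in> {0<..<a}" for x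
  proof -
    interpret I: inside \<alpha> x using that \<alpha> by unfold_locales (auto simp: a_def)
    have e: "I.a = a" "I.c = c" "I.q = w x" "I.r\<^sup>2 = 1 - x\<^sup>2"
      using I.facts by (simp_all add: I.a_def a_def I.c_def c_def I.q_def w_def)
    show "w x > 0" "(w x)\<^sup>2 = a\<^sup>2 - x\<^sup>2" using I.facts(6,7) e by auto
    show "(lim_tail \<alpha> has_real_derivative - \<rho> x) (at x)"
      using I.DERIV_lim_tail unfolding e by (simp add: \<rho>_def I.r_def)
    have "(\<rho> has_real_derivative - c / ((1 - x\<^sup>2) * w x) / pi) (at x)"
      using DERIV_cdivide[OF I.DERIV_density, of pi] unfolding e \<rho>_def .
    moreover have "- c / ((1 - x\<^sup>2) * w x) / pi = - (c / pi) / ((1 - x\<^sup>2) * w x)" by simp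
    ultimately show "(\<rho> has_real_derivative - (c / pi) / ((1 - x\<^sup>2) * w x)) (at x)" by metis
  qed
  have xpos: "1 - x\<^sup>2 > 0" if "x \<in> {0<..<a}" for x using x1[of x] that by auto
  \<comment> \<open>Moments of the arcsine law on \<open>[0, a]\<close>. The recursion comes from
    differentiating \<open>x^(2j+1) w\<close>, which vanishes at both ends.\<close>
  have W: "((\<lambda>x. x ^ (2 * j) / w x) has_integral (pi / 2 * central j * (\<alpha> * (1 - \<alpha>)) ^ j)) {0..a}" for j
  proof (induction j)
    case 0
    have "((\<lambda>x. 1 / w x) has_integral (arcsin (a / a) - arcsin (0 / a))) {0..a}"
    proof (rule fundamental_theorem_of_calculus_interior)
      show "continuous_on {0..a} (\<lambda>x. arcsin (x / a))"
        using a0 by (intro continuous_on_arcsin continuous_intros) (auto simp: field_simps)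
      fix x assume x: "x \<in> {0<..<a}"
      have xa: "- 1 < x / a" "x / a < 1" using x a0 by (auto simp: field_simps)
      have "sqrt (1 - (x / a)\<^sup>2) = sqrt ((a\<^sup>2 - x\<^sup>2) / a\<^sup>2)" using a0 by (simp add: power_divide diff_divide_distrib)
      then have sq: "sqrt (1 - (x / a)\<^sup>2) = w x / a" using a0 by (simp add: real_sqrt_divide w_def)
      have "((\<lambda>x. x / a) has_real_derivative 1 / a) (at x)" by (intro DERIV_cdivide DERIV_ident)
      from DERIV_chain2[where f = arcsin and g = "\<lambda>x. x / a", OF DERIV_arcsin[OF xa] this]
      have "((\<lambda>x. arcsin (x / a)) has_real_derivative inverse (w x / a) * (1 / a)) (at x)" unfolding sq .
      moreover have "inverse (w x / a) * (1 / a) = 1 / w x" using a0 by (simp add: field_simps)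
      ultimately show "((\<lambda>x. arcsin (x / a)) has_vector_derivative 1 / w x) (at x)"
        by (simp add: has_real_derivative_iff_has_vector_derivative)
    qed (use a0 in simp)
    then show ?case using a0 by simp
  next
    case (Suc j)
    define J where "J = real (Suc j)"
    have J: "J > 0" by (simp add: J_def)
    have "((\<lambda>x. 2 * J * (x ^ (2 * Suc j) / w x) - (2 * J - 1) * a\<^sup>2 * (x ^ (2 * j) / w x)) has_integral
       (- (a ^ (2 * j + 1) * w a) - (- (0 ^ (2 * j + 1) * w 0)))) {0..a}"
    proof (rule fundamental_theorem_of_calculus_interior)
      show "continuous_on {0..a} (\<lambda>x. - (x ^ (2 * j + 1) * w x))" unfolding w_def
        by (intro continuous_intros)
      fix x assume x: "x \<in> {0<..<a}"
      have p: "a\<^sup>2 - x\<^sup>2 > 0" using D(3,4)[OF x] by (metis zero_less_power)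
      have dw: "(w has_real_derivative - x / w x) (at x)"
        unfolding w_def using p by (auto intro!: derivative_eq_intros simp: divide_simps)
      have dp: "((\<lambda>x. x ^ (2 * j + 1)) has_real_derivative real (2 * j + 1) * x ^ (2 * j)) (at x)"
        using DERIV_pow[of "2 * j + 1" x] by simp
      have d: "((\<lambda>x. - (x ^ (2 * j + 1) * w x)) has_real_derivative
         - (real (2 * j + 1) * x ^ (2 * j) * w x + - x / w x * x ^ (2 * j + 1))) (at x)"
        by (intro DERIV_minus DERIV_mult dp dw)
      have "- (real (2 * j + 1) * x ^ (2 * j) * w x + - x / w x * x ^ (2 * j + 1)) =
         x ^ (2 * j) * (x\<^sup>2 - real (2 * j + 1) * (w x)\<^sup>2) / w x"
        using D(3)[OF x] by (simp add: field_simps power2_eq_square)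
      also have "x\<^sup>2 - real (2 * j + 1) * (w x)\<^sup>2 = 2 * J * x\<^sup>2 - (2 * J - 1) * a\<^sup>2"
        unfolding D(4)[OF x] J_def by (simp add: algebra_simps)
      also have "x ^ (2 * j) * (2 * J * x\<^sup>2 - (2 * J - 1) * a\<^sup>2) / w x =
          2 * J * (x ^ (2 * Suc j) / w x) - (2 * J - 1) * a\<^sup>2 * (x ^ (2 * j) / w x)"
        by (simp add: algebra_simps diff_divide_distrib add_divide_distrib power2_eq_square)
      finally show "((\<lambda>x. - (x ^ (2 * j + 1) * w x)) has_vector_derivative
          2 * J * (x ^ (2 * Suc j) / w x) - (2 * J - 1) * a\<^sup>2 * (x ^ (2 * j) / w x)) (at x)"
        using d by (simp add: has_real_derivative_iff_has_vector_derivative)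
    qed (use a0 in simp)
    moreover have "w a = 0" by (simp add: w_def)
    ultimately have 1: "((\<lambda>x. 2 * J * (x ^ (2 * Suc j) / w x) - (2 * J - 1) * a\<^sup>2 * (x ^ (2 * j) / w x)) has_integral 0) {0..a}"
      by simp
    have "((\<lambda>x. (2 * J * (x ^ (2 * Suc j) / w x) - (2 * J - 1) * a\<^sup>2 * (x ^ (2 * j) / w x)) +
        (2 * J - 1) * a\<^sup>2 * (x ^ (2 * j) / w x)) has_integral
        0 + (2 * J - 1) * a\<^sup>2 * (pi / 2 * central j * (\<alpha> * (1 - \<alpha>)) ^ j)) {0..a}"
      by (rule has_integral_add[OF 1 has_integral_mult_right[OF Suc.IH]])
    then have "((\<lambda>x. 2 * J * (x ^ (2 * Suc j) / w x)) has_integral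
        (2 * J - 1) * a\<^sup>2 * (pi / 2 * central j * (\<alpha> * (1 - \<alpha>)) ^ j)) {0..a}" by simp
    from has_integral_divide[OF this, of "2 * J"]
    have 2: "((\<lambda>x. x ^ (2 * Suc j) / w x) has_integral
        (2 * J - 1) * a\<^sup>2 * (pi / 2 * central j * (\<alpha> * (1 - \<alpha>)) ^ j) / (2 * J)) {0..a}" using J by simp
    have "a\<^sup>2 = 4 * (\<alpha> * (1 - \<alpha>))" unfolding a2 c_def by (simp add: power2_eq_square algebra_simps)
    moreover have "J * central (Suc j) = 2 * (2 * J - 1) * central j" unfolding J_def central_Suc by simp
    then have "central (Suc j) = 2 * (2 * J - 1) * central j / J" using J by (simp add: field_simps)
    moreover have "(2 * J - 1) * (4 * b) * (pi / 2 * C * B) / (2 * J) = pi / 2 * (2 * (2 * J - 1) * C / J) * (b * B)" for b B C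
      using J by (simp add: field_simps)
    ultimately have "(2 * J - 1) * a\<^sup>2 * (pi / 2 * central j * (\<alpha> * (1 - \<alpha>)) ^ j) / (2 * J) =
        pi / 2 * central (Suc j) * (\<alpha> * (1 - \<alpha>)) ^ Suc j" unfolding power_Suc by presburger
    then show ?case using 2 by (simp only:)
  qed
  \<comment> \<open>Since \<open>x^2 / (1 - x^2) = 1 / (1 - x^2) - 1\<close>, raising
    \<open>j\<close> subtracts one arcsine moment, as in \<open>lim_moment\<close>. The start
    \<open>j = 0\<close> is the total drop \<open>\<rho> 0 - \<rho> a = 1/2\<close> of the density,
    the origin of the value \<open>lim_moment \<alpha> 0\<close>.\<close>
  have I: "((\<lambda>x. c / pi * (x ^ (2 * j) / ((1 - x\<^sup>2) * w x))) has_integral lim_moment \<alpha> j) {0..a}" for j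
  proof (induction j)
    case 0
    have "((\<lambda>x. c / pi / ((1 - x\<^sup>2) * w x)) has_integral (- \<rho> a - - \<rho> 0)) {0..a}"
    proof (rule fundamental_theorem_of_calculus_interior)
      show "continuous_on {0..a} (\<lambda>x. - \<rho> x)" by (intro continuous_intros c\<rho>)
      fix x assume x: "x \<in> {0<..<a}"
      show "((\<lambda>x. - \<rho> x) has_vector_derivative c / pi / ((1 - x\<^sup>2) * w x)) (at x)"
        using DERIV_minus[OF D(1)[OF x]] by (simp add: has_real_derivative_iff_has_vector_derivative)
    qed (use a0 in simp)
    then show ?case by (simp add: \<rho>a \<rho>0)
  next
    case (Suc j)
    have "((\<lambda>x. c / pi * (x ^ (2 * j) / ((1 - x\<^sup>2) * w x)) - c / pi * (x ^ (2 * j) / w x)) has_integral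
      lim_moment \<alpha> j - c / pi * (pi / 2 * central j * (\<alpha> * (1 - \<alpha>)) ^ j)) {0..a}"
      by (intro has_integral_diff Suc.IH has_integral_mult_right W)
    moreover have "lim_moment \<alpha> j - c / pi * (pi / 2 * central j * (\<alpha> * (1 - \<alpha>)) ^ j) = lim_moment \<alpha> (Suc j)"
      by (simp add: c_def lim_moment.simps(2))
    ultimately have "((\<lambda>x. c / pi * (x ^ (2 * j) / ((1 - x\<^sup>2) * w x)) - c / pi * (x ^ (2 * j) / w x)) has_integral
      lim_moment \<alpha> (Suc j)) {0..a}" by simp
    then show ?case
    proof (rule has_integral_spike_interior[of _ _ 0 a, unfolded box_real cbox_interval])
      fix x assume "x \<in> {0<..<a}"
      then have "1 - x\<^sup>2 > 0" by (rule xpos)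
      moreover have "x ^ (2 * Suc j) = x ^ (2 * j) * x\<^sup>2" by (simp add: power2_eq_square)
      ultimately show "c / pi * (x ^ (2 * Suc j) / ((1 - x\<^sup>2) * w x)) =
          c / pi * (x ^ (2 * j) / ((1 - x\<^sup>2) * w x)) - c / pi * (x ^ (2 * j) / w x)"
        by (simp add: divide_simps) (simp add: algebra_simps)
    qed
  qed
  define M where "M = 2 * m + 2"
  \<comment> \<open>integration by parts, twice\<close>
  have "((\<lambda>x. lim_tail \<alpha> x * (real M * real (M - 1) * x ^ (M - 2)) - c / pi * (x ^ M / ((1 - x\<^sup>2) * w x))) has_integral
     (lim_tail \<alpha> a * (real M * a ^ (M - 1)) + \<rho> a * a ^ M) - (lim_tail \<alpha> 0 * (real M * 0 ^ (M - 1)) + \<rho> 0 * 0 ^ M)) {0..a}"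
  proof (rule fundamental_theorem_of_calculus_interior)
    show "continuous_on {0..a} (\<lambda>x. lim_tail \<alpha> x * (real M * x ^ (M - 1)) + \<rho> x * x ^ M)"
      by (intro continuous_intros cF c\<rho>)
    fix x assume x: "x \<in> {0<..<a}"
    have d1: "((\<lambda>x. real M * x ^ (M - 1)) has_real_derivative real M * (real (M - 1) * x ^ (M - 2))) (at x)"
      using DERIV_cmult[OF DERIV_pow[of "M - 1" x], of "real M"] by (simp add: M_def)
    have d2: "((\<lambda>x. x ^ M) has_real_derivative real M * x ^ (M - 1)) (at x)"
      using DERIV_pow[of M x] by simp
    have "((\<lambda>x. lim_tail \<alpha> x * (real M * x ^ (M - 1)) + \<rho> x * x ^ M) has_real_derivative
       (- \<rho> x * (real M * x ^ (M - 1)) + real M * (real (M - 1) * x ^ (M - 2)) * lim_tail \<alpha> x) +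
       (- (c / pi) / ((1 - x\<^sup>2) * w x) * x ^ M + real M * x ^ (M - 1) * \<rho> x)) (at x)"
      by (intro DERIV_add DERIV_mult d1 d2 D(1)[OF x] D(2)[OF x])
    moreover have "(- \<rho> x * (real M * x ^ (M - 1)) + real M * (real (M - 1) * x ^ (M - 2)) * lim_tail \<alpha> x) +
       (- (c / pi) / ((1 - x\<^sup>2) * w x) * x ^ M + real M * x ^ (M - 1) * \<rho> x) =
       lim_tail \<alpha> x * (real M * real (M - 1) * x ^ (M - 2)) - c / pi * (x ^ M / ((1 - x\<^sup>2) * w x))"
    proof -
      have "(- r * (u * y) + u * (v * z) * f) + (- k / q * p + u * y * r) = f * (u * v * z) - k * (p / q)"
        for r u v y z f k q p :: real by simp
      then show ?thesis .
    qed
    ultimately have "((\<lambda>x. lim_tail \<alpha> x * (real M * x ^ (M - 1)) + \<rho> x * x ^ M) has_real_derivative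
       lim_tail \<alpha> x * (real M * real (M - 1) * x ^ (M - 2)) - c / pi * (x ^ M / ((1 - x\<^sup>2) * w x))) (at x)"
      by (rule DERIV_cong)
    then show "((\<lambda>x. lim_tail \<alpha> x * (real M * x ^ (M - 1)) + \<rho> x * x ^ M) has_vector_derivative
       lim_tail \<alpha> x * (real M * real (M - 1) * x ^ (M - 2)) - c / pi * (x ^ M / ((1 - x\<^sup>2) * w x))) (at x)"
      by (rule has_real_derivative_iff_has_vector_derivative[THEN iffD1])
  qed (use a0 in simp)
  moreover have "lim_tail \<alpha> a = 0" using lim_tail_beyond[of \<alpha> a] \<alpha> a1 by (simp add: a_def)
  moreover have "(0::real) ^ (M - 1) = 0" "(0::real) ^ M = 0" by (simp_all add: M_def)
  ultimately have 1: "((\<lambda>x. lim_tail \<alpha> x * (real M * real (M - 1) * x ^ (M - 2)) - c / pi * (x ^ M / ((1 - x\<^sup>2) * w x))) has_integral 0) {0..a}"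
    by (simp only: \<rho>a mult_zero_left mult_zero_right add_0 diff_zero)
  have e: "M = 2 * Suc m" "M - 2 = 2 * m" "M - 1 = 2 * m + 1" by (simp_all add: M_def)
  have "((\<lambda>x. (lim_tail \<alpha> x * (real M * real (M - 1) * x ^ (M - 2)) - c / pi * (x ^ M / ((1 - x\<^sup>2) * w x))) +
      c / pi * (x ^ M / ((1 - x\<^sup>2) * w x))) has_integral 0 + lim_moment \<alpha> (Suc m)) {0..a}"
    using has_integral_add[OF 1 I[of "Suc m"]] unfolding e(1) .
  then have "((\<lambda>x. lim_tail \<alpha> x * (real M * real (M - 1) * x ^ (M - 2))) has_integral lim_moment \<alpha> (Suc m)) {0..a}"
    by simp
  then have A: "((\<lambda>x. lim_tail \<alpha> x * (real (2 * m + 2) * real (2 * m + 1) * x ^ (2 * m))) has_integral lim_moment \<alpha> (Suc m)) {0..a}"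
    unfolding e(2,3) by (simp only: M_def)
  have B: "((\<lambda>x. lim_tail \<alpha> x * (real (2 * m + 2) * real (2 * m + 1) * x ^ (2 * m))) has_integral 0) {a..1}"
    by (rule has_integral_eq[OF _ has_integral_0])
      (use lim_tail_beyond[of \<alpha>] \<alpha> in \<open>auto simp: a_def\<close>)
  have "0 \<le> a" "a \<le> 1" using a0 a1 by auto
  from has_integral_combine[OF this A B] show ?thesis by simp
qed

text \<open>The full profile \<open>1 - x\<close> has all these moments equal to 1, and both
  \<open>lim_tail\<close> and \<open>lim_moment\<close> turn into their complements under the flip
  of time.\<close>

theorem lim_tail_moment:
  assumes \<alpha>: "0 < \<alpha>" "\<alpha> < 1"
  shows "((\<lambda>x. lim_tail \<alpha> x * (real (2 * m + 2) * real (2 * m + 1) * x ^ (2 * m))) has_integral lim_moment \<alpha> (Suc m)) {0..1}"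
proof -
  let ?f = "\<lambda>x::real. real (2 * m + 2) * real (2 * m + 1) * x ^ (2 * m)"
  have full: "((\<lambda>x. (1 - x) * ?f x) has_integral 1) {0..1}"
  proof -
    let ?F = "\<lambda>x::real. real (2 * m + 2) * x ^ (2 * m + 1) - real (2 * m + 1) * x ^ (2 * m + 2)"
    have "((\<lambda>x. (1 - x) * ?f x) has_integral ?F 1 - ?F 0) {0..1}"
    proof (rule fundamental_theorem_of_calculus)
      fix x :: real
      have 1: "((\<lambda>x. x ^ (2 * m + 1)) has_real_derivative real (2 * m + 1) * x ^ (2 * m)) (at x within {0..1})"
        by (rule has_field_derivative_at_within) (use DERIV_pow[of "2 * m + 1" x] in simp)
      have 2: "((\<lambda>x. x ^ (2 * m + 2)) has_real_derivative real (2 * m + 2) * x ^ (2 * m + 1)) (at x within {0..1})"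
        by (rule has_field_derivative_at_within) (use DERIV_pow[of "2 * m + 2" x] in simp)
      have "(?F has_real_derivative real (2 * m + 2) * (real (2 * m + 1) * x ^ (2 * m)) -
          real (2 * m + 1) * (real (2 * m + 2) * x ^ (2 * m + 1))) (at x within {0..1})"
        by (intro DERIV_diff DERIV_cmult 1 2)
      moreover have "real (2 * m + 2) * (real (2 * m + 1) * x ^ (2 * m)) -
          real (2 * m + 1) * (real (2 * m + 2) * x ^ (2 * m + 1)) = (1 - x) * ?f x"
      proof -
        have "A * (B * p) - B * (A * (x * p)) = (1 - x) * (A * B * p)" for A B p :: real
          by (simp add: algebra_simps)
        moreover have "x ^ (2 * m + 1) = x * x ^ (2 * m)" by simp
        ultimately show ?thesis by presburger
      qed
      ultimately have "(?F has_real_derivative (1 - x) * ?f x) (at x within {0..1})" by (rule DERIV_cong)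
      then show "(?F has_vector_derivative (1 - x) * ?f x) (at x within {0..1})"
        by (rule has_real_derivative_iff_has_vector_derivative[THEN iffD1])
    qed simp
    then show ?thesis by simp
  qed
  consider "\<alpha> < 1/2" | "\<alpha> = 1/2" | "\<alpha> > 1/2" by linarith
  then show ?thesis
  proof cases
    case 1
    then show ?thesis using lim_tail_moment_low \<alpha> by blast
  next
    case 2
    have "lim_moment (1/2) (Suc m) = 1/2" by (induction m) (auto simp: lim_moment.simps)
    moreover have "((\<lambda>x. lim_tail (1/2) x * ?f x) has_integral 1/2) {0..1}"
      by (rule has_integral_eq[OF _ has_integral_divide[OF full, of 2]]) (simp add: lim_tail_half)
    ultimately show ?thesis unfolding 2 by (simp only:)
  next
    case 3
    have "((\<lambda>x. (1 - x) * ?f x - lim_tail (1 - \<alpha>) x * ?f x) has_integral 1 - lim_moment (1 - \<alpha>) (Suc m)) {0..1}"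
      using 3 \<alpha> by (intro has_integral_diff full lim_tail_moment_low) auto
    moreover have "(1 - x) * ?f x - lim_tail (1 - \<alpha>) x * ?f x = lim_tail \<alpha> x * ?f x" for x
      unfolding lim_tail_flip by (simp add: left_diff_distrib)
    moreover have "1 - lim_moment (1 - \<alpha>) (Suc m) = lim_moment \<alpha> (Suc m)" unfolding lim_moment_flip by simp
    ultimately show ?thesis by simp
  qed
qed

section \<open>Mean square concentration of the moments\<close>

lemma R132_eq_words_to: "R132 n = words_to {1..n-1}"
  by (simp add: R132_eq words_to_def)

lemma R132_length: "w \<in> R132 n \<Longrightarrow> length w = n choose 2"
  by (simp add: R132_def sorting_network_def)

lemma R132_state:
  assumes "w \<in> R132 n" "k \<le> n choose 2"
  shows "valid {} (take k w)" "shape (take k w) \<subseteq> {1..n-1}" "\<Sum>(shape (take k w)) = k"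
  using R132_valid_take[OF assms] shape_props(3)[of "take k w"] R132_length[OF assms(1)] assms(2) by auto

lemma finite_R132: "finite (R132 n)"
  unfolding R132_eq_words_to by (rule finite_words_to)

definition moment_error :: "nat \<Rightarrow> nat \<Rightarrow> nat \<Rightarrow> nat list \<Rightarrow> real" where
  "moment_error n j k w = emp_moment n (shape (take k w)) j - lim_moment (real k / real (n choose 2)) j"

lemma moment_error_final:
  assumes "n \<ge> 2" "w \<in> R132 n"
  shows "(moment_error n (Suc j) (n choose 2) w)\<^sup>2 \<le> (real j + 2)\<^sup>2 / real n"
proof -
  have "take (n choose 2) w = w" using R132_length[OF assms(2)] by simp
  moreover have "shape w = {1..n-1}" using assms(2) by (simp add: R132_eq)
  moreover have "0 < (real n)\<^sup>2 / 4" using assms(1) by simp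
  then have "real (n choose 2) > 0" using choose_two_ge[OF assms(1)] by linarith
  ultimately have "moment_error n (Suc j) (n choose 2) w = emp_moment n {1..n-1} (Suc j) - 1"
    by (simp add: moment_error_def lim_moment_at_1)
  moreover have "\<bar>emp_moment n {1..n-1} (Suc j) - 1\<bar> \<le> (real (Suc j) + 1) / real n"
    using assms by (intro emp_moment_full_error) auto
  ultimately have "\<bar>moment_error n (Suc j) (n choose 2) w\<bar>\<^sup>2 \<le> ((real j + 2) / real n)\<^sup>2"
    by (intro power_mono) (auto simp: add.commute)
  also have "\<dots> = (real j + 2)\<^sup>2 / real n * (1 / real n)" by (simp add: power2_eq_square)
  also have "\<dots> \<le> (real j + 2)\<^sup>2 / real n * 1" using assms by (intro mult_left_mono) auto
  finally show ?thesis by simp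
qed

text \<open>Strong induction on \<open>j\<close>, because a step for one moment is perturbed by all
  lower ones. The bound \<open>\<kappa> n^2 \<le> k\<close> tames the factor \<open>1 / k\<close>;
  each of the at most \<open>n^2\<close> backward steps then adds order \<open>1 / n^3\<close>, a
  total of order \<open>1 / n\<close>.\<close>

theorem moment_concentration:
  "\<forall>\<kappa>>0. \<exists>C\<ge>0. \<forall>n\<ge>2. \<forall>k. \<kappa> * (real n)\<^sup>2 \<le> real k \<longrightarrow> k \<le> n choose 2 \<longrightarrow>
     (\<Sum>w\<in>R132 n. (moment_error n (Suc j) k w)\<^sup>2) \<le> C / real n * real (card (R132 n))"
proof (induction j rule: less_induct)
  case (less j)
  show ?case
  proof (intro allI impI)
    fix \<kappa> :: real assume \<kappa>: "\<kappa> > 0"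
    have "\<forall>i\<in>{..<j}. \<exists>C\<ge>0. \<forall>n\<ge>2. \<forall>k. \<kappa> * (real n)\<^sup>2 \<le> real k \<longrightarrow> k \<le> n choose 2 \<longrightarrow>
      (\<Sum>w\<in>R132 n. (moment_error n (Suc i) k w)\<^sup>2) \<le> C / real n * real (card (R132 n))"
      using less.IH \<kappa> by blast
    then obtain c where c: "\<And>i n k. i < j \<Longrightarrow> n \<ge> 2 \<Longrightarrow> \<kappa> * (real n)\<^sup>2 \<le> real k \<Longrightarrow> k \<le> n choose 2 \<Longrightarrow>
      (\<Sum>w\<in>R132 n. (moment_error n (Suc i) k w)\<^sup>2) \<le> c i / real n * real (card (R132 n))"
      and c0: "\<And>i. i < j \<Longrightarrow> c i \<ge> 0"
      unfolding bchoice_iff by (metis lessThan_iff)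
    define C1 where "C1 = (\<Sum>i<j. c i)"
    have C1: "C1 \<ge> 0" unfolding C1_def by (intro sum_nonneg) (auto intro: c0)
    obtain C where C: "C \<ge> 0" and step:
      "\<And>n S k. n \<ge> 2 \<Longrightarrow> S \<subseteq> {1..n-1} \<Longrightarrow> \<Sum>S = k \<Longrightarrow> k \<ge> 1 \<Longrightarrow> k \<le> n choose 2 \<Longrightarrow>
      (\<Sum>s\<in>S. down_weight S s *
         (emp_moment n (pull S s) (Suc j) - lim_moment (real (k - 1) / real (n choose 2)) (Suc j))\<^sup>2)
      \<le> (emp_moment n S (Suc j) - lim_moment (real k / real (n choose 2)) (Suc j))\<^sup>2 +
        C / real k * (\<Sum>i\<in>{1..j}. (emp_moment n S i - lim_moment (real k / real (n choose 2)) i)\<^sup>2) + C / real n ^ 3"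
      by (rule moment_error_step[of j]) (erule that, blast)
    define B where "B = C * C1 / \<kappa> + C"
    have B: "B \<ge> 0" using C C1 \<kappa> by (simp add: B_def)
    show "\<exists>C\<ge>0. \<forall>n\<ge>2. \<forall>k. \<kappa> * (real n)\<^sup>2 \<le> real k \<longrightarrow> k \<le> n choose 2 \<longrightarrow>
     (\<Sum>w\<in>R132 n. (moment_error n (Suc j) k w)\<^sup>2) \<le> C / real n * real (card (R132 n))"
    proof (intro exI[of _ "(real j + 2)\<^sup>2 + B"] conjI allI impI)
      show "(real j + 2)\<^sup>2 + B \<ge> 0" using B by simp
      fix n k assume n: "n \<ge> 2" and k: "\<kappa> * (real n)\<^sup>2 \<le> real k" "k \<le> n choose 2"
      let ?N = "n choose 2"
      define cd where "cd = real (card (R132 n))"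
      define Z where "Z = (\<lambda>k. \<Sum>w\<in>R132 n. (moment_error n (Suc j) k w)\<^sup>2)"
      have cd0: "cd \<ge> 0" by (simp add: cd_def)
      have np: "real n > 0" using n by simp
      \<comment> \<open>The lower moments at time \<open>l\<close> contribute \<open>C / l\<close>
        times \<open>C1 / n\<close>, which is of order \<open>1 / n^3\<close> since \<open>l\<close>
        is at least \<open>\<kappa> n^2\<close>. This matches the intrinsic error of the
        step.\<close>
      have prev_le: "Z (l - 1) \<le> Z l + B / real n ^ 3 * cd" if l: "\<kappa> * (real n)\<^sup>2 \<le> real l" "l \<le> ?N" "l \<ge> 1" for l
      proof -
        let ?\<Phi> = "\<lambda>S. (emp_moment n S (Suc j) - lim_moment (real (l - 1) / real ?N) (Suc j))\<^sup>2"
        have "Z (l - 1) = (\<Sum>w\<in>words_to {1..n-1}. ?\<Phi> (shape (take (l - 1) w)))"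
          by (simp add: Z_def moment_error_def R132_eq_words_to)
        also have "\<dots> = (\<Sum>w\<in>R132 n. \<Sum>s\<in>shape (take l w).
             down_weight (shape (take l w)) s * ?\<Phi> (pull (shape (take l w)) s))"
          unfolding R132_eq_words_to using l sum_upto_choose[of n] by (intro sum_words_to_step) auto
        also have "\<dots> \<le> (\<Sum>w\<in>R132 n. (moment_error n (Suc j) l w)\<^sup>2 +
            C / real l * (\<Sum>i\<in>{1..j}. (moment_error n i l w)\<^sup>2) + C / real n ^ 3)"
        proof (rule sum_mono)
          fix w assume w: "w \<in> R132 n"
          show "(\<Sum>s\<in>shape (take l w). down_weight (shape (take l w)) s * ?\<Phi> (pull (shape (take l w)) s))
             \<le> (moment_error n (Suc j) l w)\<^sup>2 + C / real l * (\<Sum>i\<in>{1..j}. (moment_error n i l w)\<^sup>2) + C / real n ^ 3"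
            unfolding moment_error_def
            by (rule step[OF n R132_state(2)[OF w l(2)] R132_state(3)[OF w l(2)] l(3,2)])
        qed
        also have "\<dots> = Z l + C / real l * (\<Sum>w\<in>R132 n. \<Sum>i\<in>{1..j}. (moment_error n i l w)\<^sup>2) + cd * (C / real n ^ 3)"
          unfolding Z_def cd_def by (simp only: sum.distrib sum_distrib_left sum_constant)
        finally have c1: "Z (l - 1) \<le> Z l + C / real l * (\<Sum>w\<in>R132 n. \<Sum>i\<in>{1..j}. (moment_error n i l w)\<^sup>2) + cd * (C / real n ^ 3)" .
        have c2: "(\<Sum>w\<in>R132 n. \<Sum>i\<in>{1..j}. (moment_error n i l w)\<^sup>2) =
            (\<Sum>i<j. \<Sum>w\<in>R132 n. (moment_error n (Suc i) l w)\<^sup>2)"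
          by (subst sum.swap) (simp only: sum.atLeast1_atMost_eq One_nat_def)
        have "C / real l * (\<Sum>i<j. \<Sum>w\<in>R132 n. (moment_error n (Suc i) l w)\<^sup>2) \<le>
            C / (\<kappa> * (real n)\<^sup>2) * (C1 / real n * cd)"
        proof (rule mult_mono)
          show "C / real l \<le> C / (\<kappa> * (real n)\<^sup>2)" using l C \<kappa> np by (intro divide_left_mono) auto
          have "(\<Sum>i<j. \<Sum>w\<in>R132 n. (moment_error n (Suc i) l w)\<^sup>2) \<le> (\<Sum>i<j. c i / real n * cd)"
            unfolding cd_def using c n l by (intro sum_mono) auto
          also have "\<dots> = C1 / real n * cd" by (simp add: C1_def sum_divide_distrib sum_distrib_right)
          finally show "(\<Sum>i<j. \<Sum>w\<in>R132 n. (moment_error n (Suc i) l w)\<^sup>2) \<le> C1 / real n * cd" .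
        qed (use C \<kappa> in \<open>auto intro!: sum_nonneg\<close>)
        also have "C / (\<kappa> * (real n)\<^sup>2) * (C1 / real n * cd) = (C * C1 / \<kappa>) / real n ^ 3 * cd"
          by (simp add: power2_eq_square power3_eq_cube)
        finally have "Z (l - 1) \<le> Z l + (C * C1 / \<kappa>) / real n ^ 3 * cd + cd * (C / real n ^ 3)"
          using c1 unfolding c2 by linarith
        moreover have "B / real n ^ 3 * cd = (C * C1 / \<kappa>) / real n ^ 3 * cd + cd * (C / real n ^ 3)"
          by (simp only: B_def add_divide_distrib distrib_right mult.commute[of cd])
        ultimately show ?thesis by linarith
      qed
      have iter: "Z (?N - m) \<le> ((real j + 2)\<^sup>2 / real n + real m * (B / real n ^ 3)) * cd"
        if "m \<le> ?N" "\<kappa> * (real n)\<^sup>2 \<le> real (?N - m)" for m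
        using that
      proof (induction m)
        case 0
        have "Z ?N \<le> (\<Sum>w\<in>R132 n. (real j + 2)\<^sup>2 / real n)"
          unfolding Z_def using moment_error_final[OF n] by (intro sum_mono) auto
        then show ?case by (simp add: cd_def mult.commute)
      next
        case (Suc m)
        have le: "\<kappa> * (real n)\<^sup>2 \<le> real (?N - m)"
        proof -
          have "real (?N - Suc m) \<le> real (?N - m)" by (intro of_nat_mono) simp
          then show ?thesis using Suc.prems(2) by linarith
        qed
        have e: "?N - Suc m = (?N - m) - 1" by simp
        have "Z (?N - Suc m) \<le> Z (?N - m) + B / real n ^ 3 * cd"
          unfolding e using Suc.prems le by (intro prev_le) auto
        also have "Z (?N - m) \<le> ((real j + 2)\<^sup>2 / real n + real m * (B / real n ^ 3)) * cd"
          using Suc.prems le by (intro Suc.IH) auto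
        finally have "Z (?N - Suc m) \<le> ((real j + 2)\<^sup>2 / real n + real m * (B / real n ^ 3)) * cd + B / real n ^ 3 * cd"
          by simp
        moreover have eq: "(x + real (Suc m) * y) * cd = (x + real m * y) * cd + y * cd" for x y
          by (simp add: algebra_simps)
        ultimately show ?case unfolding eq by (simp only:)
      qed
      have "Z k \<le> ((real j + 2)\<^sup>2 / real n + real (?N - k) * (B / real n ^ 3)) * cd"
        using iter[of "?N - k"] k by simp
      also have "\<dots> \<le> ((real j + 2)\<^sup>2 / real n + (real n)\<^sup>2 * (B / real n ^ 3)) * cd"
      proof -
        have "real (?N - k) \<le> (real n)\<^sup>2" using choose_two_le[of n] by linarith
        then show ?thesis using B cd0 by (intro mult_right_mono add_left_mono) auto
      qed
      also have "(real n)\<^sup>2 * (B / real n ^ 3) = B / real n" using np by (simp add: power2_eq_square power3_eq_cube)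
      finally show "(\<Sum>w\<in>R132 n. (moment_error n (Suc j) k w)\<^sup>2) \<le> ((real j + 2)\<^sup>2 + B) / real n * real (card (R132 n))"
        by (simp add: Z_def cd_def add_divide_distrib)
    qed
  qed
qed

subsection \<open>Events of probability tending to one\<close>

definition whp :: "(nat \<Rightarrow> nat list \<Rightarrow> bool) \<Rightarrow> bool" where
  "whp P \<longleftrightarrow> (\<lambda>n. real (card {w \<in> R132 n. \<not> P n w}) / real (card (R132 n))) \<longlonglongrightarrow> 0"

lemma whp_mono:
  assumes "whp P" "\<forall>\<^sub>F n in sequentially. \<forall>w\<in>R132 n. P n w \<longrightarrow> Q n w"
  shows "whp Q"
  unfolding whp_def
proof (rule tendsto_sandwich[OF _ _ tendsto_const assms(1)[unfolded whp_def]])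
  show "\<forall>\<^sub>F n in sequentially. real (card {w \<in> R132 n. \<not> Q n w}) / real (card (R132 n)) \<le>
      real (card {w \<in> R132 n. \<not> P n w}) / real (card (R132 n))"
    using assms(2)
  proof (rule eventually_mono)
    fix n assume "\<forall>w\<in>R132 n. P n w \<longrightarrow> Q n w"
    then have "card {w \<in> R132 n. \<not> Q n w} \<le> card {w \<in> R132 n. \<not> P n w}"
      using finite_R132 by (intro card_mono) auto
    then show "real (card {w \<in> R132 n. \<not> Q n w}) / real (card (R132 n)) \<le>
      real (card {w \<in> R132 n. \<not> P n w}) / real (card (R132 n))" by (intro divide_right_mono) auto
  qed
qed (intro always_eventually allI divide_nonneg_nonneg of_nat_0_le_iff)

lemma whp_True: "whp (\<lambda>n w. True)"
  by (simp add: whp_def)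

lemma whp_eventually: "\<forall>\<^sub>F n in sequentially. \<forall>w\<in>R132 n. Q n w \<Longrightarrow> whp Q"
  by (rule whp_mono[OF whp_True]) simp

lemma whp_conj:
  assumes "whp P" "whp Q"
  shows "whp (\<lambda>n w. P n w \<and> Q n w)"
  unfolding whp_def
proof (rule tendsto_sandwich[OF _ _ tendsto_const])
  show "(\<lambda>n. real (card {w \<in> R132 n. \<not> P n w}) / real (card (R132 n)) +
      real (card {w \<in> R132 n. \<not> Q n w}) / real (card (R132 n))) \<longlonglongrightarrow> 0"
    using tendsto_add[OF assms(1)[unfolded whp_def] assms(2)[unfolded whp_def]] by simp
  show "\<forall>\<^sub>F n in sequentially. real (card {w \<in> R132 n. \<not> (P n w \<and> Q n w)}) / real (card (R132 n)) \<le>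
     real (card {w \<in> R132 n. \<not> P n w}) / real (card (R132 n)) + real (card {w \<in> R132 n. \<not> Q n w}) / real (card (R132 n))"
  proof (rule always_eventually, rule allI)
    fix n
    have "{w \<in> R132 n. \<not> (P n w \<and> Q n w)} = {w \<in> R132 n. \<not> P n w} \<union> {w \<in> R132 n. \<not> Q n w}" by auto
    then have "card {w \<in> R132 n. \<not> (P n w \<and> Q n w)} \<le> card {w \<in> R132 n. \<not> P n w} + card {w \<in> R132 n. \<not> Q n w}"
      by (simp only: card_Un_le)
    then have "real (card {w \<in> R132 n. \<not> (P n w \<and> Q n w)}) \<le>
        real (card {w \<in> R132 n. \<not> P n w}) + real (card {w \<in> R132 n. \<not> Q n w})"
      by (simp only: of_nat_add[symmetric] of_nat_le_iff)
    then show "real (card {w \<in> R132 n. \<not> (P n w \<and> Q n w)}) / real (card (R132 n)) \<le>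
     real (card {w \<in> R132 n. \<not> P n w}) / real (card (R132 n)) + real (card {w \<in> R132 n. \<not> Q n w}) / real (card (R132 n))"
      unfolding add_divide_distrib[symmetric] by (intro divide_right_mono) auto
  qed
qed (intro always_eventually allI divide_nonneg_nonneg of_nat_0_le_iff)

lemma whp_ball:
  assumes "finite I" "\<And>i. i \<in> I \<Longrightarrow> whp (P i)"
  shows "whp (\<lambda>n w. \<forall>i\<in>I. P i n w)"
  using assms
proof (induction I rule: finite_induct)
  case empty
  then show ?case by (simp add: whp_True)
next
  case (insert i I)
  then have "whp (\<lambda>n w. P i n w \<and> (\<forall>i\<in>I. P i n w))" by (intro whp_conj) auto
  then show ?case by simp
qed

lemma whp_chebyshev:
  assumes "\<eta> > 0" "\<forall>\<^sub>F n in sequentially. (\<Sum>w\<in>R132 n. (X n w)\<^sup>2) \<le> C / real n * real (card (R132 n))"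
  shows "whp (\<lambda>n w. \<bar>X n w\<bar> \<le> \<eta>)"
  unfolding whp_def
proof (rule tendsto_sandwich[OF _ _ tendsto_const])
  show "(\<lambda>n. (\<bar>C\<bar> / \<eta>\<^sup>2) * (1 / real n)) \<longlonglongrightarrow> 0"
    using tendsto_mult_right_zero[OF lim_1_over_n, of "\<bar>C\<bar> / \<eta>\<^sup>2"] by simp
  show "\<forall>\<^sub>F n in sequentially. real (card {w \<in> R132 n. \<not> \<bar>X n w\<bar> \<le> \<eta>}) / real (card (R132 n)) \<le> (\<bar>C\<bar> / \<eta>\<^sup>2) * (1 / real n)"
    using assms(2)
  proof (rule eventually_mono)
    fix n assume a: "(\<Sum>w\<in>R132 n. (X n w)\<^sup>2) \<le> C / real n * real (card (R132 n))"
    let ?B = "{w \<in> R132 n. \<not> \<bar>X n w\<bar> \<le> \<eta>}"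
    have "real (card ?B) * \<eta>\<^sup>2 = (\<Sum>w\<in>?B. \<eta>\<^sup>2)" by simp
    also have "\<dots> \<le> (\<Sum>w\<in>?B. (X n w)\<^sup>2)"
    proof (rule sum_mono)
      fix w assume "w \<in> ?B"
      then have "\<eta>\<^sup>2 \<le> \<bar>X n w\<bar>\<^sup>2" using assms(1) by (intro power_mono) auto
      then show "\<eta>\<^sup>2 \<le> (X n w)\<^sup>2" by simp
    qed
    also have "\<dots> \<le> (\<Sum>w\<in>R132 n. (X n w)\<^sup>2)" using finite_R132 by (intro sum_mono2) auto
    also have "\<dots> \<le> C / real n * real (card (R132 n))" by (rule a)
    also have "\<dots> \<le> \<bar>C\<bar> / real n * real (card (R132 n))" by (intro mult_right_mono divide_right_mono) auto
    finally have b: "real (card ?B) * \<eta>\<^sup>2 \<le> \<bar>C\<bar> / real n * real (card (R132 n))" .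
    show "real (card ?B) / real (card (R132 n)) \<le> (\<bar>C\<bar> / \<eta>\<^sup>2) * (1 / real n)"
    proof (cases "card (R132 n) = 0")
      case False
      then have p: "real (card (R132 n)) > 0" "\<eta>\<^sup>2 > 0" using assms(1) by auto
      have "real (card ?B) / real (card (R132 n)) = real (card ?B) * \<eta>\<^sup>2 / (\<eta>\<^sup>2 * real (card (R132 n)))"
        using p by simp
      also have "\<dots> \<le> \<bar>C\<bar> / real n * real (card (R132 n)) / (\<eta>\<^sup>2 * real (card (R132 n)))"
        using b p by (intro divide_right_mono) auto
      also have "\<dots> = (\<bar>C\<bar> / \<eta>\<^sup>2) * (1 / real n)" using p by simp
      finally show ?thesis .
    qed simp
  qed
qed (intro always_eventually allI divide_nonneg_nonneg of_nat_0_le_iff)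

definition time_step :: "real \<Rightarrow> nat \<Rightarrow> nat" where
  "time_step \<alpha> n = nat \<lfloor>\<alpha> * real (n choose 2)\<rfloor>"

lemma time_step_bounds:
  assumes "0 \<le> \<alpha>"
  shows "real (time_step \<alpha> n) \<le> \<alpha> * real (n choose 2)" "\<alpha> * real (n choose 2) - 1 < real (time_step \<alpha> n)"
proof -
  have "0 \<le> \<alpha> * real (n choose 2)" using assms by simp
  then have "real (time_step \<alpha> n) = of_int \<lfloor>\<alpha> * real (n choose 2)\<rfloor>" by (simp add: time_step_def)
  then show "real (time_step \<alpha> n) \<le> \<alpha> * real (n choose 2)" "\<alpha> * real (n choose 2) - 1 < real (time_step \<alpha> n)"
    by linarith+
qed

lemma time_step_le:
  assumes "0 \<le> \<alpha>" "\<alpha> \<le> 1"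
  shows "time_step \<alpha> n \<le> n choose 2"
proof -
  have "\<alpha> * real (n choose 2) \<le> 1 * real (n choose 2)" using assms by (intro mult_right_mono) auto
  then show ?thesis using time_step_bounds(1)[OF assms(1), of n] by linarith
qed

lemma filterlim_choose_two: "filterlim (\<lambda>n. real (n choose 2)) at_top sequentially"
proof (rule filterlim_at_top_mono)
  have "filterlim (\<lambda>n. (real n)\<^sup>2) at_top sequentially"
    by (rule filterlim_pow_at_top[OF _ filterlim_real_sequentially]) simp
  then have "filterlim (\<lambda>n. (1/4) * (real n)\<^sup>2) at_top sequentially"
    by (intro filterlim_tendsto_pos_mult_at_top[OF tendsto_const]) auto
  then show "filterlim (\<lambda>n. (real n)\<^sup>2 / 4) at_top sequentially" by simp
  show "\<forall>\<^sub>F n in sequentially. (real n)\<^sup>2 / 4 \<le> real (n choose 2)"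
    using eventually_ge_at_top[of 2] by (rule eventually_mono) (rule choose_two_ge)
qed

lemma time_step_tendsto:
  assumes "0 \<le> \<alpha>"
  shows "(\<lambda>n. real (time_step \<alpha> n) / real (n choose 2)) \<longlonglongrightarrow> \<alpha>"
proof (rule tendsto_sandwich[of "\<lambda>n. \<alpha> - 1 / real (n choose 2)" _ _ "\<lambda>_. \<alpha>"])
  have "(\<lambda>n. 1 / real (n choose 2)) \<longlonglongrightarrow> 0"
    by (rule tendsto_divide_0[OF tendsto_const filterlim_at_top_imp_at_infinity[OF filterlim_choose_two]])
  from tendsto_diff[OF tendsto_const this, of \<alpha>] show "(\<lambda>n. \<alpha> - 1 / real (n choose 2)) \<longlonglongrightarrow> \<alpha>" by simp
  have pos: "\<forall>\<^sub>F n in sequentially. real (n choose 2) > 0"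
    using filterlim_choose_two by (rule filterlim_at_top_dense[THEN iffD1, rule_format])
  show "\<forall>\<^sub>F n in sequentially. \<alpha> - 1 / real (n choose 2) \<le> real (time_step \<alpha> n) / real (n choose 2)"
    using pos
  proof (rule eventually_mono)
    fix n assume p: "real (n choose 2) > 0"
    have "(\<alpha> * real (n choose 2) - 1) / real (n choose 2) \<le> real (time_step \<alpha> n) / real (n choose 2)"
      using time_step_bounds(2)[OF assms, of n] p by (intro divide_right_mono) auto
    then show "\<alpha> - 1 / real (n choose 2) \<le> real (time_step \<alpha> n) / real (n choose 2)"
      using p by (simp add: diff_divide_distrib)
  qed
  show "\<forall>\<^sub>F n in sequentially. real (time_step \<alpha> n) / real (n choose 2) \<le> \<alpha>"
    using pos
  proof (rule eventually_mono)
    fix n assume p: "real (n choose 2) > 0"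
    then show "real (time_step \<alpha> n) / real (n choose 2) \<le> \<alpha>"
      using time_step_bounds(1)[OF assms, of n] by (simp add: divide_le_eq)
  qed
qed (rule tendsto_const)

lemma whp_moment:
  assumes \<alpha>: "0 < \<alpha>" "\<alpha> < 1" and \<eta>: "\<eta> > 0"
  shows "whp (\<lambda>n w. \<bar>emp_moment n (shape (take (time_step \<alpha> n) w)) (Suc j) - lim_moment \<alpha> (Suc j)\<bar> \<le> \<eta>)"
proof -
  \<comment> \<open>The constant \<open>\<alpha> / 8\<close> leaves room for rounding:
    \<open>n choose 2\<close> is at least \<open>n^2 / 4\<close>, and the floor loses at most 1,
    which is eventually below \<open>\<alpha> n^2 / 8\<close>.\<close>
  obtain C where C: "\<And>n k. n \<ge> 2 \<Longrightarrow> \<alpha> / 8 * (real n)\<^sup>2 \<le> real k \<Longrightarrow> k \<le> n choose 2 \<Longrightarrow>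
     (\<Sum>w\<in>R132 n. (moment_error n (Suc j) k w)\<^sup>2) \<le> C / real n * real (card (R132 n))"
    using moment_concentration[of j, rule_format, of "\<alpha> / 8"] \<alpha> by auto
  have late: "\<forall>\<^sub>F n in sequentially. \<alpha> / 8 * (real n)\<^sup>2 \<le> real (time_step \<alpha> n)"
  proof -
    have "\<forall>\<^sub>F n in sequentially. 8 / \<alpha> \<le> (real n)\<^sup>2"
      using filterlim_pow_at_top[OF _ filterlim_real_sequentially, of 2]
      by (simp add: filterlim_at_top)
    then show ?thesis using eventually_ge_at_top[of 2]
    proof eventually_elim
      case (elim n)
      have "\<alpha> * ((real n)\<^sup>2 / 4) \<le> \<alpha> * real (n choose 2)" using choose_two_ge[OF elim(2)] \<alpha> by (intro mult_left_mono) auto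
      moreover have "1 \<le> \<alpha> / 8 * (real n)\<^sup>2" using elim(1) \<alpha> by (simp add: field_simps)
      ultimately show ?case using time_step_bounds(2)[OF less_imp_le[OF \<alpha>(1)], of n] by linarith
    qed
  qed
  have "\<forall>\<^sub>F n in sequentially. (\<Sum>w\<in>R132 n. (moment_error n (Suc j) (time_step \<alpha> n) w)\<^sup>2) \<le> C / real n * real (card (R132 n))"
    using late eventually_ge_at_top[of 2]
  proof eventually_elim
    case (elim n)
    show ?case using C[OF elim(2,1)] time_step_le[of \<alpha> n] \<alpha> by simp
  qed
  then have "whp (\<lambda>n w. \<bar>moment_error n (Suc j) (time_step \<alpha> n) w\<bar> \<le> \<eta> / 2)"
    using \<eta> by (intro whp_chebyshev) auto
  moreover have "\<forall>\<^sub>F n in sequentially. \<bar>lim_moment (real (time_step \<alpha> n) / real (n choose 2)) (Suc j) - lim_moment \<alpha> (Suc j)\<bar> < \<eta> / 2"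
  proof -
    have "isCont (\<lambda>\<alpha>. lim_moment \<alpha> (Suc j)) \<alpha>"
      using continuous_lim_moment[of "Suc j"] by (simp add: continuous_on_eq_continuous_at)
    from isCont_tendsto_compose[OF this time_step_tendsto]
    have "(\<lambda>n. lim_moment (real (time_step \<alpha> n) / real (n choose 2)) (Suc j)) \<longlonglongrightarrow> lim_moment \<alpha> (Suc j)"
      using \<alpha> by simp
    from tendstoD[OF this, of "\<eta> / 2"] show ?thesis using \<eta> by (simp add: dist_real_def)
  qed
  then have "\<forall>\<^sub>F n in sequentially. \<forall>w\<in>R132 n. \<bar>moment_error n (Suc j) (time_step \<alpha> n) w\<bar> \<le> \<eta> / 2 \<longrightarrow>
      \<bar>emp_moment n (shape (take (time_step \<alpha> n) w)) (Suc j) - lim_moment \<alpha> (Suc j)\<bar> \<le> \<eta>"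
  proof (rule eventually_mono, intro ballI impI)
    fix n w
    assume "\<bar>lim_moment (real (time_step \<alpha> n) / real (n choose 2)) (Suc j) - lim_moment \<alpha> (Suc j)\<bar> < \<eta> / 2"
      "\<bar>moment_error n (Suc j) (time_step \<alpha> n) w\<bar> \<le> \<eta> / 2"
    then show "\<bar>emp_moment n (shape (take (time_step \<alpha> n) w)) (Suc j) - lim_moment \<alpha> (Suc j)\<bar> \<le> \<eta>"
      unfolding moment_error_def by linarith
  qed
  ultimately show ?thesis by (rule whp_mono)
qed

subsection \<open>From moments to the profile\<close>

text \<open>By exchanging summation and integration this is the integral of
  \<open>emp_tail n S x * \<phi> x\<close>. Written with primitives of \<open>\<phi>\<close>, it
  avoids integrating a step function.\<close>

definition test_sum :: "nat \<Rightarrow> nat set \<Rightarrow> (real \<Rightarrow> real) \<Rightarrow> real" where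
  "test_sum n S \<phi> = (\<Sum>s\<in>S. integral {0..real s / real n} \<phi>) / real n"

definition emp_tail :: "nat \<Rightarrow> nat set \<Rightarrow> real \<Rightarrow> real" where
  "emp_tail n S x = real (card {s \<in> S. x * real n \<le> real s}) / real n"

lemma integral_power: "0 \<le> t \<Longrightarrow> integral {0..t} (\<lambda>x. x ^ m) = t ^ Suc m / real (Suc m)"
  for t :: real
proof -
  assume t: "0 \<le> t"
  have "((\<lambda>x. x ^ m) has_integral t ^ Suc m / real (Suc m) - 0 ^ Suc m / real (Suc m)) {0..t}"
  proof (rule fundamental_theorem_of_calculus[OF t])
    fix x :: real
    have "((\<lambda>x. x ^ Suc m / real (Suc m)) has_real_derivative real (Suc m) * x ^ m / real (Suc m)) (at x within {0..t})"
      by (rule has_field_derivative_at_within, rule DERIV_cdivide) (use DERIV_pow[of "Suc m" x] in simp)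
    then show "((\<lambda>x. x ^ Suc m / real (Suc m)) has_vector_derivative x ^ m) (at x within {0..t})"
      by (simp add: has_real_derivative_iff_has_vector_derivative del: of_nat_Suc power_Suc)
  qed
  then show ?thesis by (simp add: integral_unique)
qed

text \<open>The centred difference of a power replaces its derivative; the even Taylor terms cancel,
  and at most \<open>n\<close> parts each contribute an error bounded by
  \<open>C / n^2\<close>.\<close>

lemma emp_moment_test_sum:
  obtains C where "C \<ge> 0" "\<And>n S. n \<ge> 1 \<Longrightarrow> S \<subseteq> {1..n-1} \<Longrightarrow>
    \<bar>emp_moment n S (Suc m) - real (2 * m + 2) * real (2 * m + 1) * test_sum n S (\<lambda>x. x ^ (2 * m))\<bar> \<le> C / real n"
proof -
  define M where "M = 2 * m + 2"
  obtain C where C: "C \<ge> 0" and T: "\<And>w h :: real. \<bar>w\<bar> \<le> 1 \<Longrightarrow> \<bar>h\<bar> \<le> 1 \<Longrightarrow>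
    \<bar>(w + h) ^ M - (w ^ M + real M * w ^ (M - 1) * h + real M * (real M - 1) / 2 * w ^ (M - 2) * h\<^sup>2)\<bar> \<le> C * \<bar>h\<bar> ^ 3"
    using power_taylor[of M] by blast
  show ?thesis
  proof (rule that[OF C])
    fix n :: nat and S :: "nat set" assume n: "n \<ge> 1" and S: "S \<subseteq> {1..n-1}"
    have np: "real n > 0" using n by simp
    have fin: "finite S" by (rule finite_subset[OF S]) simp
    have cS: "real (card S) \<le> real n" using card_mono[OF _ S] n by simp
    let ?g = "\<lambda>s::nat. ((real s + 1/2) / n) ^ M - ((real s - 1/2) / n) ^ M"
    let ?t = "\<lambda>s::nat. real M * (real s / real n) ^ (M - 1) / real n"
    have "emp_moment n S (Suc m) = (\<Sum>s\<in>S. ?g s)"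
    proof -
      have "2 * Suc m = M" by (simp add: M_def)
      then show ?thesis unfolding emp_moment_def power_diff_sum_def
        by (simp only: sum_divide_distrib power_divide) (simp only: diff_divide_distrib)
    qed
    moreover have "real (2 * m + 2) * real (2 * m + 1) * test_sum n S (\<lambda>x. x ^ (2 * m)) = (\<Sum>s\<in>S. ?t s)"
    proof -
      have "test_sum n S (\<lambda>x. x ^ (2 * m)) = (\<Sum>s\<in>S. (real s / real n) ^ (2 * m + 1) / real (2 * m + 1)) / real n"
        unfolding test_sum_def using integral_power[of _ "2 * m"] by simp
      then have "real (2 * m + 2) * real (2 * m + 1) * test_sum n S (\<lambda>x. x ^ (2 * m)) =
        real (2 * m + 2) * real (2 * m + 1) * ((\<Sum>s\<in>S. (real s / real n) ^ (2 * m + 1) / real (2 * m + 1)) / real n)" by simp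
      also have "\<dots> = (\<Sum>s\<in>S. real (2 * m + 2) * real (2 * m + 1) * ((real s / real n) ^ (2 * m + 1) / real (2 * m + 1) / real n))"
        by (simp only: sum_divide_distrib sum_distrib_left)
      also have "\<dots> = (\<Sum>s\<in>S. ?t s)"
      proof (intro sum.cong refl)
        fix s
        have M1: "M - 1 = 2 * m + 1" "2 * m + 2 = M" by (simp_all add: M_def)
        have frac: "x * y * (z / y / c) = x * z / c" if "y \<noteq> 0" for x y z c :: real using that by simp
        show "real (2 * m + 2) * real (2 * m + 1) * ((real s / real n) ^ (2 * m + 1) / real (2 * m + 1) / real n) = ?t s"
          unfolding M1 by (rule frac) simp
      qed
      finally show ?thesis .
    qed
    moreover have "\<bar>(\<Sum>s\<in>S. ?g s) - (\<Sum>s\<in>S. ?t s)\<bar> \<le> C / real n"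
    proof -
      have "\<bar>(\<Sum>s\<in>S. ?g s) - (\<Sum>s\<in>S. ?t s)\<bar> \<le> (\<Sum>s\<in>S. \<bar>?g s - ?t s\<bar>)"
        unfolding sum_subtractf[symmetric] by (rule sum_abs)
      also have "\<dots> \<le> (\<Sum>s\<in>S. C / (real n)\<^sup>2)"
      proof (rule sum_mono)
        fix s assume "s \<in> S"
        then have s: "s \<in> {1..n-1}" using S by blast
        define w where "w = real s / real n"
        define h where "h = 1 / (2 * real n)"
        have w: "\<bar>w\<bar> \<le> 1" using s np by (auto simp: w_def)
        have h: "0 \<le> h" "h \<le> 1" using n by (auto simp: h_def field_simps)
        have e: "(real s + 1/2) / n = w + h" "(real s - 1/2) / n = w + - h" "?t s = 2 * (real M * w ^ (M - 1) * h)"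
          unfolding w_def h_def by (simp_all add: add_divide_distrib diff_divide_distrib)
        have "\<bar>(w + h) ^ M - (w ^ M + real M * w ^ (M - 1) * h + real M * (real M - 1) / 2 * w ^ (M - 2) * h\<^sup>2)\<bar> \<le> C * h ^ 3"
          "\<bar>(w + - h) ^ M - (w ^ M - real M * w ^ (M - 1) * h + real M * (real M - 1) / 2 * w ^ (M - 2) * h\<^sup>2)\<bar> \<le> C * h ^ 3"
          using T[OF w, of h] T[OF w, of "-h"] h by auto
        then have "\<bar>?g s - ?t s\<bar> \<le> 2 * (C * h ^ 3)" unfolding e by linarith
        also have "\<dots> \<le> C / (real n)\<^sup>2"
        proof -
          have "h ^ 3 = h\<^sup>2 * h" by (simp add: power2_eq_square power3_eq_cube)
          also have "\<dots> \<le> h\<^sup>2 * 1" using h by (intro mult_left_mono) auto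
          also have "h\<^sup>2 = 1 / (4 * (real n)\<^sup>2)" by (simp add: h_def power_divide power_mult_distrib)
          finally have h3: "h ^ 3 \<le> 1 / (4 * (real n)\<^sup>2)" by simp
          have "2 * (C * h ^ 3) \<le> 2 * (C * (1 / (4 * (real n)\<^sup>2)))" using mult_left_mono[OF h3 C] by linarith
          also have "\<dots> = C / (real n)\<^sup>2 / 2" by simp
          also have "\<dots> \<le> C / (real n)\<^sup>2"
          proof -
            have half: "x / 2 \<le> x" if "0 \<le> x" for x :: real using that by simp
            show ?thesis by (rule half) (use C in simp)
          qed
          finally show ?thesis .
        qed
        finally show "\<bar>?g s - ?t s\<bar> \<le> C / (real n)\<^sup>2" .
      qed
      also have "\<dots> = real (card S) * (C / (real n)\<^sup>2)" by simp
      also have "\<dots> \<le> real n * (C / (real n)\<^sup>2)" using cS C by (intro mult_right_mono) auto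
      also have "\<dots> = C / real n" using np by (simp add: power2_eq_square)
      finally show ?thesis .
    qed
    ultimately show "\<bar>emp_moment n S (Suc m) - real (2 * m + 2) * real (2 * m + 1) * test_sum n S (\<lambda>x. x ^ (2 * m))\<bar> \<le> C / real n"
      by (simp only:)
  qed
qed

lemma R132_take_subset:
  assumes "w \<in> R132 n"
  shows "shape (take k w) \<subseteq> {1..n-1}"
proof (cases "k \<le> n choose 2")
  case True
  then show ?thesis using R132_state(2)[OF assms] by simp
next
  case False
  then have "take k w = take (n choose 2) w" using R132_length[OF assms] by simp
  then show ?thesis using R132_state(2)[OF assms order_refl] by simp
qed

lemma whp_test_monomial:
  assumes \<alpha>: "0 < \<alpha>" "\<alpha> < 1" and \<eta>: "\<eta> > 0"
  shows "whp (\<lambda>n w. \<bar>test_sum n (shape (take (time_step \<alpha> n) w)) (\<lambda>x. x ^ (2 * m)) -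
    integral {0..1} (\<lambda>x. lim_tail \<alpha> x * x ^ (2 * m))\<bar> \<le> \<eta>)"
proof -
  define A where "A = real (2 * m + 2) * real (2 * m + 1)"
  have "1 * 1 \<le> real (2 * m + 2) * real (2 * m + 1)" by (intro mult_mono) auto
  then have A: "A \<ge> 1" unfolding A_def by linarith
  have "((\<lambda>x. lim_tail \<alpha> x * (A * x ^ (2 * m)) / A) has_integral lim_moment \<alpha> (Suc m) / A) {0..1}"
    unfolding A_def by (intro has_integral_divide lim_tail_moment \<alpha>)
  moreover have "y * (A * z) / A = y * z" for y z :: real
  proof -
    have "A \<noteq> 0" using A by linarith
    then show ?thesis by simp
  qed
  ultimately have "((\<lambda>x. lim_tail \<alpha> x * x ^ (2 * m)) has_integral lim_moment \<alpha> (Suc m) / A) {0..1}"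
    by (simp only:)
  then have I: "integral {0..1} (\<lambda>x. lim_tail \<alpha> x * x ^ (2 * m)) = lim_moment \<alpha> (Suc m) / A"
    by (rule integral_unique)
  have "\<exists>C\<ge>0. \<forall>n S. n \<ge> 1 \<longrightarrow> S \<subseteq> {1..n-1} \<longrightarrow>
    \<bar>emp_moment n S (Suc m) - A * test_sum n S (\<lambda>x. x ^ (2 * m))\<bar> \<le> C / real n"
  proof (rule emp_moment_test_sum[of m])
    fix C :: real assume C0: "C \<ge> 0" and B: "\<And>n S. n \<ge> 1 \<Longrightarrow> S \<subseteq> {1..n-1} \<Longrightarrow>
      \<bar>emp_moment n S (Suc m) - real (2 * m + 2) * real (2 * m + 1) * test_sum n S (\<lambda>x. x ^ (2 * m))\<bar> \<le> C / real n"
    show ?thesis unfolding A_def by (intro exI[of _ C] conjI C0 allI impI B)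
  qed
  then obtain C where C0: "C \<ge> 0" and CB: "\<forall>n S. n \<ge> 1 \<longrightarrow> S \<subseteq> {1..n-1} \<longrightarrow>
    \<bar>emp_moment n S (Suc m) - A * test_sum n S (\<lambda>x. x ^ (2 * m))\<bar> \<le> C / real n"
    by (elim exE conjE) (rule that)
  note C = C0 CB[rule_format]
  have "(\<lambda>n. C / real n) \<longlonglongrightarrow> 0" using tendsto_mult_right_zero[OF lim_1_over_n, of C] by simp
  then have "\<forall>\<^sub>F n in sequentially. C / real n < \<eta> / 2" by (rule order_tendstoD) (use \<eta> in simp)
  then have ev: "\<forall>\<^sub>F n in sequentially. \<forall>w\<in>R132 n.
      \<bar>emp_moment n (shape (take (time_step \<alpha> n) w)) (Suc m) - lim_moment \<alpha> (Suc m)\<bar> \<le> \<eta> / 2 \<longrightarrow>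
      \<bar>test_sum n (shape (take (time_step \<alpha> n) w)) (\<lambda>x. x ^ (2 * m)) -
       integral {0..1} (\<lambda>x. lim_tail \<alpha> x * x ^ (2 * m))\<bar> \<le> \<eta>"
    using eventually_ge_at_top[of 1]
  proof eventually_elim
    case (elim n)
    show ?case
    proof (intro ballI impI)
      fix w assume w: "w \<in> R132 n" and m: "\<bar>emp_moment n (shape (take (time_step \<alpha> n) w)) (Suc m) - lim_moment \<alpha> (Suc m)\<bar> \<le> \<eta> / 2"
      define t where "t = test_sum n (shape (take (time_step \<alpha> n) w)) (\<lambda>x. x ^ (2 * m))"
      have "\<bar>A * t - lim_moment \<alpha> (Suc m)\<bar> \<le> \<eta>"
        using C(2)[OF elim(2) R132_take_subset[OF w], of "time_step \<alpha> n"] m elim(1) unfolding t_def[symmetric] by linarith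
      moreover have "t - lim_moment \<alpha> (Suc m) / A = (A * t - lim_moment \<alpha> (Suc m)) / A" using A by (simp add: field_simps)
      ultimately have "\<bar>t - lim_moment \<alpha> (Suc m) / A\<bar> \<le> \<eta> / A" using A by (simp add: divide_right_mono)
      also have "\<dots> \<le> \<eta> / 1" using A \<eta> by (intro divide_left_mono) auto
      finally show "\<bar>test_sum n (shape (take (time_step \<alpha> n) w)) (\<lambda>x. x ^ (2 * m)) -
       integral {0..1} (\<lambda>x. lim_tail \<alpha> x * x ^ (2 * m))\<bar> \<le> \<eta>" unfolding I t_def by simp
    qed
  qed
  show ?thesis using whp_mono[OF whp_moment[OF \<alpha>, of "\<eta> / 2" m] ev] \<eta> by simp
qed

lemma lim_tail_mult_integrable:
  assumes "0 \<le> \<alpha>" "\<alpha> \<le> 1" "continuous_on {0..1} \<phi>"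
  shows "(\<lambda>x. lim_tail \<alpha> x * \<phi> x) integrable_on {0..1}"
  by (intro integrable_continuous_interval continuous_on_mult continuous_lim_tail assms)

text \<open>Squares separate the points of \<open>[0, 1]\<close>, so polynomials in
  \<open>x^2\<close> already satisfy the hypotheses of Stone-Weierstrass. The even moments thus
  suffice.\<close>

lemma even_polynomial_approximation:
  fixes \<phi> :: "real \<Rightarrow> real"
  assumes "continuous_on {0..1} \<phi>" "e > 0"
  obtains p :: "real poly" where "\<And>x. x \<in> {0..1} \<Longrightarrow> \<bar>\<phi> x - poly p (x\<^sup>2)\<bar> < e"
proof -
  have "\<exists>g. (\<exists>p::real poly. g = (\<lambda>x. poly p (x\<^sup>2))) \<and> (\<forall>x\<in>{0..1}. \<bar>\<phi> x - g x\<bar> < e)"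
  proof (rule Stone_Weierstrass_HOL[where P = "\<lambda>g. \<exists>p::real poly. g = (\<lambda>x. poly p (x\<^sup>2))"])
    show "compact {0..1::real}" by simp
    show "\<exists>p::real poly. (\<lambda>x::real. c) = (\<lambda>x. poly p (x\<^sup>2))" for c
      by (intro exI[of _ "[:c:]"]) simp
    show "continuous_on {0..1} f" if "\<exists>p::real poly. f = (\<lambda>x. poly p (x\<^sup>2))" for f
      using that by (auto intro!: continuous_intros)
    show "\<exists>p::real poly. (\<lambda>x. f x + g x) = (\<lambda>x. poly p (x\<^sup>2))"
      if h: "(\<exists>p::real poly. f = (\<lambda>x. poly p (x\<^sup>2))) \<and> (\<exists>p::real poly. g = (\<lambda>x. poly p (x\<^sup>2)))" for f g
    proof -
      obtain p q :: "real poly" where "f = (\<lambda>x. poly p (x\<^sup>2))" "g = (\<lambda>x. poly q (x\<^sup>2))" using h by blast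
      then show ?thesis by (intro exI[of _ "p + q"]) simp
    qed
    show "\<exists>p::real poly. (\<lambda>x. f x * g x) = (\<lambda>x. poly p (x\<^sup>2))"
      if h: "(\<exists>p::real poly. f = (\<lambda>x. poly p (x\<^sup>2))) \<and> (\<exists>p::real poly. g = (\<lambda>x. poly p (x\<^sup>2)))" for f g
    proof -
      obtain p q :: "real poly" where "f = (\<lambda>x. poly p (x\<^sup>2))" "g = (\<lambda>x. poly q (x\<^sup>2))" using h by blast
      then show ?thesis by (intro exI[of _ "p * q"]) simp
    qed
    show "\<exists>f. (\<exists>p::real poly. f = (\<lambda>x. poly p (x\<^sup>2))) \<and> f x \<noteq> f y"
      if "x \<in> {0..1} \<and> y \<in> {0..1} \<and> x \<noteq> y" for x y :: real
    proof (intro exI conjI)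
      show "(\<lambda>x::real. x\<^sup>2) = (\<lambda>x. poly [:0, 1:] (x\<^sup>2))" by simp
      show "x\<^sup>2 \<noteq> y\<^sup>2" using that by (simp add: power2_eq_iff)
    qed
  qed (use assms in auto)
  then show ?thesis using that by blast
qed

lemma test_sum_diff_le:
  assumes S: "S \<subseteq> {1..n-1}" and n: "n \<ge> 1" and c: "continuous_on {0..1} \<phi>" "continuous_on {0..1} \<psi>"
    and e: "\<And>x. x \<in> {0..1} \<Longrightarrow> \<bar>\<phi> x - \<psi> x\<bar> \<le> e"
  shows "\<bar>test_sum n S \<phi> - test_sum n S \<psi>\<bar> \<le> e"
proof -
  have e0: "e \<ge> 0" using e[of 0] by simp
  have t: "\<bar>integral {0..real s / real n} \<phi> - integral {0..real s / real n} \<psi>\<bar> \<le> e" if "s \<in> S" for s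
  proof -
    let ?t = "real s / real n"
    have "s \<in> {1..n-1}" using S that by blast
    then have t: "0 \<le> ?t" "?t \<le> 1" by auto
    have i: "\<phi> integrable_on {0..?t}" "\<psi> integrable_on {0..?t}"
      using t by (auto intro!: integrable_continuous_interval continuous_on_subset[OF c(1)] continuous_on_subset[OF c(2)])
    have "norm (integral {0..?t} (\<lambda>x. \<phi> x - \<psi> x)) \<le> integral {0..?t} (\<lambda>x. e)"
      using t e by (intro integral_norm_bound_integral integrable_diff i) auto
    also have "\<dots> = ?t * e" using t by simp
    also have "\<dots> \<le> 1 * e" using t e0 by (intro mult_right_mono) auto
    finally show ?thesis using integral_diff[OF i] by simp
  qed
  have "\<bar>test_sum n S \<phi> - test_sum n S \<psi>\<bar> =
     \<bar>\<Sum>s\<in>S. integral {0..real s / real n} \<phi> - integral {0..real s / real n} \<psi>\<bar> / real n"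
    unfolding test_sum_def by (simp add: sum_subtractf diff_divide_distrib[symmetric])
  also have "\<dots> \<le> (real n * e) / real n"
  proof (rule divide_right_mono)
    have "\<bar>\<Sum>s\<in>S. integral {0..real s / real n} \<phi> - integral {0..real s / real n} \<psi>\<bar> \<le>
       (\<Sum>s\<in>S. \<bar>integral {0..real s / real n} \<phi> - integral {0..real s / real n} \<psi>\<bar>)" by (rule sum_abs)
    also have "\<dots> \<le> (\<Sum>s\<in>S. e)" by (intro sum_mono t)
    also have "\<dots> = real (card S) * e" by simp
    also have "\<dots> \<le> real n * e" using card_mono[OF _ S] n e0 by (intro mult_right_mono) auto
    finally show "\<bar>\<Sum>s\<in>S. integral {0..real s / real n} \<phi> - integral {0..real s / real n} \<psi>\<bar> \<le> real n * e" .
  qed simp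
  finally show ?thesis using n by simp
qed

lemma test_sum_sum:
  assumes "finite I" "\<And>i. continuous_on UNIV (f i)"
  shows "test_sum n S (\<lambda>x. \<Sum>i\<in>I. c i * f i x) = (\<Sum>i\<in>I. c i * test_sum n S (f i))"
proof -
  have "integral {0..t} (\<lambda>x. \<Sum>i\<in>I. c i * f i x) = (\<Sum>i\<in>I. c i * integral {0..t} (f i))" for t :: real
  proof -
    have i: "f i integrable_on {0..t}" for i
      by (intro integrable_continuous_interval continuous_on_subset[OF assms(2)]) auto
    have "integral {0..t} (\<lambda>x. \<Sum>i\<in>I. c i * f i x) = (\<Sum>i\<in>I. integral {0..t} (\<lambda>x. c i * f i x))"
      by (intro integral_sum assms(1) integrable_on_mult_right i)
    then show ?thesis by simp
  qed
  then have "test_sum n S (\<lambda>x. \<Sum>i\<in>I. c i * f i x) = (\<Sum>s\<in>S. \<Sum>i\<in>I. c i * integral {0..real s / real n} (f i)) / real n"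
    unfolding test_sum_def by simp
  also have "\<dots> = (\<Sum>i\<in>I. \<Sum>s\<in>S. c i * integral {0..real s / real n} (f i)) / real n"
    by (subst sum.swap) simp
  also have "\<dots> = (\<Sum>i\<in>I. c i * test_sum n S (f i))"
    unfolding test_sum_def by (simp add: sum_divide_distrib sum_distrib_left)
  finally show ?thesis .
qed

text \<open>The error \<open>\<eta>\<close> is divided into two quarters, for replacing
  \<open>\<phi>\<close> by the polynomial in the empirical and in the limiting integral, and one
  half for the finitely many monomials.\<close>

lemma whp_test_sum:
  assumes \<alpha>: "0 < \<alpha>" "\<alpha> < 1" and \<eta>: "\<eta> > 0" and c: "continuous_on {0..1} \<phi>"
  shows "whp (\<lambda>n w. \<bar>test_sum n (shape (take (time_step \<alpha> n) w)) \<phi> - integral {0..1} (\<lambda>x. lim_tail \<alpha> x * \<phi> x)\<bar> \<le> \<eta>)"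
proof -
  obtain p :: "real poly" where p: "\<And>x. x \<in> {0..1} \<Longrightarrow> \<bar>\<phi> x - poly p (x\<^sup>2)\<bar> < \<eta> / 4"
    using even_polynomial_approximation[OF c, of "\<eta> / 4"] \<eta> by auto
  define \<psi> where "\<psi> = (\<lambda>x. \<Sum>i\<in>{..degree p}. coeff p i * x ^ (2 * i))"
  have \<psi>: "\<psi> x = poly p (x\<^sup>2)" for x by (simp add: \<psi>_def poly_altdef power_mult)
  have c\<psi>: "continuous_on A \<psi>" for A unfolding \<psi>_def by (intro continuous_intros)
  \<comment> \<open>The added 1 keeps \<open>K\<close> positive even for the zero polynomial, so
    that the tolerance \<open>\<eta> / (2 K)\<close> per monomial makes sense.\<close>
  define K where "K = 1 + (\<Sum>i\<in>{..degree p}. \<bar>coeff p i\<bar>)"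
  have K: "K \<ge> 1" unfolding K_def by (simp add: sum_nonneg)
  have \<alpha>': "0 \<le> \<alpha>" "\<alpha> \<le> 1" using \<alpha> by auto
  have I\<psi>: "integral {0..1} (\<lambda>x. lim_tail \<alpha> x * \<psi> x) = (\<Sum>i\<in>{..degree p}. coeff p i * integral {0..1} (\<lambda>x. lim_tail \<alpha> x * x ^ (2 * i)))"
  proof -
    have i: "(\<lambda>x. lim_tail \<alpha> x * x ^ (2 * i)) integrable_on {0..1}" for i
      by (intro lim_tail_mult_integrable \<alpha>' continuous_intros)
    have e: "(\<lambda>x. lim_tail \<alpha> x * \<psi> x) = (\<lambda>x. \<Sum>i\<in>{..degree p}. coeff p i * (lim_tail \<alpha> x * x ^ (2 * i)))"
      by (simp add: \<psi>_def sum_distrib_left fun_eq_iff mult.left_commute)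
    have "integral {0..1} (\<lambda>x. lim_tail \<alpha> x * \<psi> x) = (\<Sum>i\<in>{..degree p}. integral {0..1} (\<lambda>x. coeff p i * (lim_tail \<alpha> x * x ^ (2 * i))))"
      unfolding e
      by (intro integral_sum integrable_on_mult_right i) simp
    then show ?thesis by simp
  qed
  have lim_close: "\<bar>integral {0..1} (\<lambda>x. lim_tail \<alpha> x * \<phi> x) - integral {0..1} (\<lambda>x. lim_tail \<alpha> x * \<psi> x)\<bar> \<le> \<eta> / 4"
  proof -
    have i: "(\<lambda>x. lim_tail \<alpha> x * \<phi> x) integrable_on {0..1}" "(\<lambda>x. lim_tail \<alpha> x * \<psi> x) integrable_on {0..1}"
      by (intro lim_tail_mult_integrable \<alpha>' c c\<psi>)+
    have "norm (integral {0..1} (\<lambda>x. lim_tail \<alpha> x * \<phi> x - lim_tail \<alpha> x * \<psi> x)) \<le> integral {0..1} (\<lambda>x::real. \<eta> / 4)"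
    proof (intro integral_norm_bound_integral integrable_diff i)
      fix x :: real assume x: "x \<in> {0..1}"
      have l: "0 \<le> lim_tail \<alpha> x" "lim_tail \<alpha> x \<le> 1" using lim_tail_bounds[OF \<alpha>' x] x by auto
      have "\<bar>lim_tail \<alpha> x * (\<phi> x - \<psi> x)\<bar> = lim_tail \<alpha> x * \<bar>\<phi> x - \<psi> x\<bar>" using l by (simp add: abs_mult)
      also have "\<dots> \<le> 1 * (\<eta> / 4)" using l p[OF x] unfolding \<psi> by (intro mult_mono) auto
      finally show "norm (lim_tail \<alpha> x * \<phi> x - lim_tail \<alpha> x * \<psi> x) \<le> \<eta> / 4" by (simp add: right_diff_distrib)
    qed (intro integrable_continuous_interval continuous_intros)
    then show ?thesis using integral_diff[OF i] by simp
  qed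
  have W: "whp (\<lambda>n w. \<forall>i\<in>{..degree p}. \<bar>test_sum n (shape (take (time_step \<alpha> n) w)) (\<lambda>x. x ^ (2 * i)) -
      integral {0..1} (\<lambda>x. lim_tail \<alpha> x * x ^ (2 * i))\<bar> \<le> \<eta> / (2 * K))"
  proof (rule whp_ball)
    fix i
    show "whp (\<lambda>n w. \<bar>test_sum n (shape (take (time_step \<alpha> n) w)) (\<lambda>x. x ^ (2 * i)) -
      integral {0..1} (\<lambda>x. lim_tail \<alpha> x * x ^ (2 * i))\<bar> \<le> \<eta> / (2 * K))"
      by (rule whp_test_monomial[OF \<alpha>]) (use \<eta> K in simp)
  qed simp
  show ?thesis
  proof (rule whp_mono[OF W], rule eventually_mono[OF eventually_ge_at_top[of 1]], intro ballI impI)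
    fix n w assume n: "n \<ge> 1" and w: "w \<in> R132 n"
      and h: "\<forall>i\<in>{..degree p}. \<bar>test_sum n (shape (take (time_step \<alpha> n) w)) (\<lambda>x. x ^ (2 * i)) -
      integral {0..1} (\<lambda>x. lim_tail \<alpha> x * x ^ (2 * i))\<bar> \<le> \<eta> / (2 * K)"
    let ?S = "shape (take (time_step \<alpha> n) w)"
    have "test_sum n ?S \<psi> = (\<Sum>i\<in>{..degree p}. coeff p i * test_sum n ?S (\<lambda>x. x ^ (2 * i)))"
      unfolding \<psi>_def by (intro test_sum_sum continuous_intros) auto
    then have "\<bar>test_sum n ?S \<psi> - integral {0..1} (\<lambda>x. lim_tail \<alpha> x * \<psi> x)\<bar> =
       \<bar>\<Sum>i\<in>{..degree p}. coeff p i * (test_sum n ?S (\<lambda>x. x ^ (2 * i)) - integral {0..1} (\<lambda>x. lim_tail \<alpha> x * x ^ (2 * i)))\<bar>"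
      unfolding I\<psi> by (simp add: sum_subtractf right_diff_distrib)
    also have "\<dots> \<le> (\<Sum>i\<in>{..degree p}. \<bar>coeff p i * (test_sum n ?S (\<lambda>x. x ^ (2 * i)) - integral {0..1} (\<lambda>x. lim_tail \<alpha> x * x ^ (2 * i)))\<bar>)"
      by (rule sum_abs)
    also have "\<dots> \<le> (\<Sum>i\<in>{..degree p}. \<bar>coeff p i\<bar> * (\<eta> / (2 * K)))"
      unfolding abs_mult using h by (intro sum_mono mult_left_mono) auto
    also have "\<dots> = (K - 1) * (\<eta> / (2 * K))"
    proof -
      have K1: "K - 1 = (\<Sum>i\<in>{..degree p}. \<bar>coeff p i\<bar>)" by (simp add: K_def)
      show ?thesis by (simp only: K1 sum_distrib_right)
    qed
    also have "\<dots> \<le> K * (\<eta> / (2 * K))" using K \<eta> by (intro mult_right_mono) auto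
    also have "\<dots> = \<eta> / 2"
    proof -
      have "K \<noteq> 0" using K by linarith
      then show ?thesis by simp
    qed
    finally have 1: "\<bar>test_sum n ?S \<psi> - integral {0..1} (\<lambda>x. lim_tail \<alpha> x * \<psi> x)\<bar> \<le> \<eta> / 2" .
    have 2: "\<bar>test_sum n ?S \<phi> - test_sum n ?S \<psi>\<bar> \<le> \<eta> / 4"
    proof -
      have p': "\<bar>\<phi> x - \<psi> x\<bar> \<le> \<eta> / 4" if "x \<in> {0..1}" for x
        using p[OF that] unfolding \<psi> by (rule less_imp_le)
      show ?thesis by (intro test_sum_diff_le R132_take_subset[OF w] n c c\<psi> p')
    qed
    show "\<bar>test_sum n ?S \<phi> - integral {0..1} (\<lambda>x. lim_tail \<alpha> x * \<phi> x)\<bar> \<le> \<eta>"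
      using 1 2 lim_close by linarith
  qed
qed

text \<open>Its primitive is 0 up to \<open>a\<close> and constant from \<open>b\<close> on, a
  continuous surrogate for the indicator used in counting parts.\<close>

lemma bump:
  fixes a b :: real
  assumes "0 \<le> a" "a < b" "b \<le> 1"
  shows "\<exists>\<phi> :: real \<Rightarrow> real. continuous_on UNIV \<phi> \<and> (\<forall>x. \<phi> x \<ge> 0) \<and> (\<forall>x. x \<notin> {a..b} \<longrightarrow> \<phi> x = 0) \<and>
    integral {0..1} \<phi> > 0 \<and> (\<forall>t. 0 \<le> t \<longrightarrow> t \<le> a \<longrightarrow> integral {0..t} \<phi> = 0) \<and>
    (\<forall>t. b \<le> t \<longrightarrow> t \<le> 1 \<longrightarrow> integral {0..t} \<phi> = integral {0..1} \<phi>) \<and>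
    (\<forall>t. 0 \<le> t \<longrightarrow> t \<le> 1 \<longrightarrow> 0 \<le> integral {0..t} \<phi> \<and> integral {0..t} \<phi> \<le> integral {0..1} \<phi>)"
proof -
  define \<phi> where "\<phi> = (\<lambda>x. max 0 ((x - a) * (b - x)))"
  have c: "continuous_on A \<phi>" for A unfolding \<phi>_def by (intro continuous_intros)
  have i: "\<phi> integrable_on {u..v}" for u v by (intro integrable_continuous_interval c)
  have nn: "\<phi> x \<ge> 0" for x by (simp add: \<phi>_def)
  have z: "\<phi> x = 0" if "x \<le> a \<or> b \<le> x" for x
  proof -
    have "(x - a) * (b - x) \<le> 0" using that assms by (auto intro: mult_nonneg_nonpos mult_nonpos_nonneg)
    then show ?thesis by (simp add: \<phi>_def)
  qed
  have comb: "integral {0..t} \<phi> + integral {t..1} \<phi> = integral {0..1} \<phi>" if "0 \<le> t" "t \<le> 1" for t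
    by (rule Henstock_Kurzweil_Integration.integral_combine[OF that i])
  have zero: "integral {u..v} \<phi> = 0" if "\<And>x. x \<in> {u..v} \<Longrightarrow> \<phi> x = 0" for u v
    using integral_cong[of "{u..v}" \<phi> "\<lambda>_. 0"] that by simp
  have ge0: "integral {u..v} \<phi> \<ge> 0" for u v by (rule integral_nonneg[OF i]) (rule nn)
  show ?thesis
  proof (intro exI[of _ \<phi>] conjI[of "continuous_on UNIV \<phi>"] conjI[of "\<forall>x. _ x"] conjI[of "_ < _"] allI impI)
    show "continuous_on UNIV \<phi>" by (rule c)
    show "\<phi> x \<ge> 0" for x by (rule nn)
    show "\<phi> x = 0" if "x \<notin> {a..b}" for x using that by (intro z) auto
    show "integral {0..t} \<phi> = 0" if "0 \<le> t" "t \<le> a" for t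
      using that by (intro zero z) auto
    show "integral {0..t} \<phi> = integral {0..1} \<phi>" if "b \<le> t" "t \<le> 1" for t
    proof -
      have "integral {t..1} \<phi> = 0" using that by (intro zero z) auto
      then show ?thesis using comb[of t] that assms by simp
    qed
    show "0 \<le> integral {0..t} \<phi> \<and> integral {0..t} \<phi> \<le> integral {0..1} \<phi>" if "0 \<le> t" "t \<le> 1" for t
      using comb[OF that] ge0[of 0 t] ge0[of t 1] by simp
    show "integral {0..1} \<phi> > 0"
    proof (rule ccontr)
      assume "\<not> integral {0..1} \<phi> > 0"
      then have "integral {0..1} \<phi> = 0" using ge0[of 0 1] by simp
      then have "\<forall>x\<in>{0..1}. \<phi> x = 0"
        using integral_eq_0_iff[of 0 1 \<phi>] c nn by auto
      then have "\<phi> ((a + b) / 2) = 0" using assms by auto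
      moreover have "((a + b) / 2 - a) * (b - (a + b) / 2) > 0" using assms by (intro mult_pos_pos) auto
      ultimately show False by (simp add: \<phi>_def)
    qed
  qed
qed

lemma emp_tail_eq: "emp_tail n S x = real (tail_count S (nat \<lceil>x * real n\<rceil>)) / real n"
proof -
  have "x * real n \<le> real s \<longleftrightarrow> nat \<lceil>x * real n\<rceil> \<le> s" for s by (simp add: ceiling_le_iff nat_le_iff)
  then show ?thesis by (simp add: emp_tail_def tail_count_def)
qed

lemma emp_tail_antimono:
  assumes "finite S" "x \<le> y"
  shows "emp_tail n S y \<le> emp_tail n S x"
proof -
  have "x * real n \<le> y * real n" using assms by (intro mult_right_mono) auto
  then have "card {s \<in> S. y * real n \<le> real s} \<le> card {s \<in> S. x * real n \<le> real s}"
    using assms by (intro card_mono) auto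
  then show ?thesis unfolding emp_tail_def by (intro divide_right_mono) auto
qed

lemma emp_tail_lipschitz:
  assumes "finite S" "0 \<le> x" "x \<le> y" "n \<ge> 1"
  shows "emp_tail n S x \<le> emp_tail n S y + (y - x) + 1 / real n"
proof -
  let ?r = "nat \<lceil>x * real n\<rceil>" and ?r' = "nat \<lceil>y * real n\<rceil>"
  have xy: "0 \<le> x * real n" "x * real n \<le> y * real n" using assms by (auto intro: mult_right_mono)
  then have le: "?r \<le> ?r'" by (intro nat_mono ceiling_mono)
  have "real (tail_count S ?r) \<le> real (tail_count S ?r' + (?r' - ?r))"
    using tail_count_lipschitz[OF assms(1) le] by (simp only: of_nat_le_iff)
  also have "\<dots> = real (tail_count S ?r') + (real ?r' - real ?r)" using le by (simp add: of_nat_diff)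
  also have "\<dots> \<le> real (tail_count S ?r') + (y * real n - x * real n + 1)" using xy by linarith
  finally have "real (tail_count S ?r) / real n \<le> (real (tail_count S ?r') + (y * real n - x * real n + 1)) / real n"
    by (intro divide_right_mono) auto
  also have "\<dots> = real (tail_count S ?r') / real n + (y - x) + 1 / real n" using assms(4) by (simp add: field_simps)
  finally show ?thesis by (simp add: emp_tail_eq)
qed

lemma emp_tail_le:
  assumes "S \<subseteq> {1..n-1}" "n \<ge> 1" "0 \<le> x" "x \<le> 1"
  shows "emp_tail n S x \<le> 1 - x"
proof -
  have xn: "0 \<le> x * real n" "x * real n \<le> real n" using assms by (auto simp: mult_left_le_one_le)
  have "{s \<in> S. nat \<lceil>x * real n\<rceil> \<le> s} \<subseteq> {nat \<lceil>x * real n\<rceil>..<n}"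
  proof
    fix s assume "s \<in> {s \<in> S. nat \<lceil>x * real n\<rceil> \<le> s}"
    moreover from this have "s \<in> {1..n-1}" using assms(1) by blast
    ultimately show "s \<in> {nat \<lceil>x * real n\<rceil>..<n}" using assms(2) by auto
  qed
  then have "tail_count S (nat \<lceil>x * real n\<rceil>) \<le> n - nat \<lceil>x * real n\<rceil>"
    unfolding tail_count_def using card_mono[of "{nat \<lceil>x * real n\<rceil>..<n}"] by fastforce
  moreover have "real (n - nat \<lceil>x * real n\<rceil>) \<le> real n - x * real n" using xn by linarith
  ultimately have "real (tail_count S (nat \<lceil>x * real n\<rceil>)) \<le> real n - x * real n" by linarith
  then have "emp_tail n S x \<le> (real n - x * real n) / real n"
    unfolding emp_tail_eq by (intro divide_right_mono) auto
  also have "\<dots> = 1 - x" using assms by (simp add: diff_divide_distrib)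
  finally show ?thesis .
qed

lemma emp_tail_nonneg: "0 \<le> emp_tail n S x"
  by (simp add: emp_tail_def)

text \<open>Testing against a bump supported on \<open>[a, b]\<close> sandwiches the tail at both ends.\<close>

lemma whp_tail_sandwich:
  assumes \<alpha>: "0 < \<alpha>" "\<alpha> < 1" and \<eta>: "\<eta> > 0" and ab: "0 \<le> a" "a < b" "b \<le> 1"
  shows "whp (\<lambda>n w. emp_tail n (shape (take (time_step \<alpha> n) w)) b \<le> lim_tail \<alpha> a + \<eta> \<and>
     lim_tail \<alpha> b - \<eta> \<le> emp_tail n (shape (take (time_step \<alpha> n) w)) a)"
proof -
  obtain \<phi> :: "real \<Rightarrow> real" where \<phi>: "continuous_on UNIV \<phi>" "\<And>x. \<phi> x \<ge> 0" "\<And>x. x \<notin> {a..b} \<Longrightarrow> \<phi> x = 0"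
    and cp: "integral {0..1} \<phi> > 0" and low: "\<And>t. 0 \<le> t \<Longrightarrow> t \<le> a \<Longrightarrow> integral {0..t} \<phi> = 0"
    and high: "\<And>t. b \<le> t \<Longrightarrow> t \<le> 1 \<Longrightarrow> integral {0..t} \<phi> = integral {0..1} \<phi>"
    and mid: "\<And>t. 0 \<le> t \<Longrightarrow> t \<le> 1 \<Longrightarrow> 0 \<le> integral {0..t} \<phi> \<and> integral {0..t} \<phi> \<le> integral {0..1} \<phi>"
    using bump[OF ab] by blast
  define c where "c = integral {0..1} \<phi>"
  have c: "c > 0" using cp by (simp add: c_def)
  have \<alpha>': "0 \<le> \<alpha>" "\<alpha> \<le> 1" using \<alpha> by auto
  have c\<phi>: "continuous_on {0..1} \<phi>" using \<phi>(1) continuous_on_subset by blast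
  have i\<phi>: "\<phi> integrable_on {0..1}" by (rule integrable_continuous_interval[OF c\<phi>])
  have il: "(\<lambda>x. lim_tail \<alpha> x * \<phi> x) integrable_on {0..1}" by (rule lim_tail_mult_integrable[OF \<alpha>' c\<phi>])
  have ml: "lim_tail \<alpha> y \<le> lim_tail \<alpha> x" if "0 \<le> x" "x \<le> y" "y \<le> 1" for x y
    using lim_tail_mono(1)[OF \<alpha>', of x y] that by (cases "x = y") auto
  have up: "integral {0..1} (\<lambda>x. lim_tail \<alpha> x * \<phi> x) \<le> lim_tail \<alpha> a * c"
  proof -
    have "integral {0..1} (\<lambda>x. lim_tail \<alpha> x * \<phi> x) \<le> integral {0..1} (\<lambda>x. lim_tail \<alpha> a * \<phi> x)"
    proof (intro integral_le il integrable_on_mult_right i\<phi>)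
      fix x :: real assume "x \<in> {0..1}"
      then show "lim_tail \<alpha> x * \<phi> x \<le> lim_tail \<alpha> a * \<phi> x"
        using \<phi>(2)[of x] \<phi>(3)[of x] ml[of a x] ab by (cases "x \<in> {a..b}") (auto intro!: mult_right_mono)
    qed
    then show ?thesis by (simp add: c_def)
  qed
  have lo: "lim_tail \<alpha> b * c \<le> integral {0..1} (\<lambda>x. lim_tail \<alpha> x * \<phi> x)"
  proof -
    have "integral {0..1} (\<lambda>x. lim_tail \<alpha> b * \<phi> x) \<le> integral {0..1} (\<lambda>x. lim_tail \<alpha> x * \<phi> x)"
    proof (intro integral_le il integrable_on_mult_right i\<phi>)
      fix x :: real assume "x \<in> {0..1}"
      then show "lim_tail \<alpha> b * \<phi> x \<le> lim_tail \<alpha> x * \<phi> x"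
        using \<phi>(2)[of x] \<phi>(3)[of x] ml[of x b] ab by (cases "x \<in> {a..b}") (auto intro!: mult_right_mono)
    qed
    then show ?thesis by (simp add: c_def)
  qed
  show ?thesis
  proof (rule whp_mono[OF whp_test_sum[OF \<alpha> mult_pos_pos[OF \<eta> c] c\<phi>]],
      rule eventually_mono[OF eventually_ge_at_top[of 1]], intro ballI impI)
    fix n w assume n: "n \<ge> 1" and w: "w \<in> R132 n"
      and t: "\<bar>test_sum n (shape (take (time_step \<alpha> n) w)) \<phi> - integral {0..1} (\<lambda>x. lim_tail \<alpha> x * \<phi> x)\<bar> \<le> \<eta> * c"
    define S where "S = shape (take (time_step \<alpha> n) w)"
    have S: "S \<subseteq> {1..n-1}" unfolding S_def by (rule R132_take_subset[OF w])
    have fS: "finite S" by (rule finite_subset[OF S]) simp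
    have np: "real n > 0" using n by simp
    have s01: "0 \<le> real s / real n" "real s / real n \<le> 1" if "s \<in> S" for s
    proof -
      have "s \<in> {1..n-1}" using S that by blast
      then show "0 \<le> real s / real n" "real s / real n \<le> 1" by auto
    qed
    have cnt: "(\<Sum>s\<in>S. if x * real n \<le> real s then c else 0) = real (card {s \<in> S. x * real n \<le> real s}) * c" for x
      using fS by (simp add: sum.If_cases Int_def)
    have "emp_tail n S b * c = (\<Sum>s\<in>S. if b * real n \<le> real s then c else 0) / real n"
      unfolding cnt by (simp add: emp_tail_def)
    also have "\<dots> \<le> test_sum n S \<phi>" unfolding test_sum_def
    proof (intro divide_right_mono sum_mono)
      fix s assume s: "s \<in> S"
      have "b * real n \<le> real s \<Longrightarrow> b \<le> real s / real n" using np by (simp add: le_divide_eq)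
      then show "(if b * real n \<le> real s then c else 0) \<le> integral {0..real s / real n} \<phi>"
        using high[of "real s / real n"] mid[of "real s / real n"] s01[OF s] by (auto simp: c_def)
    qed simp
    finally have A: "emp_tail n S b * c \<le> test_sum n S \<phi>" .
    have "test_sum n S \<phi> \<le> (\<Sum>s\<in>S. if a * real n \<le> real s then c else 0) / real n" unfolding test_sum_def
    proof (intro divide_right_mono sum_mono)
      fix s assume s: "s \<in> S"
      have "\<not> a * real n \<le> real s \<Longrightarrow> real s / real n \<le> a" using np by (simp add: divide_le_eq)
      then show "integral {0..real s / real n} \<phi> \<le> (if a * real n \<le> real s then c else 0)"
        using low[of "real s / real n"] mid[of "real s / real n"] s01[OF s] by (auto simp: c_def)
    qed simp
    also have "\<dots> = emp_tail n S a * c" unfolding cnt by (simp add: emp_tail_def)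
    finally have B: "test_sum n S \<phi> \<le> emp_tail n S a * c" .
    have "emp_tail n S b * c \<le> (lim_tail \<alpha> a + \<eta>) * c" "(lim_tail \<alpha> b - \<eta>) * c \<le> emp_tail n S a * c"
      using A B t up lo unfolding S_def[symmetric] distrib_right left_diff_distrib by linarith+
    then show "emp_tail n (shape (take (time_step \<alpha> n) w)) b \<le> lim_tail \<alpha> a + \<eta> \<and>
     lim_tail \<alpha> b - \<eta> \<le> emp_tail n (shape (take (time_step \<alpha> n) w)) a"
      using c unfolding S_def by simp
  qed
qed

text \<open>The sandwich compares the tail at two distinct points, and the limit is 1-Lipschitz in
  space, so a gap \<open>h\<close> below \<open>e / 4\<close> costs little.\<close>

lemma whp_tail:
  assumes \<alpha>: "0 < \<alpha>" "\<alpha> < 1" and e: "e > 0" and x: "0 \<le> x" "x \<le> 1"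
  shows "whp (\<lambda>n w. \<bar>emp_tail n (shape (take (time_step \<alpha> n) w)) x - lim_tail \<alpha> x\<bar> \<le> e)"
proof -
  have \<alpha>': "0 \<le> \<alpha>" "\<alpha> \<le> 1" using \<alpha> by auto
  define h where "h = min (e / 4) (1/2)"
  have h: "0 < h" "h \<le> e / 4" "h \<le> 1/2" using e by (auto simp: h_def)
  have lip: "\<bar>lim_tail \<alpha> u - lim_tail \<alpha> v\<bar> \<le> \<bar>u - v\<bar>" if "u \<in> {0..1}" "v \<in> {0..1}" for u v
    by (rule lim_tail_lipschitz[OF \<alpha>' that])
  have low: "whp (\<lambda>n w. lim_tail \<alpha> x - e \<le> emp_tail n (shape (take (time_step \<alpha> n) w)) x)"
  proof (cases "x = 1")
    case True
    then show ?thesis using lim_tail_at_1[OF \<alpha>'] e emp_tail_nonneg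
      by (intro whp_eventually always_eventually) (auto intro: order_trans[of _ 0])
  next
    case False
    define b where "b = min 1 (x + h)"
    have b: "x < b" "b \<le> 1" "b \<le> x + h" using False x h by (auto simp: b_def)
    have "lim_tail \<alpha> x - e \<le> lim_tail \<alpha> b - e / 4" using lip[of x b] b x h e by auto
    then show ?thesis
      by (intro whp_mono[OF whp_tail_sandwich[OF \<alpha> _ x(1) b(1,2), of "e / 4"]] always_eventually) (use e in auto)
  qed
  have upp: "whp (\<lambda>n w. emp_tail n (shape (take (time_step \<alpha> n) w)) x \<le> lim_tail \<alpha> x + e)"
  proof -
    \<comment> \<open>Near 0 there may be no room to the left of \<open>x\<close>, so
      \<open>b\<close> is pushed right to at least \<open>h\<close>; the empirical Lipschitz bound
      brings the estimate back from \<open>b\<close> to \<open>x\<close> at the price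
      \<open>h + 1 / n\<close>.\<close>
    define a where "a = max 0 (x - h)"
    define b where "b = max x h"
    have ab: "0 \<le> a" "a < b" "b \<le> 1" "x \<le> b" "b - x \<le> h" "\<bar>a - x\<bar> \<le> h" using x h by (auto simp: a_def b_def)
    have l: "lim_tail \<alpha> a \<le> lim_tail \<alpha> x + h" using lip[of a x] ab x by auto
    have "(\<lambda>n. 1 / real n) \<longlonglongrightarrow> 0" by (rule lim_1_over_n)
    then have "\<forall>\<^sub>F n in sequentially. 1 / real n < e / 4" by (rule order_tendstoD) (use e in simp)
    then have ev: "\<forall>\<^sub>F n in sequentially. \<forall>w\<in>R132 n.
      emp_tail n (shape (take (time_step \<alpha> n) w)) b \<le> lim_tail \<alpha> a + e / 4 \<and>
      lim_tail \<alpha> b - e / 4 \<le> emp_tail n (shape (take (time_step \<alpha> n) w)) a \<longrightarrow>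
      emp_tail n (shape (take (time_step \<alpha> n) w)) x \<le> lim_tail \<alpha> x + e"
      using eventually_ge_at_top[of 1]
    proof eventually_elim
      case (elim n)
      show ?case
      proof (intro ballI impI)
        fix w assume w: "w \<in> R132 n" and s: "emp_tail n (shape (take (time_step \<alpha> n) w)) b \<le> lim_tail \<alpha> a + e / 4 \<and>
          lim_tail \<alpha> b - e / 4 \<le> emp_tail n (shape (take (time_step \<alpha> n) w)) a"
        have "finite (shape (take (time_step \<alpha> n) w))" by (rule finite_subset[OF R132_take_subset[OF w]]) simp
        then have "emp_tail n (shape (take (time_step \<alpha> n) w)) x \<le>
            emp_tail n (shape (take (time_step \<alpha> n) w)) b + (b - x) + 1 / real n"
          using x(1) ab(4) elim(2) by (rule emp_tail_lipschitz)
        then show "emp_tail n (shape (take (time_step \<alpha> n) w)) x \<le> lim_tail \<alpha> x + e"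
          using s l ab h elim(1) by linarith
      qed
    qed
    show ?thesis by (rule whp_mono[OF whp_tail_sandwich[OF \<alpha> _ ab(1-3), of "e / 4"] ev]) (use e in simp)
  qed
  show ?thesis
    by (rule whp_mono[OF whp_conj[OF low upp]]) (auto simp: abs_le_iff intro!: always_eventually)
qed

section \<open>Uniform convergence of the empirical tail\<close>

lemma tail_count_take_mono:
  assumes "valid {} w" "k \<le> k'"
  shows "tail_count (shape (take k w)) r \<le> tail_count (shape (take k' w)) r"
  using assms(2)
proof (induction k' rule: dec_induct)
  case (step m)
  show ?case
  proof (cases "m < length w")
    case True
    let ?S = "shape (take m w)"
    have tk: "take (Suc m) w = take m w @ [w ! m]" using True by (simp add: take_Suc_conv_app_nth)
    have v: "valid {} (take m w)" by (rule valid_take[OF assms(1)])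
    have "valid {} (take (Suc m) w)" by (rule valid_take[OF assms(1)])
    then have "can_push ?S (w ! m)" unfolding tk valid_append by (simp add: shape_def)
    then have "tail_count ?S r \<le> tail_count (push ?S (w ! m)) r"
      using tail_count_push shape_props(1,2)[OF v] by simp
    also have "push ?S (w ! m) = shape (take (Suc m) w)" unfolding tk by (simp add: shape_def)
    finally show ?thesis using step.IH by simp
  next
    case False
    then show ?thesis using step.IH by simp
  qed
qed simp

lemma emp_tail_take_mono:
  assumes "w \<in> R132 n" "k \<le> k'"
  shows "emp_tail n (shape (take k w)) x \<le> emp_tail n (shape (take k' w)) x"
proof -
  have "valid {} w" using assms(1) by (simp add: R132_eq)
  from tail_count_take_mono[OF this assms(2)] show ?thesis
    unfolding emp_tail_eq by (intro divide_right_mono) auto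
qed

text \<open>The empirical tail is monotone in time and in space and the limit is uniformly continuous, so
  convergence on a finite grid is uniform convergence.\<close>

lemma whp_tail_uniform:
  assumes e: "e > 0"
  shows "whp (\<lambda>n w. \<forall>k\<le>n choose 2. \<forall>x\<in>{0..1}.
    \<bar>emp_tail n (shape (take k w)) x - lim_tail (real k / real (n choose 2)) x\<bar> \<le> e)"
proof -
  obtain d where d: "d > 0" and U: "\<And>\<alpha> \<alpha>' s s'. \<alpha> \<in> {0..1} \<Longrightarrow> \<alpha>' \<in> {0..1} \<Longrightarrow> s \<in> {0..1} \<Longrightarrow> s' \<in> {0..1} \<Longrightarrow>
    \<bar>\<alpha> - \<alpha>'\<bar> \<le> d \<Longrightarrow> \<bar>s - s'\<bar> \<le> d \<Longrightarrow> \<bar>lim_tail \<alpha> s - lim_tail \<alpha>' s'\<bar> < e / 2"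
    by (rule lim_tail_uniform[of "e / 2"]) (use e in simp, erule that, blast)
  obtain M' where M': "inverse (real (Suc M')) < d" using reals_Archimedean[OF d] ..
  define M where "M = Suc M'"
  have M0: "M \<noteq> 0" "inverse (real M) < d" using M' by (simp_all only: M_def nat.distinct not_False_eq_True)
  have M: "real M > 0" "1 / real M \<le> d" using M0 by (auto simp: inverse_eq_divide)
  define up where "up = (\<lambda>l m n w. emp_tail n (shape (take (time_step (real l / real M) n) w)) (real m / real M)
      \<le> lim_tail (real l / real M) (real m / real M) + e / 2)"
  define lo where "lo = (\<lambda>l m n w. lim_tail (real l / real M) (real m / real M) - e / 2 \<le>
      emp_tail n (shape (take (time_step (real l / real M) n) w)) (real m / real M))"
  \<comment> \<open>Moment concentration covers only interior times. At time 0 the limit is 0 and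
    the lower bound is trivial; at time 1 the limit \<open>1 - x\<close> bounds every tail from
    above. The two missing bounds at the ends are never called upon, since an upper bound uses the
    later grid time and a lower bound the earlier one.\<close>
  have grid: "whp (\<lambda>n w. (1 \<le> l \<longrightarrow> up l m n w) \<and> (l < M \<longrightarrow> lo l m n w))" if l: "l \<le> M" and m: "m \<le> M" for l m
  proof -
    have m01: "0 \<le> real m / real M" "real m / real M \<le> 1" using m M by auto
    consider "l = 0" | "0 < l" "l < M" | "l = M" "0 < l" using l by linarith
    then show ?thesis
    proof cases
      case 1
      have "lim_tail 0 (real m / real M) = 0" by (simp add: lim_tail_def)
      then have "lo 0 m n w" for n w
        using emp_tail_nonneg[of n "shape (take (time_step 0 n) w)" "real m / real M"] e by (simp add: lo_def)
      then show ?thesis using 1 by (intro whp_eventually always_eventually) auto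
    next
      case 2
      have l01: "0 < real l / real M" "real l / real M < 1" using 2 M by auto
      show ?thesis
      proof (rule whp_mono[OF whp_tail[OF l01 _ m01, of "e / 2"]], goal_cases)
        case 1
        show ?case using e by simp
      next
        case 2
        show ?case
        proof (intro always_eventually allI ballI impI conjI, goal_cases)
          case 1
          then show ?case unfolding up_def by linarith
        next
          case 2
          then show ?case unfolding lo_def by linarith
        qed
      qed
    next
      case 3
      have "up M m n w" if "n \<ge> 1" "w \<in> R132 n" for n w
        using emp_tail_le[OF R132_take_subset[OF that(2)] that(1) m01] e M by (simp add: up_def lim_tail_def add_increasing2)
      then show ?thesis using 3
        by (intro whp_eventually eventually_mono[OF eventually_ge_at_top[of 1]]) auto
    qed
  qed
  have W: "whp (\<lambda>n w. \<forall>z\<in>{0..M} \<times> {0..M}. (1 \<le> fst z \<longrightarrow> up (fst z) (snd z) n w) \<and> (fst z < M \<longrightarrow> lo (fst z) (snd z) n w))"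
  proof (rule whp_ball)
    fix z assume "z \<in> {0..M} \<times> {0..M}"
    then show "whp (\<lambda>n w. (1 \<le> fst z \<longrightarrow> up (fst z) (snd z) n w) \<and> (fst z < M \<longrightarrow> lo (fst z) (snd z) n w))"
      by (intro grid) (simp_all add: mem_Times_iff)
  qed simp
  show ?thesis
  proof (rule whp_mono[OF W], rule eventually_mono[OF eventually_ge_at_top[of 2]], intro ballI impI allI)
    fix n w k and x :: real
    assume n: "n \<ge> 2" and w: "w \<in> R132 n" and k: "k \<le> n choose 2" and x: "x \<in> {0..1}"
      and h: "\<forall>z\<in>{0..M} \<times> {0..M}. (1 \<le> fst z \<longrightarrow> up (fst z) (snd z) n w) \<and> (fst z < M \<longrightarrow> lo (fst z) (snd z) n w)"
    define N where "N = real (n choose 2)"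
    have "0 < (real n)\<^sup>2 / 4" using n by simp
    then have N: "N > 0" using choose_two_ge[OF n] unfolding N_def by linarith
    define \<alpha> where "\<alpha> = real k / N"
    have \<alpha>: "0 \<le> \<alpha>" "\<alpha> \<le> 1" using k N by (auto simp: \<alpha>_def N_def)
    then have \<alpha>01: "\<alpha> \<in> {0..1}" by simp
    have cell: "\<exists>l<M. real l / real M \<le> y \<and> y \<le> real (Suc l) / real M" if y: "0 \<le> y" "y \<le> 1" for y
    proof (cases "y = 1")
      case True
      then show ?thesis using M M0 by (intro exI[of _ "M - 1"]) (auto simp: of_nat_diff)
    next
      case False
      define l where "l = nat \<lfloor>y * real M\<rfloor>"
      have y0: "0 \<le> y * real M" using y M by simp
      then have l: "real l \<le> y * real M" "y * real M < real l + 1" unfolding l_def by linarith+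
      have "y * real M < 1 * real M" using y False M by (intro mult_strict_right_mono) auto
      then have "real l < real M" using l by linarith
      then have "l < M" by simp
      moreover have "real l / real M \<le> y" "y \<le> real (Suc l) / real M" using l M by (auto simp: field_simps)
      ultimately show ?thesis by blast
    qed
    obtain l where l: "l < M" "real l / real M \<le> \<alpha>" "\<alpha> \<le> real (Suc l) / real M" using cell[OF \<alpha>] by blast
    obtain m where m: "m < M" "real m / real M \<le> x" "x \<le> real (Suc m) / real M" using cell[of x] x by auto
    have gap: "real (Suc l) / real M - real l / real M = 1 / real M" for l
      by (simp add: diff_divide_distrib[symmetric])
    have in01: "real i / real M \<in> {0..1}" if "i \<le> M" for i using that M by auto
    have fin: "finite (shape (take k' w))" for k' by (rule finite_subset[OF R132_take_subset[OF w]]) simp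
    \<comment> \<open>The tail increases in time and decreases in space, so the upper bound pairs
      the later grid time with the smaller grid point, and the lower bound does the
      opposite.\<close>
    have hl: "up (Suc l) m n w" "lo l (Suc m) n w" using h l m by auto
    have "real k = \<alpha> * N" using N by (simp add: \<alpha>_def)
    have ku: "k \<le> time_step (real (Suc l) / real M) n"
    proof -
      have "\<alpha> * N \<le> real (Suc l) / real M * N" using l N by (intro mult_right_mono) auto
      then have "real k \<le> real (Suc l) / real M * N" using \<open>real k = \<alpha> * N\<close> by simp
      then show ?thesis unfolding time_step_def N_def by (simp add: le_nat_floor)
    qed
    have kl: "time_step (real l / real M) n \<le> k"
    proof -
      have "real l / real M * N \<le> \<alpha> * N" using l N by (intro mult_right_mono) auto
      then have "real (time_step (real l / real M) n) \<le> real k"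
        using time_step_bounds(1)[of "real l / real M" n] \<open>real k = \<alpha> * N\<close> unfolding N_def by simp
      then show ?thesis by simp
    qed
    have "emp_tail n (shape (take k w)) x \<le> emp_tail n (shape (take k w)) (real m / real M)"
      using m by (intro emp_tail_antimono fin)
    also have "\<dots> \<le> emp_tail n (shape (take (time_step (real (Suc l) / real M) n) w)) (real m / real M)"
      by (rule emp_tail_take_mono[OF w ku])
    also have "\<dots> \<le> lim_tail (real (Suc l) / real M) (real m / real M) + e / 2" using hl(1) by (simp add: up_def)
    also have "lim_tail (real (Suc l) / real M) (real m / real M) < lim_tail \<alpha> x + e / 2"
    proof -
      have "\<bar>real (Suc l) / real M - \<alpha>\<bar> \<le> d" using l gap[of l] M by linarith
      moreover have "\<bar>real m / real M - x\<bar> \<le> d" using m gap[of m] M by linarith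
      ultimately have "\<bar>lim_tail (real (Suc l) / real M) (real m / real M) - lim_tail \<alpha> x\<bar> < e / 2"
        by (intro U in01 \<alpha>01 x) (use l m in simp_all)
      then show ?thesis by linarith
    qed
    finally have 1: "emp_tail n (shape (take k w)) x \<le> lim_tail \<alpha> x + e" by simp
    have "lim_tail \<alpha> x - e / 2 < lim_tail (real l / real M) (real (Suc m) / real M)"
    proof -
      have "\<bar>real l / real M - \<alpha>\<bar> \<le> d" using l gap[of l] M by linarith
      moreover have "\<bar>real (Suc m) / real M - x\<bar> \<le> d" using m gap[of m] M by linarith
      ultimately have "\<bar>lim_tail (real l / real M) (real (Suc m) / real M) - lim_tail \<alpha> x\<bar> < e / 2"
        by (intro U in01 \<alpha>01 x) (use l m in simp_all)
      then show ?thesis by linarith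
    qed
    moreover have "lim_tail (real l / real M) (real (Suc m) / real M) - e / 2 \<le>
        emp_tail n (shape (take (time_step (real l / real M) n) w)) (real (Suc m) / real M)" using hl(2) by (simp add: lo_def)
    moreover have "\<dots> \<le> emp_tail n (shape (take k w)) (real (Suc m) / real M)"
      by (rule emp_tail_take_mono[OF w kl])
    moreover have "emp_tail n (shape (take k w)) (real (Suc m) / real M) \<le> emp_tail n (shape (take k w)) x"
      using m by (intro emp_tail_antimono fin)
    ultimately have 2: "lim_tail \<alpha> x - e \<le> emp_tail n (shape (take k w)) x" by linarith
    show "\<bar>emp_tail n (shape (take k w)) x - lim_tail (real k / real (n choose 2)) x\<bar> \<le> e"
      using 1 2 unfolding \<alpha>_def N_def abs_le_iff by linarith
  qed
qed

subsection \<open>Trajectories\<close>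

text \<open>The two branches of \<open>perm_of\<close> become the two equations of
  \<open>on_curve\<close> for the empirical tail. Both are stated at \<open>r = p - 1\<close>: when
  \<open>p - 1\<close> is not a part, the tail counts at \<open>p - 1\<close> and \<open>p\<close>
  agree, and the shift of position leaves the term \<open>1 / n\<close>.\<close>

lemma sigma_inv_position:
  assumes w: "w \<in> R132 n" and k: "k \<le> n choose 2" and i: "i \<in> {1..n}"
  obtains r where "r < n" "sigma_inv n w k i = r + 1"
    "emp_tail n (shape (take k w)) (real r / real n) = real i / real n \<or>
     real r / real n + emp_tail n (shape (take k w)) (real r / real n) + 1 / real n = real i / real n"
proof -
  let ?S = "shape (take k w)"
  have v: "valid {} (take k w)" using R132_state(1)[OF w k] .
  have fS: "finite ?S" using shape_props(1)[OF v] .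
  have "set w \<subseteq> {1..n-1}" using w by (simp add: R132_def sorting_network_def)
  then have bij: "bij_betw (sigma w k) {1..n} {1..n}" by (rule bij_sigma)
  then have "i \<in> sigma w k ` {1..n}" using i by (simp add: bij_betw_def)
  then obtain p where p: "p \<in> {1..n}" "sigma w k p = i" by auto
  have "sigma_inv n w k i = p" unfolding sigma_inv_def
  proof (rule the_equality)
    fix q assume "q \<in> {1..n} \<and> sigma w k q = i"
    then show "q = p" using p bij_betw_imp_inj_on[OF bij] by (auto dest: inj_onD)
  qed (use p in auto)
  then have inv: "sigma_inv n w k i = (p - 1) + 1" using p by simp
  have np: "real n > 0" using i by auto
  have "sigma w k p = perm_of ?S p" using sigma_eq_perm_of[OF v _, of p] k R132_length[OF w] p by simp
  then have perm: "perm_of ?S p = i" using p by simp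
  have et: "emp_tail n ?S (real r / real n) = real (tail_count ?S r) / real n" for r
    unfolding emp_tail_eq using np by simp
  show ?thesis
  proof (rule that[OF _ inv])
    show "p - 1 < n" using p by auto
    show "emp_tail n ?S (real (p - 1) / real n) = real i / real n \<or>
     real (p - 1) / real n + emp_tail n ?S (real (p - 1) / real n) + 1 / real n = real i / real n"
    proof (cases "p - 1 \<in> ?S")
      case True
      then have "tail_count ?S (p - 1) = i" using perm by (simp add: perm_of_def)
      then show ?thesis unfolding et by simp
    next
      case False
      have "tail_count ?S (p - 1) = tail_count ?S p" using tail_count_Suc[OF fS, of "p - 1"] False p by simp
      then have "i = (p - 1) + tail_count ?S (p - 1) + 1" using False perm p by (simp add: perm_of_def)
      then have "real i = real (p - 1) + real (tail_count ?S (p - 1)) + 1" by (simp only: of_nat_add of_nat_1)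
      then show ?thesis unfolding et by (simp add: add_divide_distrib)
    qed
  qed
qed

theorem mainTheorem9:
  fixes \<beta> \<epsilon> :: real
  assumes "0 < \<beta>" "\<beta> < 1" "\<epsilon> > 0"
  shows "(\<lambda>n. real (card {w \<in> R132 n.
              (SUP \<alpha>\<in>{0..1}. \<bar>traj n w (nat \<lfloor>\<beta> * real n\<rfloor>) \<alpha> - frak_t \<beta> \<alpha>\<bar>) > \<epsilon>})
            / real (card (R132 n))) \<longlonglongrightarrow> 0"
proof -
  \<comment> \<open>Half of \<open>\<epsilon>\<close> goes to the stability of the root, the other
    half to the offset \<open>1 / n\<close> between the position \<open>r + 1\<close> and the point
    \<open>r / n\<close>.\<close>
  obtain d where d: "d > 0" and stable: "\<And>\<alpha> t. \<alpha> \<in> {0..1} \<Longrightarrow> t \<in> {0..1} \<Longrightarrow>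
    \<bar>lim_tail \<alpha> t - \<beta>\<bar> < d \<or> \<bar>t + lim_tail \<alpha> t - \<beta>\<bar> < d \<Longrightarrow> \<bar>t - frak_t \<beta> \<alpha>\<bar> < \<epsilon> / 2"
    by (rule on_curve_stable[OF assms(1,2), of "\<epsilon> / 2"]) (use assms(3) in simp, erule that, blast)
  obtain d' where d': "d' > 0" and U: "\<And>\<alpha> \<alpha>' s s'. \<alpha> \<in> {0..1} \<Longrightarrow> \<alpha>' \<in> {0..1} \<Longrightarrow> s \<in> {0..1} \<Longrightarrow> s' \<in> {0..1} \<Longrightarrow>
    \<bar>\<alpha> - \<alpha>'\<bar> \<le> d' \<Longrightarrow> \<bar>s - s'\<bar> \<le> d' \<Longrightarrow> \<bar>lim_tail \<alpha> s - lim_tail \<alpha>' s'\<bar> < d / 4"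
    by (rule lim_tail_uniform[of "d / 4"]) (use d in simp, erule that, blast)
  have lim0: "(\<lambda>n. 1 / real n) \<longlonglongrightarrow> 0" by (rule lim_1_over_n)
  have ev1: "\<forall>\<^sub>F n in sequentially. 1 / real n < c" if "c > 0" for c using order_tendstoD(2)[OF lim0 that] .
  have ev2: "\<forall>\<^sub>F n in sequentially. 1 / d' \<le> real (n choose 2)"
    using filterlim_choose_two by (simp add: filterlim_at_top)
  \<comment> \<open>The condition \<open>1 / n < \<beta>\<close> makes the rounded index at least 1,
    and the last condition makes one swap shorter than \<open>d'\<close> in scaled time.\<close>
  have ev: "\<forall>\<^sub>F n in sequentially. n \<ge> 2 \<and> 1 / real n < d / 8 \<and> 1 / real n < \<epsilon> / 2 \<and> 1 / real n < \<beta> \<and> 1 / d' \<le> real (n choose 2)"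
    by (intro eventually_conj ev1 ev2 eventually_ge_at_top) (use d assms in simp_all)
  have "whp (\<lambda>n w. (SUP \<alpha>\<in>{0..1}. \<bar>traj n w (nat \<lfloor>\<beta> * real n\<rfloor>) \<alpha> - frak_t \<beta> \<alpha>\<bar>) \<le> \<epsilon>)"
  proof (rule whp_mono[OF whp_tail_uniform[of "d / 4"]])
    show "d / 4 > 0" using d by simp
    show "\<forall>\<^sub>F n in sequentially. \<forall>w\<in>R132 n. (\<forall>k\<le>n choose 2. \<forall>x\<in>{0..1}.
        \<bar>emp_tail n (shape (take k w)) x - lim_tail (real k / real (n choose 2)) x\<bar> \<le> d / 4) \<longrightarrow>
        (SUP \<alpha>\<in>{0..1}. \<bar>traj n w (nat \<lfloor>\<beta> * real n\<rfloor>) \<alpha> - frak_t \<beta> \<alpha>\<bar>) \<le> \<epsilon>"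
      using ev
    proof (rule eventually_mono, intro ballI impI)
      fix n w
      assume nn: "n \<ge> 2 \<and> 1 / real n < d / 8 \<and> 1 / real n < \<epsilon> / 2 \<and> 1 / real n < \<beta> \<and> 1 / d' \<le> real (n choose 2)"
        and w: "w \<in> R132 n" and h: "\<forall>k\<le>n choose 2. \<forall>x\<in>{0..1}.
        \<bar>emp_tail n (shape (take k w)) x - lim_tail (real k / real (n choose 2)) x\<bar> \<le> d / 4"
      have n: "n \<ge> 2" and n1: "1 / real n < d / 8" "1 / real n < \<epsilon> / 2" "1 / real n < \<beta>" and Nd: "1 / d' \<le> real (n choose 2)"
        using nn by auto
      have np: "real n > 0" using n by simp
      define i where "i = nat \<lfloor>\<beta> * real n\<rfloor>"
      have bn: "0 \<le> \<beta> * real n" "\<beta> * real n < real n" using assms np by auto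
      have i1: "real i \<le> \<beta> * real n" "\<beta> * real n - 1 < real i" unfolding i_def using bn by linarith+
      have "1 < \<beta> * real n" using n1(3) np by (simp add: field_simps)
      then have iin: "i \<in> {1..n}" using i1 bn by auto
      have ib: "\<bar>real i / real n - \<beta>\<bar> \<le> 1 / real n"
      proof -
        have "real i / real n - \<beta> = (real i - \<beta> * real n) / real n" using np by (simp add: diff_divide_distrib)
        then have "\<bar>real i / real n - \<beta>\<bar> = \<bar>real i - \<beta> * real n\<bar> / real n" using np by simp
        also have "\<dots> \<le> 1 / real n" using i1 by (intro divide_right_mono) auto
        finally show ?thesis .
      qed
      define N where "N = real (n choose 2)"
      have "1 / d' > 0" using d' by simp
      then have N: "N > 0" using Nd unfolding N_def by linarith
      have Nd': "1 / N \<le> d'" using Nd d' N unfolding N_def[symmetric] by (simp add: field_simps)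
      \<comment> \<open>The time \<open>\<alpha>\<close> may differ from \<open>k / N\<close> by a
        full step, so that both ends of an interpolation interval are covered. The defect is below
        \<open>d\<close>: \<open>d / 4\<close> each for the tail and the time shift,
        \<open>d / 8\<close> each for rounding \<open>\<beta> n\<close> and for the term
        \<open>1 / n\<close>.\<close>
      have close: "\<bar>real (sigma_inv n w k i) / real n - frak_t \<beta> \<alpha>\<bar> \<le> \<epsilon>"
        if k: "k \<le> n choose 2" and \<alpha>: "\<alpha> \<in> {0..1}" "\<bar>\<alpha> - real k / N\<bar> \<le> 1 / N" for k \<alpha>
      proof -
        obtain r where r: "r < n" "sigma_inv n w k i = r + 1"
          "emp_tail n (shape (take k w)) (real r / real n) = real i / real n \<or>
           real r / real n + emp_tail n (shape (take k w)) (real r / real n) + 1 / real n = real i / real n"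
          by (rule sigma_inv_position[OF w k iin])
        define t where "t = real r / real n"
        have t: "t \<in> {0..1}" using r(1) np by (auto simp: t_def)
        have kN: "real k / N \<in> {0..1}" using k N by (auto simp: N_def)
        have "\<bar>emp_tail n (shape (take k w)) t - lim_tail (real k / N) t\<bar> \<le> d / 4"
          using h k t by (simp add: N_def)
        moreover have "\<bar>lim_tail \<alpha> t - lim_tail (real k / N) t\<bar> < d / 4"
          using U[OF \<alpha>(1) kN t t] \<alpha>(2) Nd' d' by simp
        ultimately have near: "\<bar>emp_tail n (shape (take k w)) t - lim_tail \<alpha> t\<bar> < d / 2" by linarith
        have ib8: "\<bar>real i / real n - \<beta>\<bar> < d / 8" using ib n1(1) by (rule le_less_trans)
        have "0 < 1 / real n" using np by simp
        from r(3)[folded t_def] have "\<bar>lim_tail \<alpha> t - \<beta>\<bar> < d \<or> \<bar>t + lim_tail \<alpha> t - \<beta>\<bar> < d"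
        proof
          assume "emp_tail n (shape (take k w)) t = real i / real n"
          then have "\<bar>lim_tail \<alpha> t - \<beta>\<bar> < d" using near ib8 d by linarith
          then show ?thesis ..
        next
          assume "t + emp_tail n (shape (take k w)) t + 1 / real n = real i / real n"
          then have "\<bar>t + lim_tail \<alpha> t - \<beta>\<bar> < d" using near ib8 d n1(1) \<open>0 < 1 / real n\<close> by linarith
          then show ?thesis ..
        qed
        then have "\<bar>t - frak_t \<beta> \<alpha>\<bar> < \<epsilon> / 2" by (rule stable[OF \<alpha>(1) t])
        moreover have "real (sigma_inv n w k i) / real n = t + 1 / real n"
          unfolding r(2) t_def by (simp add: add_divide_distrib)
        moreover have "0 < 1 / real n" using np by simp
        ultimately show ?thesis using n1(2) by linarith
      qed
      have "\<bar>traj n w i \<alpha> - frak_t \<beta> \<alpha>\<bar> \<le> \<epsilon>" if \<alpha>: "\<alpha> \<in> {0..1}" for \<alpha>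
      proof -
        define k where "k = nat \<lfloor>\<alpha> * N\<rfloor>"
        define s where "s = \<alpha> * N - real k"
        have "0 \<le> \<alpha> * N" using \<alpha> N by simp
        then have k: "real k \<le> \<alpha> * N" "\<alpha> * N < real k + 1" unfolding k_def by linarith+
        have s: "0 \<le> s" "s < 1" using k by (auto simp: s_def)
        have "\<alpha> * N \<le> 1 * N" using \<alpha> N by (intro mult_right_mono) auto
        then have kN: "k \<le> n choose 2" using k unfolding N_def by linarith
        define A where "A = real (sigma_inv n w k i) / real n"
        define B where "B = real (sigma_inv n w (k + 1) i) / real n"
        have tr: "traj n w i \<alpha> = (1 - s) * A + s * B"
          unfolding traj_def Let_def A_def B_def s_def k_def N_def by simp
        have q: "\<alpha> = \<alpha> * N / N" using N by simp
        have "\<alpha> - real k / N = s / N" by (subst q) (simp add: s_def diff_divide_distrib)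
        moreover have "\<bar>s / N\<bar> \<le> 1 / N" using s N by (simp add: divide_right_mono)
        ultimately have a: "\<bar>A - frak_t \<beta> \<alpha>\<bar> \<le> \<epsilon>" unfolding A_def using close[OF kN \<alpha>] by simp
        \<comment> \<open>The factor \<open>s\<close> is kept because at \<open>\<alpha> = 1\<close>
          the index \<open>k + 1\<close> exceeds the length of the network; there
          \<open>s = 0\<close> and the value of \<open>B\<close> is irrelevant.\<close>
        have b: "s * \<bar>B - frak_t \<beta> \<alpha>\<bar> \<le> s * \<epsilon>"
        proof (cases "s = 0")
          case False
          then have "real k < N" using s \<open>\<alpha> * N \<le> 1 * N\<close> by (simp add: s_def)
          then have kN': "k + 1 \<le> n choose 2" unfolding N_def by simp
          have "s - 1 = \<alpha> * N - real (k + 1)" by (simp add: s_def)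
          then have "\<alpha> - real (k + 1) / N = (s - 1) / N"
            by (simp only: diff_divide_distrib q[symmetric])
          moreover have "\<bar>(s - 1) / N\<bar> \<le> 1 / N" using s N by (simp add: divide_right_mono)
          ultimately have "\<bar>B - frak_t \<beta> \<alpha>\<bar> \<le> \<epsilon>" unfolding B_def using close[OF kN' \<alpha>] by simp
          then show ?thesis using s by (intro mult_left_mono)
        qed simp
        have "traj n w i \<alpha> - frak_t \<beta> \<alpha> = (1 - s) * (A - frak_t \<beta> \<alpha>) + s * (B - frak_t \<beta> \<alpha>)"
          unfolding tr by (simp add: algebra_simps)
        then have "\<bar>traj n w i \<alpha> - frak_t \<beta> \<alpha>\<bar> \<le> \<bar>(1 - s) * (A - frak_t \<beta> \<alpha>)\<bar> + \<bar>s * (B - frak_t \<beta> \<alpha>)\<bar>"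
          by (simp only: abs_triangle_ineq)
        also have "\<dots> = (1 - s) * \<bar>A - frak_t \<beta> \<alpha>\<bar> + s * \<bar>B - frak_t \<beta> \<alpha>\<bar>" using s by (simp add: abs_mult)
        also have "\<dots> \<le> (1 - s) * \<epsilon> + s * \<epsilon>" using mult_left_mono[OF a, of "1 - s"] b s by linarith
        also have "\<dots> = \<epsilon>" by (simp add: algebra_simps)
        finally show ?thesis .
      qed
      then show "(SUP \<alpha>\<in>{0..1}. \<bar>traj n w (nat \<lfloor>\<beta> * real n\<rfloor>) \<alpha> - frak_t \<beta> \<alpha>\<bar>) \<le> \<epsilon>"
        unfolding i_def[symmetric] by (intro cSUP_least) simp
    qed
  qed
  then show ?thesis by (simp add: whp_def not_le)
qed

end
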